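(* Let $\mathbf E$ be an additive DG-category with shifts and cones. Then any DG-compatible exact category structure on $\mathsf Z^0(\mathbf E)$ admits a unique $\natural$-compatible exact category structure on $\mathsf Z^0(\mathbf E^\natural)$.
   Context: Gradings: fix an abelian group $\Gamma$, a symmetric bilinear form $\sigma\colon\Gamma\times\Gamma\to\mathbb Z/2$ and an element $\mathbf 1\in\Gamma$ with $\sigma(\mathbf 1,\mathbf 1)=1$; complexes are $\Gamma$-graded with differentials of degree $\mathbf 1$ (an integer $n$ denotes $n\cdot\mathbf 1$; $(-1)^i$ means $(-1)^{\sigma(\mathbf 1,i)}$), with the Koszul sign rule (standard case: $\Gamma=\mathbb Z$). A DG-category $\mathbf A$ is a category enriched in complexes of abelian groups; $\mathsf Z^0(\mathbf A)$ is the preadditive category with the same objects and the degree-$0$ cocycles (closed morphisms of degree $0$) as morphisms; $\mathbf A$ is additive if $\mathsf Z^0(\mathbf A)$ is. Shift $X[i]$: an object with mutually inverse closed morphisms in $\operatorname{Hom}^{-i}_{\mathbf A}(X,X[i])$ and $\operatorname{Hom}^{i}_{\mathbf A}(X[i],X)$. The cone of a closed degree-$0$ morphism $f\colon X\to Y$ is an object representing, functorially in $Z$, the cone of $\operatorname{Hom}^\bullet_{\mathbf A}(Z,X)\to\operatorname{Hom}^\bullet_{\mathbf A}(Z,Y)$. The DG-category $\mathbf E^\natural$: objects are pairs $(X,\sigma_X)$ with $X\in\mathbf E$, $\sigma_X\in\operatorname{Hom}^{-1}_{\mathbf E}(X,X)$, $d(\sigma_X)=\mathrm{id}_X$, $\sigma_X^2=0$;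 $\operatorname{Hom}^i_{\mathbf E^\natural}((X,\sigma_X),(Y,\sigma_Y))$ is the group of closed morphisms $X\to Y$ of degree $-i$ in $\mathbf E$, with differential $d^\natural(f)=\sigma_Yf-(-1)^if\sigma_X$. The functor $\Phi_{\mathbf E}\colon\mathsf Z^0(\mathbf E)\to\mathsf Z^0(\mathbf E^\natural)$ takes $A$ to $E=\operatorname{cone}(\mathrm{id}_A[-1])$ with its natural contracting homotopy $\sigma_E=\iota'\pi'$, where $\iota\in\operatorname{Hom}^1(A,E)$, $\pi\in\operatorname{Hom}^0(E,A)$, $\pi'\in\operatorname{Hom}^{-1}(E,A)$, $\iota'\in\operatorname{Hom}^0(A,E)$ are the structure morphisms of the cone ($\pi'\iota'=0=\pi\iota$, $\pi'\iota=\mathrm{id}_A=\pi\iota'$, $\iota\pi'+\iota'\pi=\mathrm{id}_E$, $d\iota=0=d\pi$, $d\pi'=\pi$, $d\iota'=\iota$). The functor $\Psi^+_{\mathbf E}\colon\mathsf Z^0(\mathbf E^\natural)\to\mathsf Z^0(\mathbf E)$ takes $(X,\sigma_X)$ to $X$. Exact categories are in the sense of Quillen, with a class of "admissible" short exact sequences. An additive functor between exact categories preserves (resp. reflects) admissible short exact sequences if it takes them to admissible short exact sequences (resp. if a composable pair of morphisms whose image is an admissible short exact sequence is itself one). An exact structure on $\mathsf Z^0(\mathbf E)$ is DG-compatible if it is preserved by the shifts $[1]$, $[-1]$ and, for every object $E$, the natural sequence $0\to E[-1]\to\operatorname{cone}(\mathrm{id}_E[-1])\to E\to0$ is an admissible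 short exact sequence. Exact structures on $\mathsf Z^0(\mathbf E)$ and $\mathsf Z^0(\mathbf E^\natural)$ are $\natural$-compatible with each other if both are preserved by $[1]$, $[-1]$ and both functors $\Phi_{\mathbf E}$ and $\Psi^+_{\mathbf E}$ preserve and reflect admissible short exact sequences. *)

theory Defs
  imports Main "HOL-Library.Z2"
begin

section \<open>Preadditive, additive and exact categories\<close>

text \<open>
  Morphism groups are subgroups of one ambient abelian group, the type \<open>'m\<close>, and composition is a
  single operation on that type; only its values on composable morphisms matter.  This is no
  restriction up to isomorphism: any family of abelian groups embeds independently into one group
  of functions (into a product of copies of the circle group), and composition can be transported
  along the embedding.  Different morphism sets may overlap, so a morphism is always considered
  together with its source and target.
\<close>

record ('o, 'm) cat_data =
  Ob :: "'o set"
  cmp :: "'m \<Rightarrow> 'm \<Rightarrow> 'm"  (infixl "\<cdot>\<index>" 70)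
  idm :: "'o \<Rightarrow> 'm"

record ('o, 'm) precat = "('o, 'm) cat_data" +
  Mor :: "'o \<Rightarrow> 'o \<Rightarrow> 'm set"

definition subgrp :: "'m::ab_group_add set \<Rightarrow> bool" where
  "subgrp H \<longleftrightarrow> 0 \<in> H \<and> (\<forall>a\<in>H. \<forall>b\<in>H. a + b \<in> H) \<and> (\<forall>a\<in>H. - a \<in> H)"

locale preadditive_category =
  fixes C :: "('o, 'm::ab_group_add) precat" (structure)
  assumes Mor_subgrp: "X \<in> Ob C \<Longrightarrow> Y \<in> Ob C \<Longrightarrow> subgrp (Mor C X Y)"
    and Id_Mor: "X \<in> Ob C \<Longrightarrow> idm C X \<in> Mor C X X"
    and cmp_Mor: "\<lbrakk>X \<in> Ob C; Y \<in> Ob C; Z \<in> Ob C; f \<in> Mor C X Y; g \<in> Mor C Y Z\<rbrakk>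
      \<Longrightarrow> g \<cdot> f \<in> Mor C X Z"
    and cmp_assoc: "\<lbrakk>W \<in> Ob C; X \<in> Ob C; Y \<in> Ob C; Z \<in> Ob C;
      f \<in> Mor C W X; g \<in> Mor C X Y; h \<in> Mor C Y Z\<rbrakk> \<Longrightarrow> (h \<cdot> g) \<cdot> f = h \<cdot> (g \<cdot> f)"
    and cmp_Id: "\<lbrakk>X \<in> Ob C; Y \<in> Ob C; f \<in> Mor C X Y\<rbrakk> \<Longrightarrow> f \<cdot> idm C X = f"
    and Id_cmp: "\<lbrakk>X \<in> Ob C; Y \<in> Ob C; f \<in> Mor C X Y\<rbrakk> \<Longrightarrow> idm C Y \<cdot> f = f"
    and cmp_add: "\<lbrakk>X \<in> Ob C; Y \<in> Ob C; Z \<in> Ob C; f \<in> Mor C X Y; f' \<in> Mor C X Y; g \<in> Mor C Y Z\<rbrakk>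
      \<Longrightarrow> g \<cdot> (f + f') = g \<cdot> f + g \<cdot> f'"
    and add_cmp: "\<lbrakk>X \<in> Ob C; Y \<in> Ob C; Z \<in> Ob C; f \<in> Mor C X Y; g \<in> Mor C Y Z; g' \<in> Mor C Y Z\<rbrakk>
      \<Longrightarrow> (g + g') \<cdot> f = g \<cdot> f + g' \<cdot> f"

definition is_zero_object :: "('o, 'm::ab_group_add) precat \<Rightarrow> 'o \<Rightarrow> bool" where
  "is_zero_object C N \<longleftrightarrow> N \<in> Ob C \<and> (\<forall>X\<in>Ob C. Mor C X N = {0} \<and> Mor C N X = {0})"

definition is_biproduct :: "('o, 'm::ab_group_add) precat \<Rightarrow> 'o \<Rightarrow> 'o \<Rightarrow> 'o \<Rightarrow> bool" where
  "is_biproduct C X Y P \<longleftrightarrow> P \<in> Ob C \<and>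
    (\<exists>i\<in>Mor C X P. \<exists>j\<in>Mor C Y P. \<exists>p\<in>Mor C P X. \<exists>q\<in>Mor C P Y.
       p \<cdot>\<^bsub>C\<^esub> i = idm C X \<and> q \<cdot>\<^bsub>C\<^esub> j = idm C Y \<and> q \<cdot>\<^bsub>C\<^esub> i = 0 \<and> p \<cdot>\<^bsub>C\<^esub> j = 0 \<and>
       i \<cdot>\<^bsub>C\<^esub> p + j \<cdot>\<^bsub>C\<^esub> q = idm C P)"

definition additive_category :: "('o, 'm::ab_group_add) precat \<Rightarrow> bool" where
  "additive_category C \<longleftrightarrow> preadditive_category C \<and> (\<exists>N. is_zero_object C N) \<and>
    (\<forall>X\<in>Ob C. \<forall>Y\<in>Ob C. \<exists>P. is_biproduct C X Y P)"

definition is_iso :: "('o, 'm::ab_group_add) precat \<Rightarrow> 'o \<Rightarrow> 'o \<Rightarrow> 'm \<Rightarrow> bool" where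
  "is_iso C X Y f \<longleftrightarrow> f \<in> Mor C X Y \<and>
    (\<exists>g\<in>Mor C Y X. g \<cdot>\<^bsub>C\<^esub> f = idm C X \<and> f \<cdot>\<^bsub>C\<^esub> g = idm C Y)"

text \<open>A composable pair \<open>X \<rightarrow> Y \<rightarrow> Z\<close> is the tuple \<open>(X, f, Y, g, Z)\<close>.\<close>

type_synonym ('o, 'm) seq = "'o \<times> 'm \<times> 'o \<times> 'm \<times> 'o"

definition composable :: "('o, 'm) precat \<Rightarrow> ('o, 'm) seq \<Rightarrow> bool" where
  "composable C = (\<lambda>(X, f, Y, g, Z).
     X \<in> Ob C \<and> Y \<in> Ob C \<and> Z \<in> Ob C \<and> f \<in> Mor C X Y \<and> g \<in> Mor C Y Z)"

definition kernel_cokernel_pair :: "('o, 'm::ab_group_add) precat \<Rightarrow> ('o, 'm) seq \<Rightarrow> bool" where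
  "kernel_cokernel_pair C = (\<lambda>(X, f, Y, g, Z).
     composable C (X, f, Y, g, Z) \<and> g \<cdot>\<^bsub>C\<^esub> f = 0 \<and>
     (\<forall>W\<in>Ob C. \<forall>h\<in>Mor C W Y. g \<cdot>\<^bsub>C\<^esub> h = 0 \<longrightarrow> (\<exists>!k. k \<in> Mor C W X \<and> f \<cdot>\<^bsub>C\<^esub> k = h)) \<and>
     (\<forall>W\<in>Ob C. \<forall>h\<in>Mor C Y W. h \<cdot>\<^bsub>C\<^esub> f = 0 \<longrightarrow> (\<exists>!k. k \<in> Mor C Z W \<and> k \<cdot>\<^bsub>C\<^esub> g = h)))"

definition seq_iso :: "('o, 'm::ab_group_add) precat \<Rightarrow> ('o, 'm) seq \<Rightarrow> ('o, 'm) seq \<Rightarrow> bool" where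
  "seq_iso C = (\<lambda>(X, f, Y, g, Z) (X', f', Y', g', Z').
     \<exists>a b c. is_iso C X X' a \<and> is_iso C Y Y' b \<and> is_iso C Z Z' c \<and>
       b \<cdot>\<^bsub>C\<^esub> f = f' \<cdot>\<^bsub>C\<^esub> a \<and> c \<cdot>\<^bsub>C\<^esub> g = g' \<cdot>\<^bsub>C\<^esub> b)"

definition admissible_mono :: "('o, 'm) seq set \<Rightarrow> 'o \<Rightarrow> 'o \<Rightarrow> 'm \<Rightarrow> bool" where
  "admissible_mono \<E> X Y f \<longleftrightarrow> (\<exists>Z g. (X, f, Y, g, Z) \<in> \<E>)"

definition admissible_epi :: "('o, 'm) seq set \<Rightarrow> 'o \<Rightarrow> 'o \<Rightarrow> 'm \<Rightarrow> bool" where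
  "admissible_epi \<E> Y Z g \<longleftrightarrow> (\<exists>X f. (X, f, Y, g, Z) \<in> \<E>)"

text \<open>The square \<open>X \<rightarrow> Y\<close>, \<open>X \<rightarrow> X'\<close>, \<open>X' \<rightarrow> P\<close>, \<open>Y \<rightarrow> P\<close> with maps \<open>f, a, f', b\<close>.\<close>

definition is_pushout ::
  "('o, 'm::ab_group_add) precat \<Rightarrow> 'o \<Rightarrow> 'o \<Rightarrow> 'o \<Rightarrow> 'm \<Rightarrow> 'm \<Rightarrow> 'o \<Rightarrow> 'm \<Rightarrow> 'm \<Rightarrow> bool" where
  "is_pushout C X Y X' f a P f' b \<longleftrightarrow>
     P \<in> Ob C \<and> f' \<in> Mor C X' P \<and> b \<in> Mor C Y P \<and> b \<cdot>\<^bsub>C\<^esub> f = f' \<cdot>\<^bsub>C\<^esub> a \<and>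
     (\<forall>W\<in>Ob C. \<forall>p\<in>Mor C X' W. \<forall>q\<in>Mor C Y W. q \<cdot>\<^bsub>C\<^esub> f = p \<cdot>\<^bsub>C\<^esub> a \<longrightarrow>
        (\<exists>!k. k \<in> Mor C P W \<and> k \<cdot>\<^bsub>C\<^esub> f' = p \<and> k \<cdot>\<^bsub>C\<^esub> b = q))"

text \<open>The square \<open>P \<rightarrow> Z'\<close>, \<open>P \<rightarrow> Y\<close>, \<open>Y \<rightarrow> Z\<close>, \<open>Z' \<rightarrow> Z\<close> with maps \<open>g', b, g, a\<close>.\<close>

definition is_pullback ::
  "('o, 'm::ab_group_add) precat \<Rightarrow> 'o \<Rightarrow> 'o \<Rightarrow> 'o \<Rightarrow> 'm \<Rightarrow> 'm \<Rightarrow> 'o \<Rightarrow> 'm \<Rightarrow> 'm \<Rightarrow> bool" where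
  "is_pullback C Y Z Z' g a P g' b \<longleftrightarrow>
     P \<in> Ob C \<and> g' \<in> Mor C P Z' \<and> b \<in> Mor C P Y \<and> g \<cdot>\<^bsub>C\<^esub> b = a \<cdot>\<^bsub>C\<^esub> g' \<and>
     (\<forall>W\<in>Ob C. \<forall>p\<in>Mor C W Z'. \<forall>q\<in>Mor C W Y. g \<cdot>\<^bsub>C\<^esub> q = a \<cdot>\<^bsub>C\<^esub> p \<longrightarrow>
        (\<exists>!k. k \<in> Mor C W P \<and> g' \<cdot>\<^bsub>C\<^esub> k = p \<and> b \<cdot>\<^bsub>C\<^esub> k = q))"

text \<open>
  Quillen's exact categories in the axiomatization of Keller and Buehler (Exact Categories,
  Definition 2.1).  Quillen's remaining requirements (split sequences are admissible; the
  ``obscure axiom'') follow from these axioms.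
\<close>

definition exact_structure :: "('o, 'm::ab_group_add) precat \<Rightarrow> ('o, 'm) seq set \<Rightarrow> bool" where
  "exact_structure C \<E> \<longleftrightarrow>
     additive_category C \<and>
     (\<forall>s\<in>\<E>. kernel_cokernel_pair C s) \<and>
     (\<forall>s\<in>\<E>. \<forall>s'. composable C s' \<and> seq_iso C s s' \<longrightarrow> s' \<in> \<E>) \<and>
     (\<forall>X\<in>Ob C. admissible_mono \<E> X X (idm C X) \<and> admissible_epi \<E> X X (idm C X)) \<and>
     (\<forall>X Y Z f g. admissible_mono \<E> X Y f \<and> admissible_mono \<E> Y Z g \<longrightarrow>
        admissible_mono \<E> X Z (g \<cdot>\<^bsub>C\<^esub> f)) \<and>
     (\<forall>X Y Z f g. admissible_epi \<E> X Y f \<and> admissible_epi \<E> Y Z g \<longrightarrow>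
        admissible_epi \<E> X Z (g \<cdot>\<^bsub>C\<^esub> f)) \<and>
     (\<forall>X Y f. admissible_mono \<E> X Y f \<longrightarrow> (\<forall>X'\<in>Ob C. \<forall>a\<in>Mor C X X'.
        \<exists>P f' b. is_pushout C X Y X' f a P f' b \<and> admissible_mono \<E> X' P f')) \<and>
     (\<forall>Y Z g. admissible_epi \<E> Y Z g \<longrightarrow> (\<forall>Z'\<in>Ob C. \<forall>a\<in>Mor C Z' Z.
        \<exists>P g' b. is_pullback C Y Z Z' g a P g' b \<and> admissible_epi \<E> P Z' g'))"

text \<open>
  A functor is given by its object part \<open>Fo\<close> and its morphism part \<open>Fm X Y\<close> on \<open>Mor C X Y\<close>.
\<close>

definition map_seq ::
  "('o \<Rightarrow> 'p) \<Rightarrow> ('o \<Rightarrow> 'o \<Rightarrow> 'm \<Rightarrow> 'n) \<Rightarrow> ('o, 'm) seq \<Rightarrow> ('p, 'n) seq" where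
  "map_seq Fo Fm = (\<lambda>(X, f, Y, g, Z). (Fo X, Fm X Y f, Fo Y, Fm Y Z g, Fo Z))"

definition preserves_admissible ::
  "('o \<Rightarrow> 'p) \<Rightarrow> ('o \<Rightarrow> 'o \<Rightarrow> 'm \<Rightarrow> 'n) \<Rightarrow> ('o, 'm) seq set \<Rightarrow> ('p, 'n) seq set \<Rightarrow> bool" where
  "preserves_admissible Fo Fm \<E> \<F> \<longleftrightarrow> (\<forall>s\<in>\<E>. map_seq Fo Fm s \<in> \<F>)"

definition reflects_admissible ::
  "('o, 'm) precat \<Rightarrow> ('o \<Rightarrow> 'p) \<Rightarrow> ('o \<Rightarrow> 'o \<Rightarrow> 'm \<Rightarrow> 'n) \<Rightarrow>
   ('o, 'm) seq set \<Rightarrow> ('p, 'n) seq set \<Rightarrow> bool" where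
  "reflects_admissible C Fo Fm \<E> \<F> \<longleftrightarrow>
     (\<forall>s. composable C s \<and> map_seq Fo Fm s \<in> \<F> \<longrightarrow> s \<in> \<E>)"


section \<open>DG-categories\<close>

locale grading =
  fixes \<sigma> :: "'g::ab_group_add \<Rightarrow> 'g \<Rightarrow> bit"
    and u :: 'g
  assumes form_sym: "\<sigma> i j = \<sigma> j i"
    and form_add: "\<sigma> (i + j) k = \<sigma> i k + \<sigma> j k"
    and form_unit: "\<sigma> u u = 1"

lemma grading_int: "grading (\<lambda>i j. of_int (i * j)) (1 :: int)"
  by unfold_locales (simp_all add: algebra_simps)

text \<open>\<open>signed \<sigma> u i x\<close> is \<open>(-1)\<^sup>i x\<close>, that is, \<open>x\<close> multiplied by \<open>-1\<close> to the power \<open>\<sigma> u i\<close>.\<close>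

definition signed :: "('g \<Rightarrow> 'g \<Rightarrow> bit) \<Rightarrow> 'g \<Rightarrow> 'g \<Rightarrow> 'm::ab_group_add \<Rightarrow> 'm" where
  "signed \<sigma> u i x = (if \<sigma> u i = 0 then x else - x)"

record ('g, 'o, 'm) dgcat = "('o, 'm) cat_data" +
  Hom :: "'o \<Rightarrow> 'o \<Rightarrow> 'g \<Rightarrow> 'm set"
  dif :: "'o \<Rightarrow> 'o \<Rightarrow> 'g \<Rightarrow> 'm \<Rightarrow> 'm"

locale dg_category = grading \<sigma> u
  for \<sigma> :: "'g::ab_group_add \<Rightarrow> 'g \<Rightarrow> bit" and u :: 'g +
  fixes A :: "('g, 'o, 'm::ab_group_add) dgcat" (structure)
  assumes Hom_subgrp: "X \<in> Ob A \<Longrightarrow> Y \<in> Ob A \<Longrightarrow> subgrp (Hom A X Y i)"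
    and Id_Hom: "X \<in> Ob A \<Longrightarrow> idm A X \<in> Hom A X X 0"
    and cmp_Hom: "\<lbrakk>X \<in> Ob A; Y \<in> Ob A; Z \<in> Ob A; f \<in> Hom A X Y i; g \<in> Hom A Y Z j\<rbrakk>
      \<Longrightarrow> g \<cdot> f \<in> Hom A X Z (j + i)"
    and cmp_assoc: "\<lbrakk>W \<in> Ob A; X \<in> Ob A; Y \<in> Ob A; Z \<in> Ob A;
      f \<in> Hom A W X i; g \<in> Hom A X Y j; h \<in> Hom A Y Z k\<rbrakk> \<Longrightarrow> (h \<cdot> g) \<cdot> f = h \<cdot> (g \<cdot> f)"
    and cmp_Id: "\<lbrakk>X \<in> Ob A; Y \<in> Ob A; f \<in> Hom A X Y i\<rbrakk> \<Longrightarrow> f \<cdot> idm A X = f"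
    and Id_cmp: "\<lbrakk>X \<in> Ob A; Y \<in> Ob A; f \<in> Hom A X Y i\<rbrakk> \<Longrightarrow> idm A Y \<cdot> f = f"
    and cmp_add: "\<lbrakk>X \<in> Ob A; Y \<in> Ob A; Z \<in> Ob A;
      f \<in> Hom A X Y i; f' \<in> Hom A X Y i; g \<in> Hom A Y Z j\<rbrakk> \<Longrightarrow> g \<cdot> (f + f') = g \<cdot> f + g \<cdot> f'"
    and add_cmp: "\<lbrakk>X \<in> Ob A; Y \<in> Ob A; Z \<in> Ob A;
      f \<in> Hom A X Y i; g \<in> Hom A Y Z j; g' \<in> Hom A Y Z j\<rbrakk> \<Longrightarrow> (g + g') \<cdot> f = g \<cdot> f + g' \<cdot> f"
    and dif_Hom: "\<lbrakk>X \<in> Ob A; Y \<in> Ob A; f \<in> Hom A X Y i\<rbrakk> \<Longrightarrow> dif A X Y i f \<in> Hom A X Y (i + u)"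
    and dif_add: "\<lbrakk>X \<in> Ob A; Y \<in> Ob A; f \<in> Hom A X Y i; f' \<in> Hom A X Y i\<rbrakk>
      \<Longrightarrow> dif A X Y i (f + f') = dif A X Y i f + dif A X Y i f'"
    and dif_dif: "\<lbrakk>X \<in> Ob A; Y \<in> Ob A; f \<in> Hom A X Y i\<rbrakk>
      \<Longrightarrow> dif A X Y (i + u) (dif A X Y i f) = 0"
    and dif_Id: "X \<in> Ob A \<Longrightarrow> dif A X X 0 (idm A X) = 0"
    and dif_cmp: "\<lbrakk>X \<in> Ob A; Y \<in> Ob A; Z \<in> Ob A; f \<in> Hom A X Y i; g \<in> Hom A Y Z j\<rbrakk>
      \<Longrightarrow> dif A X Z (j + i) (g \<cdot> f) = dif A Y Z j g \<cdot> f + signed \<sigma> u j (g \<cdot> dif A X Y i f)"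

definition closed_hom :: "('g, 'o, 'm::ab_group_add) dgcat \<Rightarrow> 'o \<Rightarrow> 'o \<Rightarrow> 'g \<Rightarrow> 'm set" where
  "closed_hom A X Y i = {f \<in> Hom A X Y i. dif A X Y i f = 0}"

definition Z0 :: "('g::ab_group_add, 'o, 'm::ab_group_add) dgcat \<Rightarrow> ('o, 'm) precat" where
  "Z0 A = \<lparr>Ob = Ob A, cmp = cmp A, idm = idm A, Mor = (\<lambda>X Y. closed_hom A X Y 0)\<rparr>"

text \<open>\<open>S\<close> is \<open>X[i]\<close>, with structure isomorphisms \<open>s : X \<rightarrow> S\<close> and \<open>t : S \<rightarrow> X\<close>.\<close>

definition is_shift ::
  "('g::ab_group_add, 'o, 'm::ab_group_add) dgcat \<Rightarrow> 'g \<Rightarrow> 'o \<Rightarrow> 'o \<Rightarrow> 'm \<Rightarrow> 'm \<Rightarrow> bool" where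
  "is_shift A i X S s t \<longleftrightarrow> S \<in> Ob A \<and> s \<in> closed_hom A X S (- i) \<and> t \<in> closed_hom A S X i \<and>
     t \<cdot>\<^bsub>A\<^esub> s = idm A X \<and> s \<cdot>\<^bsub>A\<^esub> t = idm A S"

definition has_shifts :: "('g::ab_group_add, 'o, 'm::ab_group_add) dgcat \<Rightarrow> bool" where
  "has_shifts A \<longleftrightarrow> (\<forall>X\<in>Ob A. \<forall>i. \<exists>S s t. is_shift A i X S s t)"

text \<open>
  The cone of a morphism of complexes \<open>F : K \<rightarrow> L\<close> has components \<open>L\<^sup>n \<oplus> K\<^sup>n\<^sup>+\<^sup>1\<close> and differential
  \<open>(l, k) \<mapsto> (d l + F k, - d k)\<close>.  The object \<open>C\<close> is the cone of \<open>f : X \<rightarrow> Y\<close> when the maps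
  \<open>\<theta> Z n\<close> are isomorphisms, natural in \<open>Z\<close>, from the complex of morphisms \<open>Z \<rightarrow> C\<close>
  to the cone of composition with \<open>f\<close> on morphisms from \<open>Z\<close>.
\<close>

definition is_cone ::
  "'g::ab_group_add \<Rightarrow> ('g, 'o, 'm::ab_group_add) dgcat \<Rightarrow> 'o \<Rightarrow> 'o \<Rightarrow> 'm \<Rightarrow> 'o \<Rightarrow>
   ('o \<Rightarrow> 'g \<Rightarrow> 'm \<Rightarrow> 'm \<times> 'm) \<Rightarrow> bool" where
  "is_cone u A X Y f C \<theta> \<longleftrightarrow> C \<in> Ob A \<and>
     (\<forall>Z\<in>Ob A. \<forall>n. bij_betw (\<theta> Z n) (Hom A Z C n) (Hom A Z Y n \<times> Hom A Z X (n + u))) \<and>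
     (\<forall>Z\<in>Ob A. \<forall>n. \<forall>h\<in>Hom A Z C n. \<forall>h'\<in>Hom A Z C n.
        \<theta> Z n (h + h') = (fst (\<theta> Z n h) + fst (\<theta> Z n h'), snd (\<theta> Z n h) + snd (\<theta> Z n h'))) \<and>
     (\<forall>Z\<in>Ob A. \<forall>n. \<forall>h\<in>Hom A Z C n.
        \<theta> Z (n + u) (dif A Z C n h) =
          (dif A Z Y n (fst (\<theta> Z n h)) + f \<cdot>\<^bsub>A\<^esub> snd (\<theta> Z n h),
           - dif A Z X (n + u) (snd (\<theta> Z n h)))) \<and>
     (\<forall>Z\<in>Ob A. \<forall>W\<in>Ob A. \<forall>n j. \<forall>h\<in>Hom A Z C n. \<forall>w\<in>Hom A W Z j.
        \<theta> W (n + j) (h \<cdot>\<^bsub>A\<^esub> w) = (fst (\<theta> Z n h) \<cdot>\<^bsub>A\<^esub> w, snd (\<theta> Z n h) \<cdot>\<^bsub>A\<^esub> w))"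

definition has_cones :: "'g::ab_group_add \<Rightarrow> ('g, 'o, 'm::ab_group_add) dgcat \<Rightarrow> bool" where
  "has_cones u A \<longleftrightarrow>
     (\<forall>X\<in>Ob A. \<forall>Y\<in>Ob A. \<forall>f\<in>closed_hom A X Y 0. \<exists>C \<theta>. is_cone u A X Y f C \<theta>)"

text \<open>
  Shifts and cones are defined up to closed isomorphism of degree 0; the functors below depend on a
  choice of them.  Isomorphic choices give isomorphic sequences, and exact structures are closed
  under isomorphism, so the choice is immaterial.
\<close>

definition shift_choice ::
  "('g::ab_group_add, 'o, 'm::ab_group_add) dgcat \<Rightarrow> 'g \<Rightarrow> 'o \<Rightarrow> 'o \<times> 'm \<times> 'm" where
  "shift_choice A i X = (SOME (S, s, t). is_shift A i X S s t)"

definition shift_ob :: "('g::ab_group_add, 'o, 'm::ab_group_add) dgcat \<Rightarrow> 'g \<Rightarrow> 'o \<Rightarrow> 'o" where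
  "shift_ob A i X = fst (shift_choice A i X)"

definition shift_to :: "('g::ab_group_add, 'o, 'm::ab_group_add) dgcat \<Rightarrow> 'g \<Rightarrow> 'o \<Rightarrow> 'm" where
  "shift_to A i X = fst (snd (shift_choice A i X))"

definition shift_from :: "('g::ab_group_add, 'o, 'm::ab_group_add) dgcat \<Rightarrow> 'g \<Rightarrow> 'o \<Rightarrow> 'm" where
  "shift_from A i X = snd (snd (shift_choice A i X))"

definition shift_mor ::
  "('g::ab_group_add, 'o, 'm::ab_group_add) dgcat \<Rightarrow> 'g \<Rightarrow> 'o \<Rightarrow> 'o \<Rightarrow> 'm \<Rightarrow> 'm" where
  "shift_mor A i X Y f = shift_to A i Y \<cdot>\<^bsub>A\<^esub> f \<cdot>\<^bsub>A\<^esub> shift_from A i X"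

definition cone_choice ::
  "'g::ab_group_add \<Rightarrow> ('g, 'o, 'm::ab_group_add) dgcat \<Rightarrow> 'o \<Rightarrow> 'o \<Rightarrow> 'm \<Rightarrow>
   'o \<times> ('o \<Rightarrow> 'g \<Rightarrow> 'm \<Rightarrow> 'm \<times> 'm)" where
  "cone_choice u A X Y f = (SOME (C, \<theta>). is_cone u A X Y f C \<theta>)"

text \<open>
  The object \<open>E = cone(id\<^bsub>X[-1]\<^esub>)\<close> with its structure morphisms: writing \<open>s : X \<rightarrow> X[-1]\<close> and
  \<open>t : X[-1] \<rightarrow> X\<close> for those of the shift, \<open>\<iota>\<close> and \<open>\<iota>'\<close> correspond under \<open>\<theta>\<close> to \<open>(s, 0)\<close> and
  \<open>(0, s)\<close>, and \<open>\<pi>'\<close>, \<open>\<pi>\<close> are \<open>t\<close> composed with the two components of \<open>\<theta>\<close> applied to \<open>id\<^bsub>E\<^esub>\<close>.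
\<close>

definition idcone_choice ::
  "'g::ab_group_add \<Rightarrow> ('g, 'o, 'm::ab_group_add) dgcat \<Rightarrow> 'o \<Rightarrow>
   'o \<times> ('o \<Rightarrow> 'g \<Rightarrow> 'm \<Rightarrow> 'm \<times> 'm)" where
  "idcone_choice u A X =
     (let S = shift_ob A (- u) X in cone_choice u A S S (idm A S))"

definition idcone :: "'g::ab_group_add \<Rightarrow> ('g, 'o, 'm::ab_group_add) dgcat \<Rightarrow> 'o \<Rightarrow> 'o" where
  "idcone u A X = fst (idcone_choice u A X)"

definition idcone_iota ::
  "'g::ab_group_add \<Rightarrow> ('g, 'o, 'm::ab_group_add) dgcat \<Rightarrow> 'o \<Rightarrow> 'm" where
  "idcone_iota u A X =
     inv_into (Hom A X (idcone u A X) u) (snd (idcone_choice u A X) X u) (shift_to A (- u) X, 0)"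

definition idcone_iota' ::
  "'g::ab_group_add \<Rightarrow> ('g, 'o, 'm::ab_group_add) dgcat \<Rightarrow> 'o \<Rightarrow> 'm" where
  "idcone_iota' u A X =
     inv_into (Hom A X (idcone u A X) 0) (snd (idcone_choice u A X) X 0) (0, shift_to A (- u) X)"

definition idcone_pi ::
  "'g::ab_group_add \<Rightarrow> ('g, 'o, 'm::ab_group_add) dgcat \<Rightarrow> 'o \<Rightarrow> 'm" where
  "idcone_pi u A X =
     (let E = idcone u A X; \<theta> = snd (idcone_choice u A X)
      in shift_from A (- u) X \<cdot>\<^bsub>A\<^esub> snd (\<theta> E 0 (idm A E)))"

definition idcone_pi' ::
  "'g::ab_group_add \<Rightarrow> ('g, 'o, 'm::ab_group_add) dgcat \<Rightarrow> 'o \<Rightarrow> 'm" where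
  "idcone_pi' u A X =
     (let E = idcone u A X; \<theta> = snd (idcone_choice u A X)
      in shift_from A (- u) X \<cdot>\<^bsub>A\<^esub> fst (\<theta> E 0 (idm A E)))"

definition preserved_by_shifts ::
  "'g::ab_group_add \<Rightarrow> ('g, 'o, 'm::ab_group_add) dgcat \<Rightarrow> ('o, 'm) seq set \<Rightarrow> bool" where
  "preserved_by_shifts u A \<E> \<longleftrightarrow>
     preserves_admissible (shift_ob A u) (shift_mor A u) \<E> \<E> \<and>
     preserves_admissible (shift_ob A (- u)) (shift_mor A (- u)) \<E> \<E>"

text \<open>
  In the natural sequence \<open>X[-1] \<rightarrow> cone(id\<^bsub>X[-1]\<^esub>) \<rightarrow> X\<close>, the first map corresponds under \<open>\<theta>\<close> to
  \<open>(id, 0)\<close>; it is \<open>\<iota> \<cdot> t\<close>.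
\<close>

definition DG_compatible ::
  "'g::ab_group_add \<Rightarrow> ('g, 'o, 'm::ab_group_add) dgcat \<Rightarrow> ('o, 'm) seq set \<Rightarrow> bool" where
  "DG_compatible u A \<E> \<longleftrightarrow> preserved_by_shifts u A \<E> \<and>
     (\<forall>X\<in>Ob A. (shift_ob A (- u) X, idcone_iota u A X \<cdot>\<^bsub>A\<^esub> shift_from A (- u) X,
                 idcone u A X, idcone_pi u A X, X) \<in> \<E>)"


section \<open>The DG-category \<open>E\<^sup>\<natural>\<close>\<close>

definition natural_dg ::
  "('g::ab_group_add \<Rightarrow> 'g \<Rightarrow> bit) \<Rightarrow> 'g \<Rightarrow> ('g, 'o, 'm::ab_group_add) dgcat \<Rightarrow>
   ('g, 'o \<times> 'm, 'm) dgcat" where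
  "natural_dg \<sigma> u E = \<lparr>
     Ob = {(X, h). X \<in> Ob E \<and> h \<in> Hom E X X (- u) \<and> dif E X X (- u) h = idm E X \<and> h \<cdot>\<^bsub>E\<^esub> h = 0},
     cmp = cmp E,
     idm = (\<lambda>(X, h). idm E X),
     Hom = (\<lambda>(X, h) (Y, k) i. closed_hom E X Y (- i)),
     dif = (\<lambda>(X, h) (Y, k) i f. k \<cdot>\<^bsub>E\<^esub> f - signed \<sigma> u i (f \<cdot>\<^bsub>E\<^esub> h))\<rparr>"

definition Phi_ob ::
  "'g::ab_group_add \<Rightarrow> ('g, 'o, 'm::ab_group_add) dgcat \<Rightarrow> 'o \<Rightarrow> 'o \<times> 'm" where
  "Phi_ob u E X = (idcone u E X, idcone_iota' u E X \<cdot>\<^bsub>E\<^esub> idcone_pi' u E X)"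

text \<open>
  The morphism of cones induced by \<open>f\<close>: the only one commuting with all the structure morphisms
  \<open>\<iota>, \<iota>', \<pi>, \<pi>'\<close>.
\<close>

definition Phi_mor ::
  "'g::ab_group_add \<Rightarrow> ('g, 'o, 'm::ab_group_add) dgcat \<Rightarrow> 'o \<Rightarrow> 'o \<Rightarrow> 'm \<Rightarrow> 'm" where
  "Phi_mor u E X Y f =
     idcone_iota u E Y \<cdot>\<^bsub>E\<^esub> f \<cdot>\<^bsub>E\<^esub> idcone_pi' u E X + idcone_iota' u E Y \<cdot>\<^bsub>E\<^esub> f \<cdot>\<^bsub>E\<^esub> idcone_pi u E X"

definition Psi_ob :: "'o \<times> 'm \<Rightarrow> 'o" where
  "Psi_ob = fst"

definition Psi_mor :: "'o \<times> 'm \<Rightarrow> 'o \<times> 'm \<Rightarrow> 'm \<Rightarrow> 'm" where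
  "Psi_mor P Q f = f"

definition natural_compatible ::
  "('g::ab_group_add \<Rightarrow> 'g \<Rightarrow> bit) \<Rightarrow> 'g \<Rightarrow> ('g, 'o, 'm::ab_group_add) dgcat \<Rightarrow>
   ('o, 'm) seq set \<Rightarrow> ('o \<times> 'm, 'm) seq set \<Rightarrow> bool" where
  "natural_compatible \<sigma> u E \<E> \<F> \<longleftrightarrow>
     preserved_by_shifts u E \<E> \<and>
     preserved_by_shifts u (natural_dg \<sigma> u E) \<F> \<and>
     preserves_admissible (Phi_ob u E) (Phi_mor u E) \<E> \<F> \<and>
     reflects_admissible (Z0 E) (Phi_ob u E) (Phi_mor u E) \<E> \<F> \<and>
     preserves_admissible Psi_ob Psi_mor \<F> \<E> \<and>
     reflects_admissible (Z0 (natural_dg \<sigma> u E)) Psi_ob Psi_mor \<F> \<E>"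


section \<open>Consistency of the conventions\<close>

text \<open>
  The structure morphisms of \<open>cone(id\<^bsub>X[-1]\<^esub>)\<close> satisfy the usual identities, including the signs
  (\<open>idcone_structure\<close>); \<open>E\<^sup>\<natural>\<close> is a DG-category for the same grading data (\<open>natural_dg\<close>); and
  \<open>Phi_ob\<close> takes values in its objects.
\<close>

lemma (in grading) form_zero [simp]: "\<sigma> i 0 = 0" "\<sigma> 0 i = 0"
  using form_add[of 0 0 i] form_sym[of i 0] by simp_all

lemma (in grading) form_minus [simp]: "\<sigma> i (- j) = \<sigma> i j"
  using form_add[of "- j" j i] form_sym[of i] by (cases "\<sigma> j i"; cases "\<sigma> (- j) i") simp_all

lemma (in grading) form_add2: "\<sigma> k (i + j) = \<sigma> k i + \<sigma> k j"
  using form_add[of i j k] form_sym[of k] by simp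

context dg_category
begin

lemma Hom_zero [simp]: "X \<in> Ob A \<Longrightarrow> Y \<in> Ob A \<Longrightarrow> 0 \<in> Hom A X Y i"
  using Hom_subgrp by (auto simp: subgrp_def)

lemma Hom_add: "X \<in> Ob A \<Longrightarrow> Y \<in> Ob A \<Longrightarrow> f \<in> Hom A X Y i \<Longrightarrow> g \<in> Hom A X Y i \<Longrightarrow> f + g \<in> Hom A X Y i"
  using Hom_subgrp by (auto simp: subgrp_def)

lemma Hom_minus: "X \<in> Ob A \<Longrightarrow> Y \<in> Ob A \<Longrightarrow> f \<in> Hom A X Y i \<Longrightarrow> - f \<in> Hom A X Y i"
  using Hom_subgrp by (auto simp: subgrp_def)

lemma Hom_diff: "X \<in> Ob A \<Longrightarrow> Y \<in> Ob A \<Longrightarrow> f \<in> Hom A X Y i \<Longrightarrow> g \<in> Hom A X Y i \<Longrightarrow> f - g \<in> Hom A X Y i"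
  using Hom_add Hom_minus by fastforce

lemma cmp_0: "X \<in> Ob A \<Longrightarrow> Y \<in> Ob A \<Longrightarrow> Z \<in> Ob A \<Longrightarrow> g \<in> Hom A Y Z j \<Longrightarrow> g \<cdot> 0 = 0"
  using cmp_add[of X Y Z 0 0 0 g j] by simp

lemma cmp_0': "X \<in> Ob A \<Longrightarrow> Y \<in> Ob A \<Longrightarrow> Z \<in> Ob A \<Longrightarrow> g \<in> Hom A X Y j \<Longrightarrow> 0 \<cdot> g = 0"
  using add_cmp[of X Y Z g j 0 0 0] by simp

lemma cmp_minus: "X \<in> Ob A \<Longrightarrow> Y \<in> Ob A \<Longrightarrow> Z \<in> Ob A \<Longrightarrow> f \<in> Hom A X Y i \<Longrightarrow> g \<in> Hom A Y Z j \<Longrightarrow> g \<cdot> (- f) = - (g \<cdot> f)"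
  using cmp_add[of X Y Z f i "- f" g j] cmp_0[of X Y Z g j] Hom_minus by (simp add: add_eq_0_iff)

lemma minus_cmp: "X \<in> Ob A \<Longrightarrow> Y \<in> Ob A \<Longrightarrow> Z \<in> Ob A \<Longrightarrow> f \<in> Hom A X Y i \<Longrightarrow> g \<in> Hom A Y Z j \<Longrightarrow> (- g) \<cdot> f = - (g \<cdot> f)"
  using add_cmp[of X Y Z f i g j "- g"] cmp_0'[of X Y Z f i] Hom_minus by (simp add: add_eq_0_iff)

lemma dif_0: "X \<in> Ob A \<Longrightarrow> Y \<in> Ob A \<Longrightarrow> dif A X Y i 0 = 0"
  using dif_add[of X Y 0 i 0] by simp

lemma dif_minus: "X \<in> Ob A \<Longrightarrow> Y \<in> Ob A \<Longrightarrow> f \<in> Hom A X Y i \<Longrightarrow> dif A X Y i (- f) = - dif A X Y i f"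
  using dif_add[of X Y f i "- f"] dif_0[of X Y i] Hom_minus by (simp add: add_eq_0_iff)

lemma signed_in: "X \<in> Ob A \<Longrightarrow> Y \<in> Ob A \<Longrightarrow> f \<in> Hom A X Y i \<Longrightarrow> signed \<sigma> u j f \<in> Hom A X Y i"
  by (simp add: signed_def Hom_minus)

lemma shift_choice:
  assumes "has_shifts A" "X \<in> Ob A"
  shows "is_shift A i X (shift_ob A i X) (shift_to A i X) (shift_from A i X)"
proof -
  have "\<exists>p. case p of (S, s, t) \<Rightarrow> is_shift A i X S s t"
    using assms unfolding has_shifts_def by fast
  then have "case shift_choice A i X of (S, s, t) \<Rightarrow> is_shift A i X S s t"
    unfolding shift_choice_def by (rule someI_ex)
  then show ?thesis by (auto simp: shift_ob_def shift_to_def shift_from_def split: prod.splits)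
qed

lemma idcone_is_cone:
  assumes "has_shifts A" "has_cones u A" "X \<in> Ob A"
  shows "is_cone u A (shift_ob A (- u) X) (shift_ob A (- u) X) (idm A (shift_ob A (- u) X))
    (idcone u A X) (snd (idcone_choice u A X))"
proof -
  let ?S = "shift_ob A (- u) X"
  have S: "?S \<in> Ob A" using shift_choice[OF assms(1,3)] by (simp add: is_shift_def)
  have "idm A ?S \<in> closed_hom A ?S ?S 0" using S Id_Hom dif_Id by (simp add: closed_hom_def)
  then have "\<exists>p. case p of (C, \<theta>) \<Rightarrow> is_cone u A ?S ?S (idm A ?S) C \<theta>"
    using assms S unfolding has_cones_def by fast
  then have "case cone_choice u A ?S ?S (idm A ?S) of (C, \<theta>) \<Rightarrow> is_cone u A ?S ?S (idm A ?S) C \<theta>"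
    unfolding cone_choice_def by (rule someI_ex)
  then show ?thesis by (auto simp: idcone_choice_def idcone_def Let_def split: prod.splits)
qed

lemma idcone_structure:
  assumes "has_shifts A" "has_cones u A" "X \<in> Ob A"
  defines "S \<equiv> shift_ob A (- u) X" and "s \<equiv> shift_to A (- u) X" and "t \<equiv> shift_from A (- u) X"
    and "E \<equiv> idcone u A X" and "\<theta> \<equiv> snd (idcone_choice u A X)"
    and "\<iota> \<equiv> idcone_iota u A X" and "\<iota>' \<equiv> idcone_iota' u A X"
    and "\<pi> \<equiv> idcone_pi u A X" and "\<pi>' \<equiv> idcone_pi' u A X"
  shows "E \<in> Ob A"
    "\<iota> \<in> Hom A X E u" "\<iota>' \<in> Hom A X E 0" "\<pi> \<in> Hom A E X 0" "\<pi>' \<in> Hom A E X (- u)"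
    "\<pi>' \<cdot> \<iota>' = 0" "\<pi> \<cdot> \<iota> = 0" "\<pi>' \<cdot> \<iota> = idm A X" "\<pi> \<cdot> \<iota>' = idm A X"
    "\<iota> \<cdot> \<pi>' + \<iota>' \<cdot> \<pi> = idm A E"
    "dif A X E u \<iota> = 0" "dif A E X 0 \<pi> = 0" "dif A E X (- u) \<pi>' = \<pi>" "dif A X E 0 \<iota>' = \<iota>"
    "\<theta> S 0 (\<iota> \<cdot> t) = (idm A S, 0)"
proof -
  have sh: "is_shift A (- u) X S s t"
    unfolding S_def s_def t_def by (rule shift_choice[OF assms(1,3)])
  then have S: "S \<in> Ob A" and s: "s \<in> Hom A X S u" and ds: "dif A X S u s = 0"
    and t: "t \<in> Hom A S X (- u)" and dt: "dif A S X (- u) t = 0"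
    and ts: "t \<cdot> s = idm A X" and st: "s \<cdot> t = idm A S"
    by (simp_all add: is_shift_def closed_hom_def)
  note X = assms(3)
  have cone: "is_cone u A S S (idm A S) E \<theta>"
    unfolding S_def E_def \<theta>_def by (rule idcone_is_cone[OF assms(1-3)])
  show E: "E \<in> Ob A" using cone by (simp add: is_cone_def)
  have bij: "bij_betw (\<theta> Z n) (Hom A Z E n) (Hom A Z S n \<times> Hom A Z S (n + u))" if "Z \<in> Ob A" for Z n
    using cone that by (simp add: is_cone_def)
  have th_add: "\<theta> Z n (h + h') = (fst (\<theta> Z n h) + fst (\<theta> Z n h'), snd (\<theta> Z n h) + snd (\<theta> Z n h'))"
    if "Z \<in> Ob A" "h \<in> Hom A Z E n" "h' \<in> Hom A Z E n" for Z n h h'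
    using cone that unfolding is_cone_def by blast
  have th_in: "fst (\<theta> Z n h) \<in> Hom A Z S n" "snd (\<theta> Z n h) \<in> Hom A Z S (n + u)"
    if "Z \<in> Ob A" "h \<in> Hom A Z E n" for Z n h
    using bij_betw_apply[OF bij[OF that(1)] that(2)] by (auto simp: mem_Times_iff)
  have th_dif: "\<theta> Z (n + u) (dif A Z E n h) =
      (dif A Z S n (fst (\<theta> Z n h)) + snd (\<theta> Z n h), - dif A Z S (n + u) (snd (\<theta> Z n h)))"
    if "Z \<in> Ob A" "h \<in> Hom A Z E n" for Z n h
  proof -
    have "idm A S \<cdot> snd (\<theta> Z n h) = snd (\<theta> Z n h)" using that S th_in(2) Id_cmp by blast
    then show ?thesis using cone that unfolding is_cone_def by metis
  qed
  have th_cmp: "\<theta> W (n + j) (h \<cdot> w) = (fst (\<theta> Z n h) \<cdot> w, snd (\<theta> Z n h) \<cdot> w)"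
    if "Z \<in> Ob A" "W \<in> Ob A" "h \<in> Hom A Z E n" "w \<in> Hom A W Z j" for Z W n j h w
    using cone that unfolding is_cone_def by blast
  have th_inj: "h = h'" if "Z \<in> Ob A" "h \<in> Hom A Z E n" "h' \<in> Hom A Z E n" "\<theta> Z n h = \<theta> Z n h'" for Z n h h'
    using bij[OF that(1), of n] that by (meson bij_betw_def inj_on_eq_iff)
  have th_inv: "inv_into (Hom A Z E n) (\<theta> Z n) (a, b) \<in> Hom A Z E n"
      "\<theta> Z n (inv_into (Hom A Z E n) (\<theta> Z n) (a, b)) = (a, b)"
    if "Z \<in> Ob A" "a \<in> Hom A Z S n" "b \<in> Hom A Z S (n + u)" for Z n a b
  proof -
    have "(a, b) \<in> \<theta> Z n ` Hom A Z E n" using bij[OF that(1), of n] that by (simp add: bij_betw_def)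
    then show "inv_into (Hom A Z E n) (\<theta> Z n) (a, b) \<in> Hom A Z E n"
      "\<theta> Z n (inv_into (Hom A Z E n) (\<theta> Z n) (a, b)) = (a, b)"
      by (rule inv_into_into, rule f_inv_into_f)
  qed
  have \<iota>: "\<iota> = inv_into (Hom A X E u) (\<theta> X u) (s, 0)"
    unfolding \<iota>_def E_def \<theta>_def s_def idcone_iota_def ..
  have \<iota>': "\<iota>' = inv_into (Hom A X E 0) (\<theta> X 0) (0, s)"
    unfolding \<iota>'_def E_def \<theta>_def s_def idcone_iota'_def ..
  show iH: "\<iota> \<in> Hom A X E u" unfolding \<iota> by (rule th_inv) (use X S s in auto)
  have thi: "\<theta> X u \<iota> = (s, 0)" unfolding \<iota> by (rule th_inv) (use X S s in auto)
  show iH': "\<iota>' \<in> Hom A X E 0" unfolding \<iota>' by (rule th_inv) (use X S s in auto)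
  have thi': "\<theta> X 0 \<iota>' = (0, s)" unfolding \<iota>' by (rule th_inv) (use X S s in auto)
  define p where "p = fst (\<theta> E 0 (idm A E))"
  define q where "q = snd (\<theta> E 0 (idm A E))"
  have p: "p \<in> Hom A E S 0" and q: "q \<in> Hom A E S u"
    using th_in[OF E Id_Hom[OF E]] by (simp_all add: p_def q_def)
  have \<pi>: "\<pi> = t \<cdot> q" and \<pi>': "\<pi>' = t \<cdot> p"
    by (simp_all add: \<pi>_def \<pi>'_def idcone_pi_def idcone_pi'_def E_def \<theta>_def p_def q_def t_def Let_def)
  have pq: "\<theta> Z n h = (p \<cdot> h, q \<cdot> h)" if "Z \<in> Ob A" "h \<in> Hom A Z E n" for Z n h
    using th_cmp[OF E that(1) Id_Hom[OF E] that(2)] Id_cmp[OF that(1) E that(2)] by (simp add: p_def q_def)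
  show piH: "\<pi> \<in> Hom A E X 0" using cmp_Hom[OF E S X q t] by (simp add: \<pi>)
  show piH': "\<pi>' \<in> Hom A E X (- u)" using cmp_Hom[OF E S X p t] by (simp add: \<pi>')
  have pi_s: "p \<cdot> \<iota> = s" "q \<cdot> \<iota> = 0" "p \<cdot> \<iota>' = 0" "q \<cdot> \<iota>' = s"
    using pq[OF X iH] pq[OF X iH'] thi thi' by auto
  show "\<pi>' \<cdot> \<iota>' = 0" using cmp_assoc[OF X E S X iH' p t] pi_s cmp_0[OF X S X t] by (simp add: \<pi>')
  show "\<pi> \<cdot> \<iota> = 0" using cmp_assoc[OF X E S X iH q t] pi_s cmp_0[OF X S X t] by (simp add: \<pi>)
  show "\<pi>' \<cdot> \<iota> = idm A X" using cmp_assoc[OF X E S X iH p t] pi_s ts by (simp add: \<pi>')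
  show "\<pi> \<cdot> \<iota>' = idm A X" using cmp_assoc[OF X E S X iH' q t] pi_s ts by (simp add: \<pi>)
  have s\<pi>: "s \<cdot> \<pi> = q" using cmp_assoc[OF E S X S q t s] st Id_cmp[OF E S q] by (simp add: \<pi>)
  have s\<pi>': "s \<cdot> \<pi>' = p" using cmp_assoc[OF E S X S p t s] st Id_cmp[OF E S p] by (simp add: \<pi>')
  have a: "\<iota> \<cdot> \<pi>' \<in> Hom A E E 0" using cmp_Hom[OF E X E piH' iH] by simp
  have b: "\<iota>' \<cdot> \<pi> \<in> Hom A E E 0" using cmp_Hom[OF E X E piH iH'] by simp
  have tha: "\<theta> E 0 (\<iota> \<cdot> \<pi>') = (p, 0)"
    using th_cmp[OF X E iH piH'] thi s\<pi>' cmp_0'[OF E X S piH'] by simp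
  have thb: "\<theta> E 0 (\<iota>' \<cdot> \<pi>) = (0, q)"
    using th_cmp[OF X E iH' piH] thi' s\<pi> cmp_0'[OF E X S piH] by simp
  show "\<iota> \<cdot> \<pi>' + \<iota>' \<cdot> \<pi> = idm A E"
  proof (rule th_inj[OF E, where n = 0])
    show "\<theta> E 0 (\<iota> \<cdot> \<pi>' + \<iota>' \<cdot> \<pi>) = \<theta> E 0 (idm A E)"
      using th_add[OF E a b] tha thb by (simp add: p_def q_def)
  qed (use Hom_add[OF E E a b] Id_Hom[OF E] in auto)
  have th0: "\<theta> Z n 0 = (0, 0)" if "Z \<in> Ob A" for Z n
    using pq[OF that Hom_zero[OF that E]] cmp_0[OF that E S p] cmp_0[OF that E S q] by simp
  show "dif A X E u \<iota> = 0"
  proof (rule th_inj[OF X, where n = "u + u"])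
    show "\<theta> X (u + u) (dif A X E u \<iota>) = \<theta> X (u + u) 0"
      using th_dif[OF X iH] thi ds th0[OF X] dif_0[OF X S] by simp
  qed (use dif_Hom[OF X E iH] X E in auto)
  show "dif A X E 0 \<iota>' = \<iota>"
  proof (rule th_inj[OF X, where n = u])
    show "\<theta> X u (dif A X E 0 \<iota>') = \<theta> X u \<iota>"
      using th_dif[OF X iH'] thi' thi ds dif_0[OF X S] by simp
  qed (use dif_Hom[OF X E iH'] iH in auto)
  have "dif A E S 0 p + q = 0 \<and> dif A E S u q = 0"
    using th_dif[OF E Id_Hom[OF E]] dif_Id[OF E] th0[OF E, of u] by (simp add: p_def q_def)
  then have dp: "dif A E S 0 p = - q" and dq: "dif A E S u q = 0"
    by (simp_all add: eq_neg_iff_add_eq_0)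
  show "dif A E X 0 \<pi> = 0"
    using dif_cmp[OF E S X q t] dt dq cmp_0'[OF E S X q] cmp_0[OF E S X t]
    by (simp add: \<pi> signed_def)
  show "dif A E X (- u) \<pi>' = \<pi>"
    using dif_cmp[OF E S X p t] dt dp cmp_0'[OF E S X p] cmp_minus[OF E S X q t]
    by (simp add: \<pi> \<pi>' signed_def form_unit)
  show "\<theta> S 0 (\<iota> \<cdot> t) = (idm A S, 0)"
    using th_cmp[OF X S iH t] thi st cmp_0'[OF S X S t] by simp
qed

lemma deg_swap: "- i - u = - u - (i :: 'g)"
  by simp

lemma natural_dg: "dg_category \<sigma> u (natural_dg \<sigma> u A)"
  apply unfold_locales
  subgoal for X Y i
    apply (cases X; cases Y)
    apply (auto simp: natural_dg_def subgrp_def closed_hom_def Hom_add Hom_minus dif_add dif_0 dif_minus)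
    done
  subgoal for X
    by (cases X) (auto simp: natural_dg_def closed_hom_def Id_Hom dif_Id)
  subgoal for X Y Z f i g j
    apply (cases X; cases Y; cases Z)
    using cmp_Hom[of "fst X" "fst Y" "fst Z" f "-i" g "-j"] dif_cmp[of "fst X" "fst Y" "fst Z" f "-i" g "-j"]
      cmp_0 cmp_0'
    apply (auto simp: natural_dg_def closed_hom_def signed_def algebra_simps)
      done
  subgoal for W X Y Z f i g j h k
    apply (cases W; cases X; cases Y; cases Z)
    apply (auto simp: natural_dg_def closed_hom_def intro: cmp_assoc) done
  subgoal by (auto simp: natural_dg_def closed_hom_def cmp_Id)
  subgoal by (auto simp: natural_dg_def closed_hom_def Id_cmp)
  subgoal by (auto simp: natural_dg_def closed_hom_def intro: cmp_add)
  subgoal by (auto simp: natural_dg_def closed_hom_def intro: add_cmp)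
  subgoal for P Q f i
  proof (cases P, cases Q)
    fix X h Y k
    assume *: "P \<in> Ob (natural_dg \<sigma> u A)" "Q \<in> Ob (natural_dg \<sigma> u A)"
      "f \<in> Hom (natural_dg \<sigma> u A) P Q i" "P = (X, h)" "Q = (Y, k)"
    then have X: "X \<in> Ob A" "Y \<in> Ob A" and h: "h \<in> Hom A X X (- u)" "dif A X X (- u) h = idm A X"
      and k: "k \<in> Hom A Y Y (- u)" "dif A Y Y (- u) k = idm A Y"
      and f: "f \<in> Hom A X Y (- i)" "dif A X Y (- i) f = 0"
      by (auto simp: natural_dg_def closed_hom_def)
    have kf: "k \<cdot> f \<in> Hom A X Y (- u - i)" "dif A X Y (- u - i) (k \<cdot> f) = f"
      using cmp_Hom[OF X(1,2,2) f(1) k(1)] dif_cmp[OF X(1,2,2) f(1) k(1)] f k X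
        cmp_0[OF X(1,2,2) k(1)] Id_cmp[OF X f(1)] by (auto simp: signed_def)
    have fh: "f \<cdot> h \<in> Hom A X Y (- u - i)" "dif A X Y (- u - i) (f \<cdot> h) = signed \<sigma> u i f"
      using cmp_Hom[OF X(1,1,2) h(1) f(1)] dif_cmp[OF X(1,1,2) h(1) f(1)] f h X
        cmp_0'[OF X(1,1,2) h(1)] cmp_Id[OF X f(1)] by (auto simp: signed_def deg_swap)
    have "dif A X Y (- u - i) (k \<cdot> f + - signed \<sigma> u i (f \<cdot> h)) = 0"
      using dif_add[OF X kf(1) fh(1)] dif_add[OF X kf(1) Hom_minus[OF X fh(1)]]
        dif_minus[OF X fh(1)] kf(2) fh(2) by (auto simp: signed_def)
    moreover have "k \<cdot> f - signed \<sigma> u i (f \<cdot> h) \<in> Hom A X Y (- u - i)"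
      by (intro Hom_diff X kf signed_in fh)
    ultimately show ?thesis using * by (simp add: natural_dg_def closed_hom_def deg_swap)
  qed
  subgoal for P Q f i f'
    apply (cases P; cases Q)
    apply (auto simp: natural_dg_def closed_hom_def)
    by (subst add_cmp cmp_add; assumption?; auto simp: signed_def cmp_add add_cmp)+
  subgoal for P Q f i
  proof (cases P, cases Q)
    fix X h Y k
    assume *: "P \<in> Ob (natural_dg \<sigma> u A)" "Q \<in> Ob (natural_dg \<sigma> u A)"
      "f \<in> Hom (natural_dg \<sigma> u A) P Q i" "P = (X, h)" "Q = (Y, k)"
    then have X: "X \<in> Ob A" "Y \<in> Ob A" and h: "h \<in> Hom A X X (- u)" "h \<cdot> h = 0"
      and k: "k \<in> Hom A Y Y (- u)" "k \<cdot> k = 0"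
      and f: "f \<in> Hom A X Y (- i)"
      by (auto simp: natural_dg_def closed_hom_def)
    have kf: "k \<cdot> f \<in> Hom A X Y (- u - i)" using cmp_Hom[OF X(1,2,2) f(1) k(1)] by simp
    have fh: "f \<cdot> h \<in> Hom A X Y (- u - i)" using cmp_Hom[OF X(1,1,2) h(1) f(1)] by (simp add: deg_swap)
    have sfh: "- signed \<sigma> u i (f \<cdot> h) \<in> Hom A X Y (- u - i)" by (intro Hom_minus X signed_in fh)
    have 1: "k \<cdot> (k \<cdot> f) = 0" "(f \<cdot> h) \<cdot> h = 0"
      using cmp_assoc[OF X(1,2,2,2) f k(1) k(1)] cmp_assoc[OF X(1,1,1,2) h(1) h(1) f] k h
        cmp_0'[OF X(1,2,2) f] cmp_0[OF X(1,1,2) f] by auto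
    have 2: "k \<cdot> (f \<cdot> h) = (k \<cdot> f) \<cdot> h" using cmp_assoc[OF X(1,1,2,2) h(1) f k(1)] by simp
    have 3: "k \<cdot> (k \<cdot> f + - signed \<sigma> u i (f \<cdot> h)) = - signed \<sigma> u i ((k \<cdot> f) \<cdot> h)"
      using cmp_add[OF X(1,2,2) kf sfh k(1)] cmp_minus[OF X(1,2,2) fh k(1)] 1 2 by (auto simp: signed_def)
    have 4: "(k \<cdot> f + - signed \<sigma> u i (f \<cdot> h)) \<cdot> h = (k \<cdot> f) \<cdot> h"
      using add_cmp[OF X(1,1,2) h(1) kf sfh] minus_cmp[OF X(1,1,2) h(1) fh] 1 by (auto simp: signed_def)
    show ?thesis using * 3 4 by (auto simp: natural_dg_def signed_def form_add2 form_unit)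
  qed
  subgoal
    by (auto simp: natural_dg_def closed_hom_def signed_def Id_cmp cmp_Id)
  subgoal for P Q R f i g j
  proof (cases P, cases Q, cases R)
    fix X h Y k Z l
    assume *: "P \<in> Ob (natural_dg \<sigma> u A)" "Q \<in> Ob (natural_dg \<sigma> u A)" "R \<in> Ob (natural_dg \<sigma> u A)"
      "f \<in> Hom (natural_dg \<sigma> u A) P Q i" "g \<in> Hom (natural_dg \<sigma> u A) Q R j" "P = (X, h)" "Q = (Y, k)" "R = (Z, l)"
    then have X: "X \<in> Ob A" "Y \<in> Ob A" "Z \<in> Ob A" and h: "h \<in> Hom A X X (- u)"
      and k: "k \<in> Hom A Y Y (- u)" and l: "l \<in> Hom A Z Z (- u)"
      and f: "f \<in> Hom A X Y (- i)" and g: "g \<in> Hom A Y Z (- j)"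
      by (auto simp: natural_dg_def closed_hom_def)
    have lg: "l \<cdot> g \<in> Hom A Y Z (- u - j)" using cmp_Hom[OF X(2,3,3) g l] by simp
    have gk: "g \<cdot> k \<in> Hom A Y Z (- u - j)" using cmp_Hom[OF X(2,2,3) k g] by (simp add: deg_swap)
    have kf: "k \<cdot> f \<in> Hom A X Y (- u - i)" using cmp_Hom[OF X(1,2,2) f k] by simp
    have fh: "f \<cdot> h \<in> Hom A X Y (- u - i)" using cmp_Hom[OF X(1,1,2) h f] by (simp add: deg_swap)
    have sgk: "- signed \<sigma> u j (g \<cdot> k) \<in> Hom A Y Z (- u - j)" by (intro Hom_minus X signed_in gk)
    have sfh: "- signed \<sigma> u i (f \<cdot> h) \<in> Hom A X Y (- u - i)" by (intro Hom_minus X signed_in fh)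
    have 1: "(l \<cdot> g + - signed \<sigma> u j (g \<cdot> k)) \<cdot> f = l \<cdot> (g \<cdot> f) - signed \<sigma> u j (g \<cdot> (k \<cdot> f))"
      using add_cmp[OF X f lg sgk] minus_cmp[OF X f gk] cmp_assoc[OF X(1,2,3,3) f g l] cmp_assoc[OF X(1,2,2,3) f k g]
      by (auto simp: signed_def)
    have 2: "g \<cdot> (k \<cdot> f + - signed \<sigma> u i (f \<cdot> h)) = g \<cdot> (k \<cdot> f) - signed \<sigma> u i ((g \<cdot> f) \<cdot> h)"
      using cmp_add[OF X kf sfh g] cmp_minus[OF X fh g] cmp_assoc[OF X(1,1,2,3) h f g]
      by (auto simp: signed_def)
    show ?thesis using * 1 2 by (auto simp: natural_dg_def signed_def form_add2)
  qed
  done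

lemma Phi_ob:
  assumes "has_shifts A" "has_cones u A" "X \<in> Ob A"
  shows "Phi_ob u A X \<in> Ob (natural_dg \<sigma> u A)"
proof -
  note c = idcone_structure[OF assms] note X = assms(3) note E = c(1)
  let ?h = "idcone_iota' u A X \<cdot> idcone_pi' u A X"
  have h: "?h \<in> Hom A (idcone u A X) (idcone u A X) (- u)" using cmp_Hom[OF E X E c(5) c(3)] by simp
  have "dif A (idcone u A X) (idcone u A X) (- u) ?h = idm A (idcone u A X)"
    using dif_cmp[OF E X E c(5) c(3)] c(10,13,14) by (simp add: signed_def)
  moreover have "?h \<cdot> ?h = 0"
    using cmp_assoc[OF E E X E h c(5) c(3)] cmp_assoc[OF E X E X c(5) c(3) c(5)] c(6)
     cmp_0'[OF E X X c(5)] cmp_0[OF E X E c(3)] by simp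
  ultimately show ?thesis using h E by (simp add: natural_dg_def Phi_ob_def)
qed

end

end

theory Submission
  imports Defs
begin

text \<open>
  An object of \<open>E\<^sup>\<natural>\<close> is an object \<open>X\<close> of \<open>E\<close> with a contraction \<open>h\<close>, and a closed morphism of degree 0
  in \<open>E\<^sup>\<natural>\<close> is a closed morphism of degree 0 in \<open>E\<close> that commutes with the contractions.  Since the
  functor \<open>\<Psi>\<^sup>+\<close> forgetting the contraction has to preserve and to reflect admissible sequences, the
  exact structure on \<open>Z\<^sup>0(E\<^sup>\<natural>)\<close> can only consist of the sequences whose underlying sequence in
  \<open>Z\<^sup>0(E)\<close> is admissible; this set is called \<open>lift\<close>.  The work is to show that it is an exact structure
  and that the remaining compatibility conditions hold.

  \<^emph>\<open>The lift is exact.\<close>  Kernels, cokernels, pushouts and pullbacks in \<open>Z\<^sup>0(E)\<close> have their universal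
  property for closed morphisms of degree 0 only, whereas a contraction has degree \<open>-1\<close> and is not
  closed.  But arbitrary morphisms into \<open>W\<close> of a given degree are the same as closed morphisms of degree
  0 into the cone of the identity of a shift of \<open>W\<close> (\<open>represent\<close>), and dually (\<open>corepresent\<close>).  So all
  these universal properties hold for arbitrary homogeneous morphisms (\<open>kernel_factor\<close>,
  \<open>pushout_factor\<close> and so on).  Hence the contractions given on the objects of a diagram induce a unique
  degree \<open>-1\<close> endomorphism of its limit or colimit, and the identities \<open>d h = id\<close> and \<open>h h = 0\<close> follow
  from uniqueness.  In other words, \<open>\<Psi>\<^sup>+\<close> creates the kernels, cokernels, pushouts and pullbacks that
  the axioms mention, and each axiom for \<open>lift\<close> reduces to the same axiom for \<open>\<E>\<close> (\<open>lift_exact\<close>).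

  \<^emph>\<open>\<open>\<Phi>\<close> preserves admissibility.\<close>  The object \<open>K X = cone(id\<^bsub>X[-1]\<^esub>)\<close> underlying \<open>\<Phi>(X)\<close> is an
  admissible extension of \<open>X\<close> by \<open>X[-1]\<close>.  For an admissible \<open>X \<rightarrow> Y \<rightarrow> Z\<close> let \<open>L\<close> be the kernel of the
  admissible epimorphism \<open>K Y \<rightarrow> Y \<rightarrow> Z\<close>; as a graded object it is \<open>Y[-1] \<oplus> X\<close>, and in fact it is the cone
  of \<open>X[-1] \<rightarrow> Y[-1]\<close>.  It is therefore also the pushout of \<open>X[-1] \<rightarrow> Y[-1]\<close> along \<open>X[-1] \<rightarrow> K X\<close>, so both
  \<open>K X \<rightarrow> L\<close> and \<open>L \<rightarrow> K Y\<close> are admissible monomorphisms and so is their composite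
  (\<open>Phi_preserves\<close>).

  \<^emph>\<open>\<open>\<Phi>\<close> reflects admissibility.\<close>  If \<open>K X \<rightarrow> K Y \<rightarrow> K Z\<close> is admissible, then \<open>K Y \<rightarrow> Y \<rightarrow> Z\<close>, being equal
  to \<open>K Y \<rightarrow> K Z \<rightarrow> Z\<close>, is an admissible epimorphism, and \<open>X \<rightarrow> Y\<close> is a kernel of \<open>Y \<rightarrow> Z\<close>.  Quillen's
  obscure axiom (\<open>obscure_axiom\<close>) says that \<open>X \<rightarrow> Y \<rightarrow> Z\<close> is then admissible (\<open>Phi_reflects\<close>).
\<close>

section \<open>Universal properties in preadditive categories\<close>

context preadditive_category
begin

text \<open>
  Bundling the membership of source and target keeps the side conditions of the category axioms
  down to one premise per morphism.
\<close>

definition mor :: "'o \<Rightarrow> 'o \<Rightarrow> 'm \<Rightarrow> bool" where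
  "mor X Y f \<longleftrightarrow> X \<in> Ob C \<and> Y \<in> Ob C \<and> f \<in> Mor C X Y"

lemma mor_ob: "mor X Y f \<Longrightarrow> X \<in> Ob C" "mor X Y f \<Longrightarrow> Y \<in> Ob C"
  by (simp_all add: mor_def)

lemma mor_id: "X \<in> Ob C \<Longrightarrow> mor X X (idm C X)"
  by (simp add: mor_def Id_Mor)

lemma mor_comp: "mor Y Z g \<Longrightarrow> mor X Y f \<Longrightarrow> mor X Z (g \<cdot> f)"
  by (auto simp: mor_def intro: cmp_Mor)

lemma mor_0: "X \<in> Ob C \<Longrightarrow> Y \<in> Ob C \<Longrightarrow> mor X Y 0"
  using Mor_subgrp by (simp add: mor_def subgrp_def)

lemma mor_add: "mor X Y f \<Longrightarrow> mor X Y f' \<Longrightarrow> mor X Y (f + f')"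
  using Mor_subgrp by (auto simp: mor_def subgrp_def)

lemma mor_minus: "mor X Y f \<Longrightarrow> mor X Y (- f)"
  using Mor_subgrp by (auto simp: mor_def subgrp_def)

lemma mor_diff: "mor X Y f \<Longrightarrow> mor X Y f' \<Longrightarrow> mor X Y (f - f')"
  using mor_add[OF _ mor_minus] by fastforce

lemma comp_assoc: "mor Y Z h \<Longrightarrow> mor X Y g \<Longrightarrow> mor W X f \<Longrightarrow> (h \<cdot> g) \<cdot> f = h \<cdot> (g \<cdot> f)"
  by (auto simp: mor_def intro: cmp_assoc)

lemma comp_id: "mor X Y f \<Longrightarrow> f \<cdot> idm C X = f"
  by (auto simp: mor_def intro: cmp_Id)

lemma id_comp: "mor X Y f \<Longrightarrow> idm C Y \<cdot> f = f"
  by (auto simp: mor_def intro: Id_cmp)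

lemma comp_add: "mor Y Z g \<Longrightarrow> mor X Y f \<Longrightarrow> mor X Y f' \<Longrightarrow> g \<cdot> (f + f') = g \<cdot> f + g \<cdot> f'"
  by (auto simp: mor_def cmp_add)

lemma add_comp: "mor Y Z g \<Longrightarrow> mor Y Z g' \<Longrightarrow> mor X Y f \<Longrightarrow> (g + g') \<cdot> f = g \<cdot> f + g' \<cdot> f"
  by (auto simp: mor_def add_cmp)

lemma comp_0: "mor Y Z g \<Longrightarrow> X \<in> Ob C \<Longrightarrow> g \<cdot> 0 = 0"
  using comp_add[of Y Z g X 0 0] mor_0[of X Y] mor_ob[of Y Z g] by simp

lemma zero_comp: "mor X Y f \<Longrightarrow> Z \<in> Ob C \<Longrightarrow> 0 \<cdot> f = 0"
  using add_comp[of Y Z 0 0 X f] mor_0[of Y Z] mor_ob[of X Y f] by simp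

lemma comp_minus: "mor Y Z g \<Longrightarrow> mor X Y f \<Longrightarrow> g \<cdot> (- f) = - (g \<cdot> f)"
  using comp_add[of Y Z g X f "- f"] comp_0[of Y Z g X] mor_minus[of X Y f] mor_ob[of X Y f]
  by (simp add: add_eq_0_iff)

lemma minus_comp: "mor Y Z g \<Longrightarrow> mor X Y f \<Longrightarrow> (- g) \<cdot> f = - (g \<cdot> f)"
  using add_comp[of Y Z g "- g" X f] zero_comp[of X Y f Z] mor_minus[of Y Z g] mor_ob[of Y Z g]
  by (simp add: add_eq_0_iff)

lemma comp_diff: "mor Y Z g \<Longrightarrow> mor X Y f \<Longrightarrow> mor X Y f' \<Longrightarrow> g \<cdot> (f - f') = g \<cdot> f - g \<cdot> f'"
  using comp_add[of Y Z g X f "- f'"] comp_minus[of Y Z g X f'] mor_minus[of X Y f'] by simp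

lemma diff_comp: "mor Y Z g \<Longrightarrow> mor Y Z g' \<Longrightarrow> mor X Y f \<Longrightarrow> (g - g') \<cdot> f = g \<cdot> f - g' \<cdot> f"
  using add_comp[of Y Z g "- g'" X f] minus_comp[of Y Z g' X f] mor_minus[of Y Z g'] by simp

definition kernel :: "('o, 'm) seq \<Rightarrow> bool" where
  "kernel = (\<lambda>(X, f, Y, g, Z). mor X Y f \<and> mor Y Z g \<and> g \<cdot> f = 0 \<and>
     (\<forall>W h. mor W Y h \<and> g \<cdot> h = 0 \<longrightarrow> (\<exists>!k. mor W X k \<and> f \<cdot> k = h)))"

definition cokernel :: "('o, 'm) seq \<Rightarrow> bool" where
  "cokernel = (\<lambda>(X, f, Y, g, Z). mor X Y f \<and> mor Y Z g \<and> g \<cdot> f = 0 \<and>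
     (\<forall>W h. mor Y W h \<and> h \<cdot> f = 0 \<longrightarrow> (\<exists>!k. mor Z W k \<and> k \<cdot> g = h)))"

lemma kernel_cokernel_pair_iff: "kernel_cokernel_pair C s \<longleftrightarrow> kernel s \<and> cokernel s"
proof (cases s)
  case (fields X f Y g Z)
  show ?thesis unfolding fields kernel_cokernel_pair_def kernel_def cokernel_def composable_def mor_def prod.case
    by (intro iffI conjI; (elim conjE)?; (intro allI ballI impI)?; (elim conjE)?; simp?)
qed

lemma is_pushout_iff:
  assumes "mor X Y f" "mor X X' a"
  shows "is_pushout C X Y X' f a P f' b \<longleftrightarrow> mor X' P f' \<and> mor Y P b \<and> b \<cdot> f = f' \<cdot> a \<and>
     (\<forall>W p q. mor X' W p \<and> mor Y W q \<and> q \<cdot> f = p \<cdot> a \<longrightarrow>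
        (\<exists>!k. mor P W k \<and> k \<cdot> f' = p \<and> k \<cdot> b = q))"
  using assms unfolding is_pushout_def mor_def
  by (intro iffI conjI; (elim conjE)?; (intro allI ballI impI)?; (elim conjE)?; simp?)

lemma is_pullback_iff:
  assumes "mor Y Z g" "mor Z' Z a"
  shows "is_pullback C Y Z Z' g a P g' b \<longleftrightarrow> mor P Z' g' \<and> mor P Y b \<and> g \<cdot> b = a \<cdot> g' \<and>
     (\<forall>W p q. mor W Z' p \<and> mor W Y q \<and> g \<cdot> q = a \<cdot> p \<longrightarrow>
        (\<exists>!k. mor W P k \<and> g' \<cdot> k = p \<and> b \<cdot> k = q))"
  using assms unfolding is_pullback_def mor_def
  by (intro iffI conjI; (elim conjE)?; (intro allI ballI impI)?; (elim conjE)?; simp?)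

lemma is_isoI:
  assumes "mor X Y f" "mor Y X g" "g \<cdot> f = idm C X" "f \<cdot> g = idm C Y"
  shows "is_iso C X Y f"
  using assms by (auto simp: is_iso_def mor_def)

lemma is_isoE:
  assumes "is_iso C X Y f" "X \<in> Ob C" "Y \<in> Ob C"
  obtains g where "mor X Y f" "mor Y X g" "g \<cdot> f = idm C X" "f \<cdot> g = idm C Y"
  using assms by (auto simp: is_iso_def mor_def)

lemma is_iso_id: "X \<in> Ob C \<Longrightarrow> is_iso C X X (idm C X)"
  by (rule is_isoI[OF mor_id mor_id]) (simp_all add: comp_id[OF mor_id])

lemma kernelD:
  assumes "kernel (X, f, Y, g, Z)"
  shows "mor X Y f" "mor Y Z g" "g \<cdot> f = 0"
    "\<And>W h. mor W Y h \<Longrightarrow> g \<cdot> h = 0 \<Longrightarrow> \<exists>k. mor W X k \<and> f \<cdot> k = h"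
  using assms unfolding kernel_def by blast+

lemma kernel_mono:
  assumes "kernel (X, f, Y, g, Z)" "mor W X h" "mor W X h'" "f \<cdot> h = f \<cdot> h'"
  shows "h = h'"
proof -
  note k = kernelD[OF assms(1)]
  have "g \<cdot> (f \<cdot> h) = 0"
    using comp_assoc[OF k(2,1) assms(2)] k(3) zero_comp[OF assms(2) mor_ob(2)[OF k(2)]] by simp
  then have "\<exists>!k. mor W X k \<and> f \<cdot> k = f \<cdot> h"
    using assms(1) mor_comp[OF k(1) assms(2)] unfolding kernel_def by blast
  then show ?thesis using assms(2-4) by auto
qed

lemma cokernelD:
  assumes "cokernel (X, f, Y, g, Z)"
  shows "mor X Y f" "mor Y Z g" "g \<cdot> f = 0"
    "\<And>W h. mor Y W h \<Longrightarrow> h \<cdot> f = 0 \<Longrightarrow> \<exists>k. mor Z W k \<and> k \<cdot> g = h"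
  using assms unfolding cokernel_def by blast+

lemma cokernel_epi:
  assumes "cokernel (X, f, Y, g, Z)" "mor Z W h" "mor Z W h'" "h \<cdot> g = h' \<cdot> g"
  shows "h = h'"
proof -
  note k = cokernelD[OF assms(1)]
  have "(h \<cdot> g) \<cdot> f = 0"
    using comp_assoc[OF assms(2) k(2,1)] k(3) comp_0[OF assms(2) mor_ob(1)[OF k(1)]] by simp
  then have "\<exists>!k. mor Z W k \<and> k \<cdot> g = h \<cdot> g"
    using assms(1) mor_comp[OF assms(2) k(2)] unfolding cokernel_def by blast
  then show ?thesis using assms(2-4) by auto
qed

lemma pushoutD:
  assumes "is_pushout C X Y X' f a P f' b" "mor X Y f" "mor X X' a"
  shows "mor X' P f'" "mor Y P b" "b \<cdot> f = f' \<cdot> a"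
    "\<And>W p q. mor X' W p \<Longrightarrow> mor Y W q \<Longrightarrow> q \<cdot> f = p \<cdot> a \<Longrightarrow> \<exists>k. mor P W k \<and> k \<cdot> f' = p \<and> k \<cdot> b = q"
proof -
  note * = assms(1)[unfolded is_pushout_iff[OF assms(2,3)]]
  show "mor X' P f'" "mor Y P b" "b \<cdot> f = f' \<cdot> a" using * by auto
  show "\<exists>k. mor P W k \<and> k \<cdot> f' = p \<and> k \<cdot> b = q"
    if "mor X' W p" "mor Y W q" "q \<cdot> f = p \<cdot> a" for W p q
    using * that by blast
qed

lemma pushout_eq:
  assumes "is_pushout C X Y X' f a P f' b" "mor X Y f" "mor X X' a"
    and k: "mor P W k" "mor P W l" "k \<cdot> f' = l \<cdot> f'" "k \<cdot> b = l \<cdot> b"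
  shows "k = l"
proof -
  note D = pushoutD[OF assms(1-3)]
  have "(k \<cdot> b) \<cdot> f = (k \<cdot> f') \<cdot> a"
    using comp_assoc[OF k(1) D(2) assms(2)] comp_assoc[OF k(1) D(1) assms(3)] D(3) by simp
  then have "\<exists>!m. mor P W m \<and> m \<cdot> f' = k \<cdot> f' \<and> m \<cdot> b = k \<cdot> b"
    using assms(1) mor_comp[OF k(1) D(1)] mor_comp[OF k(1) D(2)]
    unfolding is_pushout_iff[OF assms(2,3)] by blast
  then show ?thesis using k by auto
qed

lemma pullbackD:
  assumes "is_pullback C Y Z Z' g a P g' b" "mor Y Z g" "mor Z' Z a"
  shows "mor P Z' g'" "mor P Y b" "g \<cdot> b = a \<cdot> g'"
    "\<And>W p q. mor W Z' p \<Longrightarrow> mor W Y q \<Longrightarrow> g \<cdot> q = a \<cdot> p \<Longrightarrow> \<exists>k. mor W P k \<and> g' \<cdot> k = p \<and> b \<cdot> k = q"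
proof -
  note * = assms(1)[unfolded is_pullback_iff[OF assms(2,3)]]
  show "mor P Z' g'" "mor P Y b" "g \<cdot> b = a \<cdot> g'" using * by auto
  show "\<exists>k. mor W P k \<and> g' \<cdot> k = p \<and> b \<cdot> k = q"
    if "mor W Z' p" "mor W Y q" "g \<cdot> q = a \<cdot> p" for W p q
    using * that by blast
qed

lemma pullback_eq:
  assumes "is_pullback C Y Z Z' g a P g' b" "mor Y Z g" "mor Z' Z a"
    and k: "mor W P k" "mor W P l" "g' \<cdot> k = g' \<cdot> l" "b \<cdot> k = b \<cdot> l"
  shows "k = l"
proof -
  note D = pullbackD[OF assms(1-3)]
  have "g \<cdot> (b \<cdot> k) = a \<cdot> (g' \<cdot> k)"
    using comp_assoc[OF assms(2) D(2) k(1)] comp_assoc[OF assms(3) D(1) k(1)] D(3) by simp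
  then have "\<exists>!m. mor W P m \<and> g' \<cdot> m = g' \<cdot> k \<and> b \<cdot> m = b \<cdot> k"
    using assms(1) mor_comp[OF D(1) k(1)] mor_comp[OF D(2) k(1)]
    unfolding is_pullback_iff[OF assms(2,3)] by blast
  then show ?thesis using k by auto
qed

text \<open>Uniqueness of a factorization is additive, so it only has to be checked for zero.\<close>

lemma kernelI:
  assumes "mor X Y f" "mor Y Z g" "g \<cdot> f = 0"
    and ex: "\<And>W h. mor W Y h \<Longrightarrow> g \<cdot> h = 0 \<Longrightarrow> \<exists>k. mor W X k \<and> f \<cdot> k = h"
    and un: "\<And>W k. mor W X k \<Longrightarrow> f \<cdot> k = 0 \<Longrightarrow> k = 0"
  shows "kernel (X, f, Y, g, Z)"
proof -
  have "k = k'" if "mor W X k" "mor W X k'" "f \<cdot> k = f \<cdot> k'" for W k k'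
    using un[OF mor_diff[OF that(1,2)]] comp_diff[OF assms(1) that(1,2)] that(3) by simp
  then show ?thesis using assms(1-3) ex unfolding kernel_def prod.case by metis
qed

lemma cokernelI:
  assumes "mor X Y f" "mor Y Z g" "g \<cdot> f = 0"
    and ex: "\<And>W h. mor Y W h \<Longrightarrow> h \<cdot> f = 0 \<Longrightarrow> \<exists>k. mor Z W k \<and> k \<cdot> g = h"
    and un: "\<And>W k. mor Z W k \<Longrightarrow> k \<cdot> g = 0 \<Longrightarrow> k = 0"
  shows "cokernel (X, f, Y, g, Z)"
proof -
  have "k = k'" if "mor Z W k" "mor Z W k'" "k \<cdot> g = k' \<cdot> g" for W k k'
    using un[OF mor_diff[OF that(1,2)]] diff_comp[OF that(1,2) assms(2)] that(3) by simp
  then show ?thesis using assms(1-3) ex unfolding cokernel_def prod.case by metis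
qed

lemma pushoutI:
  assumes "mor X Y f" "mor X X' a" "mor X' P f'" "mor Y P b" "b \<cdot> f = f' \<cdot> a"
    and ex: "\<And>W p q. mor X' W p \<Longrightarrow> mor Y W q \<Longrightarrow> q \<cdot> f = p \<cdot> a \<Longrightarrow> \<exists>k. mor P W k \<and> k \<cdot> f' = p \<and> k \<cdot> b = q"
    and un: "\<And>W k. mor P W k \<Longrightarrow> k \<cdot> f' = 0 \<Longrightarrow> k \<cdot> b = 0 \<Longrightarrow> k = 0"
  shows "is_pushout C X Y X' f a P f' b"
proof -
  have "k = k'" if "mor P W k" "mor P W k'" "k \<cdot> f' = k' \<cdot> f'" "k \<cdot> b = k' \<cdot> b" for W k k'
    using un[OF mor_diff[OF that(1,2)]] diff_comp[OF that(1,2) assms(3)]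
      diff_comp[OF that(1,2) assms(4)] that(3,4) by simp
  then have "\<exists>!k. mor P W k \<and> k \<cdot> f' = p \<and> k \<cdot> b = q"
    if "mor X' W p" "mor Y W q" "q \<cdot> f = p \<cdot> a" for W p q
    using ex[OF that] by (intro ex_ex1I) auto
  then show ?thesis using assms(3-5) unfolding is_pushout_iff[OF assms(1,2)] by blast
qed

lemma pullbackI:
  assumes "mor Y Z g" "mor Z' Z a" "mor P Z' g'" "mor P Y b" "g \<cdot> b = a \<cdot> g'"
    and ex: "\<And>W p q. mor W Z' p \<Longrightarrow> mor W Y q \<Longrightarrow> g \<cdot> q = a \<cdot> p \<Longrightarrow> \<exists>k. mor W P k \<and> g' \<cdot> k = p \<and> b \<cdot> k = q"
    and un: "\<And>W k. mor W P k \<Longrightarrow> g' \<cdot> k = 0 \<Longrightarrow> b \<cdot> k = 0 \<Longrightarrow> k = 0"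
  shows "is_pullback C Y Z Z' g a P g' b"
proof -
  have "k = k'" if "mor W P k" "mor W P k'" "g' \<cdot> k = g' \<cdot> k'" "b \<cdot> k = b \<cdot> k'" for W k k'
    using un[OF mor_diff[OF that(1,2)]] comp_diff[OF assms(3) that(1,2)]
      comp_diff[OF assms(4) that(1,2)] that(3,4) by simp
  then have "\<exists>!k. mor W P k \<and> g' \<cdot> k = p \<and> b \<cdot> k = q"
    if "mor W Z' p" "mor W Y q" "g \<cdot> q = a \<cdot> p" for W p q
    using ex[OF that] by (intro ex_ex1I) auto
  then show ?thesis using assms(3-5) unfolding is_pullback_iff[OF assms(1,2)] by blast
qed

lemma cokernel_unique:
  assumes "cokernel (X, f, Y, g, Z)" "cokernel (X, f, Y, g', Z')"
  shows "\<exists>c. is_iso C Z Z' c \<and> c \<cdot> g = g'"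
proof -
  note k = cokernelD[OF assms(1)] and k' = cokernelD[OF assms(2)]
  obtain c where c: "mor Z Z' c" "c \<cdot> g = g'" using k(4)[OF k'(2,3)] by blast
  obtain c' where c': "mor Z' Z c'" "c' \<cdot> g' = g" using k'(4)[OF k(2,3)] by blast
  have "c' \<cdot> c = idm C Z"
    by (rule cokernel_epi[OF assms(1) mor_comp[OF c'(1) c(1)] mor_id[OF mor_ob(2)[OF k(2)]]])
      (simp add: comp_assoc[OF c'(1) c(1) k(2)] c(2) c'(2) id_comp[OF k(2)])
  moreover have "c \<cdot> c' = idm C Z'"
    by (rule cokernel_epi[OF assms(2) mor_comp[OF c(1) c'(1)] mor_id[OF mor_ob(2)[OF k'(2)]]])
      (simp add: comp_assoc[OF c(1) c'(1) k'(2)] c(2) c'(2) id_comp[OF k'(2)])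
  ultimately show ?thesis using c c' is_isoI by blast
qed

lemma pushout_unique:
  assumes f: "mor X Y f" and a: "mor X X' a"
    and P: "is_pushout C X Y X' f a P f' b" and Q: "is_pushout C X Y X' f a Q f'' b'"
  shows "\<exists>c. is_iso C P Q c \<and> c \<cdot> f' = f''"
proof -
  note p = pushoutD[OF P f a] and q = pushoutD[OF Q f a]
  obtain c where c: "mor P Q c" "c \<cdot> f' = f''" "c \<cdot> b = b'" using p(4)[OF q(1-3)] by blast
  obtain c' where c': "mor Q P c'" "c' \<cdot> f'' = f'" "c' \<cdot> b' = b" using q(4)[OF p(1-3)] by blast
  have "c' \<cdot> c = idm C P"
    by (rule pushout_eq[OF P f a mor_comp[OF c'(1) c(1)] mor_id[OF mor_ob(2)[OF p(2)]]])
      (simp_all add: comp_assoc[OF c'(1) c(1) p(1)] comp_assoc[OF c'(1) c(1) p(2)] c c' id_comp[OF p(1)] id_comp[OF p(2)])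
  moreover have "c \<cdot> c' = idm C Q"
    by (rule pushout_eq[OF Q f a mor_comp[OF c(1) c'(1)] mor_id[OF mor_ob(2)[OF q(2)]]])
      (simp_all add: comp_assoc[OF c(1) c'(1) q(1)] comp_assoc[OF c(1) c'(1) q(2)] c c' id_comp[OF q(1)] id_comp[OF q(2)])
  ultimately show ?thesis using c c' is_isoI by blast
qed

lemma pullback_unique:
  assumes g: "mor Y Z g" and a: "mor Z' Z a"
    and P: "is_pullback C Y Z Z' g a P g' b" and Q: "is_pullback C Y Z Z' g a Q g'' b'"
  shows "\<exists>c. is_iso C Q P c \<and> g' \<cdot> c = g''"
proof -
  note p = pullbackD[OF P g a] and q = pullbackD[OF Q g a]
  obtain c where c: "mor Q P c" "g' \<cdot> c = g''" "b \<cdot> c = b'" using p(4)[OF q(1-3)] by blast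
  obtain c' where c': "mor P Q c'" "g'' \<cdot> c' = g'" "b' \<cdot> c' = b" using q(4)[OF p(1-3)] by blast
  have "c \<cdot> c' = idm C P"
    by (rule pullback_eq[OF P g a mor_comp[OF c(1) c'(1)] mor_id[OF mor_ob(1)[OF p(2)]]])
      (simp_all add: comp_assoc[OF p(1) c(1) c'(1), symmetric] comp_assoc[OF p(2) c(1) c'(1), symmetric] c c' comp_id[OF p(1)] comp_id[OF p(2)])
  moreover have "c' \<cdot> c = idm C Q"
    by (rule pullback_eq[OF Q g a mor_comp[OF c'(1) c(1)] mor_id[OF mor_ob(1)[OF q(2)]]])
      (simp_all add: comp_assoc[OF q(1) c'(1) c(1), symmetric] comp_assoc[OF q(2) c'(1) c(1), symmetric] c c' comp_id[OF q(1)] comp_id[OF q(2)])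
  ultimately show ?thesis using c c' is_isoI by blast
qed

end

section \<open>Exact categories and the obscure axiom\<close>

locale exact_category = preadditive_category C
  for C :: "('o, 'm::ab_group_add) precat" (structure) +
  fixes \<E> :: "('o, 'm) seq set"
  assumes exact: "exact_structure C \<E>"
begin

lemmas exact_axioms = exact[unfolded exact_structure_def]
lemmas additive = exact_axioms[THEN conjunct1]
lemmas kernel_cokernel = exact_axioms[THEN conjunct2, THEN conjunct1]
lemmas iso_closed = exact_axioms[THEN conjunct2, THEN conjunct2, THEN conjunct1]
lemmas id_admissible = exact_axioms[THEN conjunct2, THEN conjunct2, THEN conjunct2, THEN conjunct1]
lemmas mono_comp_ax = exact_axioms[THEN conjunct2, THEN conjunct2, THEN conjunct2, THEN conjunct2, THEN conjunct1]
lemmas epi_comp_ax = exact_axioms[THEN conjunct2, THEN conjunct2, THEN conjunct2, THEN conjunct2, THEN conjunct2, THEN conjunct1]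
lemmas pushout_ax = exact_axioms[THEN conjunct2, THEN conjunct2, THEN conjunct2, THEN conjunct2, THEN conjunct2, THEN conjunct2, THEN conjunct1]
lemmas pullback_ax = exact_axioms[THEN conjunct2, THEN conjunct2, THEN conjunct2, THEN conjunct2, THEN conjunct2, THEN conjunct2, THEN conjunct2]

lemma E_kernel: "s \<in> \<E> \<Longrightarrow> kernel s" and E_cokernel: "s \<in> \<E> \<Longrightarrow> cokernel s"
  using kernel_cokernel kernel_cokernel_pair_iff by auto

lemma E_mor: "(X, f, Y, g, Z) \<in> \<E> \<Longrightarrow> mor X Y f" "(X, f, Y, g, Z) \<in> \<E> \<Longrightarrow> mor Y Z g"
  using E_kernel unfolding kernel_def by fastforce+

lemma E_iso:
  assumes "(X, f, Y, g, Z) \<in> \<E>" "is_iso C X X' a" "is_iso C Y Y' b" "is_iso C Z Z' c"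
    "mor X' Y' f'" "mor Y' Z' g'" "b \<cdot> f = f' \<cdot> a" "c \<cdot> g = g' \<cdot> b"
  shows "(X', f', Y', g', Z') \<in> \<E>"
proof -
  have "composable C (X', f', Y', g', Z')" using assms by (simp add: composable_def mor_def)
  moreover have "seq_iso C (X, f, Y, g, Z) (X', f', Y', g', Z')"
    using assms unfolding seq_iso_def prod.case by blast
  ultimately show ?thesis using iso_closed assms(1) by blast
qed

lemma mono_comp:
  "admissible_mono \<E> X Y f \<Longrightarrow> admissible_mono \<E> Y Z g \<Longrightarrow> admissible_mono \<E> X Z (g \<cdot> f)"
  using mono_comp_ax by blast

lemma epi_comp:
  "admissible_epi \<E> X Y f \<Longrightarrow> admissible_epi \<E> Y Z g \<Longrightarrow> admissible_epi \<E> X Z (g \<cdot> f)"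
  using epi_comp_ax by blast

lemma mono_mor: "admissible_mono \<E> X Y f \<Longrightarrow> mor X Y f"
  unfolding admissible_mono_def using E_mor by blast

lemma epi_mor: "admissible_epi \<E> Y Z g \<Longrightarrow> mor Y Z g"
  unfolding admissible_epi_def using E_mor by blast

lemma pushout_exists:
  assumes "admissible_mono \<E> X Y f" "mor X X' a"
  obtains P f' b where "is_pushout C X Y X' f a P f' b" "admissible_mono \<E> X' P f'"
  using pushout_ax assms unfolding mor_def by blast

lemma pullback_exists:
  assumes "admissible_epi \<E> Y Z g" "mor Z' Z a"
  obtains P g' b where "is_pullback C Y Z Z' g a P g' b" "admissible_epi \<E> P Z' g'"
  using pullback_ax assms unfolding mor_def by blast

lemma mono_pushout:
  assumes f: "admissible_mono \<E> X Y f" and a: "mor X X' a"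
    and P: "is_pushout C X Y X' f a P f' b"
  shows "admissible_mono \<E> X' P f'"
proof -
  note fm = mono_mor[OF f]
  obtain Q f0 b0 where Q: "is_pushout C X Y X' f a Q f0 b0" "admissible_mono \<E> X' Q f0"
    using pushout_exists[OF f a] by blast
  then obtain c where c: "is_iso C Q P c" "c \<cdot> f0 = f'" using pushout_unique[OF fm a _ P] by blast
  obtain Z g where s: "(X', f0, Q, g, Z) \<in> \<E>" using Q(2) by (auto simp: admissible_mono_def)
  have t: "mor X' Q f0" "mor Q Z g" using E_mor[OF s] by auto
  have P': "mor X' P f'" using P is_pushout_iff[OF fm a] by auto
  obtain d where d: "mor Q P c" "mor P Q d" "d \<cdot> c = idm C Q"
    using is_isoE[OF c(1) mor_ob(2)[OF t(1)] mor_ob(2)[OF P']] by blast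
  have "(X', f', P, g \<cdot> d, Z) \<in> \<E>"
  proof (rule E_iso[OF s is_iso_id c(1) is_iso_id])
    show "c \<cdot> f0 = f' \<cdot> idm C X'" using c comp_id[OF P'] by simp
    show "idm C Z \<cdot> g = (g \<cdot> d) \<cdot> c" using comp_assoc[OF t(2) d(2,1)] d(3) comp_id[OF t(2)] id_comp[OF t(2)] by simp
  qed (use t P' d mor_ob mor_comp in blast)+
  then show ?thesis by (auto simp: admissible_mono_def)
qed

lemma epi_pullback:
  assumes g: "admissible_epi \<E> Y Z g" and a: "mor Z' Z a"
    and P: "is_pullback C Y Z Z' g a P g' b"
  shows "admissible_epi \<E> P Z' g'"
proof -
  note gm = epi_mor[OF g]
  obtain Q g0 b0 where Q: "is_pullback C Y Z Z' g a Q g0 b0" "admissible_epi \<E> Q Z' g0"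
    using pullback_exists[OF g a] by blast
  then obtain c where c: "is_iso C Q P c" "g' \<cdot> c = g0" using pullback_unique[OF gm a P] by blast
  obtain X f where s: "(X, f, Q, g0, Z') \<in> \<E>" using Q(2) by (auto simp: admissible_epi_def)
  have t: "mor X Q f" "mor Q Z' g0" using E_mor[OF s] by auto
  have P': "mor P Z' g'" using P is_pullback_iff[OF gm a] by auto
  have c': "mor Q P c" using is_isoE[OF c(1) mor_ob(1)[OF t(2)] mor_ob(1)[OF P']] by blast
  have "(X, c \<cdot> f, P, g', Z') \<in> \<E>"
  proof (rule E_iso[OF s is_iso_id c(1) is_iso_id])
    show "c \<cdot> f = (c \<cdot> f) \<cdot> idm C X" using comp_id[OF mor_comp[OF c' t(1)]] by simp
    show "idm C Z' \<cdot> g0 = g' \<cdot> c" using c id_comp[OF t(2)] by simp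
  qed (use t P' c' mor_ob mor_comp in blast)+
  then show ?thesis by (auto simp: admissible_epi_def)
qed

text \<open>
  An admissible monomorphism has some admissible cokernel, and cokernels are unique up to
  isomorphism.
\<close>

lemma admissible_cokernel:
  assumes f: "admissible_mono \<E> X Y f" and g: "cokernel (X, f, Y, g, Z)"
  shows "(X, f, Y, g, Z) \<in> \<E>"
proof -
  obtain Z' g' where s: "(X, f, Y, g', Z') \<in> \<E>" using f by (auto simp: admissible_mono_def)
  obtain c where c: "is_iso C Z' Z c" "c \<cdot> g' = g" using cokernel_unique[OF E_cokernel[OF s] g] by blast
  have g': "mor Y Z g" "mor X Y f" using g by (auto simp: cokernel_def)
  show ?thesis
    by (rule E_iso[OF s is_iso_id is_iso_id c(1)])
      (use g' c mor_ob(1)[OF g'(2)] mor_ob(2)[OF g'(2)] in \<open>simp_all add: comp_id id_comp\<close>)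
qed

lemma biproductE:
  assumes "X \<in> Ob C" "Y \<in> Ob C"
  obtains P i j p q where "mor X P i" "mor Y P j" "mor P X p" "mor P Y q"
    "p \<cdot> i = idm C X" "q \<cdot> j = idm C Y" "q \<cdot> i = 0" "p \<cdot> j = 0" "i \<cdot> p + j \<cdot> q = idm C P"
proof -
  have "\<exists>P. is_biproduct C X Y P" using assms additive unfolding additive_category_def by blast
  then show ?thesis using assms that unfolding is_biproduct_def mor_def by blast
qed

context
  fixes X Y P i j p q
  assumes P: "mor X P i" "mor Y P j" "mor P X p" "mor P Y q"
    "p \<cdot> i = idm C X" "q \<cdot> j = idm C Y" "q \<cdot> i = 0" "p \<cdot> j = 0" "i \<cdot> p + j \<cdot> q = idm C P"
begin

lemma pair:
  assumes "mor W X s" "mor W Y t"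
  shows "mor W P (i \<cdot> s + j \<cdot> t)" "p \<cdot> (i \<cdot> s + j \<cdot> t) = s" "q \<cdot> (i \<cdot> s + j \<cdot> t) = t"
proof -
  have m: "mor W P (i \<cdot> s)" "mor W P (j \<cdot> t)" using mor_comp P assms by blast+
  show "mor W P (i \<cdot> s + j \<cdot> t)" by (rule mor_add[OF m])
  show "p \<cdot> (i \<cdot> s + j \<cdot> t) = s"
    using comp_add[OF P(3) m] comp_assoc[OF P(3,1) assms(1)] comp_assoc[OF P(3,2) assms(2)]
      P(5,8) id_comp[OF assms(1)] zero_comp[OF assms(2) mor_ob(2)[OF P(3)]] by simp
  show "q \<cdot> (i \<cdot> s + j \<cdot> t) = t"
    using comp_add[OF P(4) m] comp_assoc[OF P(4,1) assms(1)] comp_assoc[OF P(4,2) assms(2)]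
      P(6,7) id_comp[OF assms(2)] zero_comp[OF assms(1) mor_ob(2)[OF P(4)]] by simp
qed

lemma pair_0:
  assumes k: "mor W P k" "p \<cdot> k = 0" "q \<cdot> k = 0"
  shows "k = 0"
proof -
  have "k = (i \<cdot> p + j \<cdot> q) \<cdot> k" using P(9) id_comp[OF k(1)] by simp
  then show ?thesis
    using add_comp[OF mor_comp[OF P(1,3)] mor_comp[OF P(2,4)] k(1)]
      comp_assoc[OF P(1,3) k(1)] comp_assoc[OF P(2,4) k(1)] k
      comp_0[OF P(1) mor_ob(1)[OF k(1)]] comp_0[OF P(2) mor_ob(1)[OF k(1)]] by simp
qed

lemma pair_eq:
  assumes k: "mor W P k" "mor W P l" "p \<cdot> k = p \<cdot> l" "q \<cdot> k = q \<cdot> l"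
  shows "k = l"
  using pair_0[OF mor_diff[OF k(1,2)]] comp_diff[OF P(3) k(1,2)] comp_diff[OF P(4) k(1,2)] k(3,4) by simp

end

text \<open>
  The object \<open>N\<close> is the cokernel of the identity, hence a zero object.  Pullbacks along morphisms to
  \<open>N\<close> are products, which is how split epimorphisms are seen to be admissible.
\<close>

lemma epi_to_zero:
  assumes "Y \<in> Ob C" obtains N where "admissible_epi \<E> Y N 0" "\<And>W h. mor W N h \<Longrightarrow> h = 0"
proof -
  obtain N g where s: "(Y, idm C Y, Y, g, N) \<in> \<E>"
    using assms id_admissible unfolding admissible_mono_def by blast
  have g: "mor Y N g" "g \<cdot> idm C Y = 0" using E_cokernel[OF s] by (auto simp: cokernel_def)
  then have g0: "g = 0" using comp_id by metis
  have N: "N \<in> Ob C" using g mor_ob by blast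
  have "\<exists>!k. mor N N k \<and> k \<cdot> g = g" using E_cokernel[OF s] g unfolding cokernel_def by auto
  moreover have "mor N N 0" "0 \<cdot> g = g" "mor N N (idm C N)" "idm C N \<cdot> g = g"
    using mor_0 N zero_comp[OF g(1) N] g0 mor_id id_comp[OF g(1)] by auto
  ultimately have "idm C N = 0" by blast
  then have "h = 0" if "mor W N h" for W h using id_comp[OF that] zero_comp[OF that N] by simp
  moreover have "admissible_epi \<E> Y N 0" using s g0 by (auto simp: admissible_epi_def)
  ultimately show ?thesis using that by blast
qed

text \<open>
  Quillen's ``obscure axiom''.  The morphism \<open>g p\<close> on the biproduct \<open>P\<close> of \<open>Y\<close> and \<open>V\<close>, with \<open>p\<close> the
  projection to \<open>Y\<close>, is a composite of two pullbacks of admissible epimorphisms, one of them being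
  \<open>g e\<close>.  Its kernel \<open>k\<close> is thus an admissible monomorphism, and \<open>f\<close> is a pushout of \<open>k\<close>: intuitively,
  \<open>k\<close> is the sum of \<open>f\<close> and the identity of \<open>V\<close>, and the summand \<open>V\<close> is collapsed.
\<close>

lemma obscure_axiom:
  assumes ker: "kernel (X, f, Y, g, Z)" and e: "mor V Y e" and ge: "admissible_epi \<E> V Z (g \<cdot> e)"
  shows "(X, f, Y, g, Z) \<in> \<E>"
proof -
  note f = kernelD(1)[OF ker] and g = kernelD(2)[OF ker] and gf = kernelD(3)[OF ker]
  note X = mor_ob(1)[OF f] and Y = mor_ob(2)[OF f] and Z = mor_ob(2)[OF g] and V = mor_ob(1)[OF e]
  note gem = epi_mor[OF ge]
  obtain P i j p q where P: "mor Y P i" "mor V P j" "mor P Y p" "mor P V q"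
    "p \<cdot> i = idm C Y" "q \<cdot> j = idm C V" "q \<cdot> i = 0" "p \<cdot> j = 0" "i \<cdot> p + j \<cdot> q = idm C P"
    using biproductE[OF Y V] .
  obtain Q i' j' p' q' where Q: "mor Y Q i'" "mor Z Q j'" "mor Q Y p'" "mor Q Z q'"
    "p' \<cdot> i' = idm C Y" "q' \<cdot> j' = idm C Z" "q' \<cdot> i' = 0" "p' \<cdot> j' = 0" "i' \<cdot> p' + j' \<cdot> q' = idm C Q"
    using biproductE[OF Y Z] .
  have pairP: "mor W P (i \<cdot> s + j \<cdot> t)" "p \<cdot> (i \<cdot> s + j \<cdot> t) = s" "q \<cdot> (i \<cdot> s + j \<cdot> t) = t"
    if "mor W Y s" "mor W V t" for W s t
    using pair[OF P that] .
  have pairQ: "mor W Q (i' \<cdot> s + j' \<cdot> t)" "p' \<cdot> (i' \<cdot> s + j' \<cdot> t) = s" "q' \<cdot> (i' \<cdot> s + j' \<cdot> t) = t"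
    if "mor W Y s" "mor W Z t" for W s t
    using pair[OF Q that] .
  \<comment> \<open>In terms of elements, \<open>c (y, z) = g y + z\<close>.  Together with the projection \<open>p'\<close> it is the
    pullback of the admissible epimorphism \<open>Y \<rightarrow> 0\<close> along \<open>Z \<rightarrow> 0\<close>.\<close>
  define c where "c = g \<cdot> p' + q'"
  have gp': "mor Q Z (g \<cdot> p')" by (rule mor_comp[OF g Q(3)])
  have c: "mor Q Z c" unfolding c_def by (rule mor_add[OF gp' Q(4)])
  have c_comp: "c \<cdot> h = g \<cdot> (p' \<cdot> h) + q' \<cdot> h" if "mor W Q h" for W h
    using add_comp[OF gp' Q(4) that] comp_assoc[OF g Q(3) that] by (simp add: c_def)
  have c_epi: "admissible_epi \<E> Q Z c"
  proof -
    obtain N where N: "admissible_epi \<E> Y N 0" "\<And>W h. mor W N h \<Longrightarrow> h = 0" using epi_to_zero[OF Y] by blast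
    have ZN: "mor Z N 0" using mor_0 Z mor_ob(2)[OF epi_mor[OF N(1)]] by blast
    have "is_pullback C Y N Z 0 0 Q c p'"
    proof (rule pullbackI[OF epi_mor[OF N(1)] ZN c Q(3)])
      show "0 \<cdot> p' = 0 \<cdot> c"
        using mor_comp[OF epi_mor[OF N(1)] Q(3)] mor_comp[OF ZN c] N(2) by metis
      show "\<exists>k. mor W Q k \<and> c \<cdot> k = s \<and> p' \<cdot> k = t" if s: "mor W Z s" and t: "mor W Y t" for W s t
      proof -
        have d: "mor W Z (s - g \<cdot> t)" by (rule mor_diff[OF s mor_comp[OF g t]])
        show ?thesis using pairQ[OF t d] c_comp[OF pairQ(1)[OF t d]] by (intro exI) auto
      qed
      show "k = 0" if k: "mor W Q k" "c \<cdot> k = 0" "p' \<cdot> k = 0" for W k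
        using pair_0[OF Q k(1,3)] c_comp[OF k(1)] k comp_0[OF g mor_ob(1)[OF k(1)]] by simp
    qed
    then show ?thesis by (rule epi_pullback[OF N(1) ZN])
  qed
  \<comment> \<open>In terms of elements, \<open>r (y, v) = (y - e v, g e v)\<close>, so that \<open>c r = g p\<close>.  Together with
    the projection \<open>q\<close> it is the pullback of \<open>g e\<close> along the projection \<open>q'\<close>.\<close>
  define r where "r = i' \<cdot> (p - e \<cdot> q) + j' \<cdot> ((g \<cdot> e) \<cdot> q)"
  have eq: "mor P Y (e \<cdot> q)" "mor P Y (p - e \<cdot> q)" "mor P Z ((g \<cdot> e) \<cdot> q)"
    using mor_comp[OF e P(4)] mor_diff[OF P(3)] mor_comp[OF gem P(4)] by auto
  note r = pairQ[OF eq(2,3), folded r_def]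
  have r_comp: "p' \<cdot> (r \<cdot> k) = p \<cdot> k - e \<cdot> (q \<cdot> k)" "q' \<cdot> (r \<cdot> k) = (g \<cdot> e) \<cdot> (q \<cdot> k)" if k: "mor W P k" for W k
    using r comp_assoc[OF Q(3) r(1) k] comp_assoc[OF Q(4) r(1) k] diff_comp[OF P(3) eq(1) k]
      comp_assoc[OF e P(4) k] comp_assoc[OF gem P(4) k] by auto
  have r_epi: "admissible_epi \<E> P Q r"
  proof -
    have "is_pullback C V Z Q (g \<cdot> e) q' P r q"
    proof (rule pullbackI[OF gem Q(4) r(1) P(4) r(3)[symmetric]])
      show "\<exists>k. mor W P k \<and> r \<cdot> k = s \<and> q \<cdot> k = t"
        if s: "mor W Q s" and t: "mor W V t" and st: "(g \<cdot> e) \<cdot> t = q' \<cdot> s" for W s t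
      proof -
        have d: "mor W Y (p' \<cdot> s + e \<cdot> t)" by (rule mor_add[OF mor_comp[OF Q(3) s] mor_comp[OF e t]])
        note k = pairP[OF d t]
        have "i \<cdot> (p' \<cdot> s + e \<cdot> t) + j \<cdot> t = k \<Longrightarrow> r \<cdot> k = s" for k
          using pair_eq[OF Q mor_comp[OF r(1) k(1)] s] r_comp[OF k(1)] k st by auto
        then show ?thesis using k by blast
      qed
      show "k = 0" if k: "mor W P k" "r \<cdot> k = 0" "q \<cdot> k = 0" for W k
      proof (rule pair_0[OF P k(1) _ k(3)])
        show "p \<cdot> k = 0"
          using r_comp(1)[OF k(1)] k comp_0[OF e mor_ob(1)[OF k(1)]] comp_0[OF Q(3) mor_ob(1)[OF k(1)]] by simp
      qed
    qed
    then show ?thesis by (rule epi_pullback[OF ge Q(4)])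
  qed
  have "c \<cdot> r = g \<cdot> p"
    using c_comp[OF r(1)] r comp_diff[OF g P(3) eq(1)] comp_assoc[OF g e P(4)] by simp
  then have gp_epi: "admissible_epi \<E> P Z (g \<cdot> p)" using epi_comp[OF r_epi c_epi] by simp
  then obtain K k where s: "(K, k, P, g \<cdot> p, Z) \<in> \<E>" by (auto simp: admissible_epi_def)
  note kK = kernelD[OF E_kernel[OF s]]
  have p_inj: "v = 0" if "mor Y W v" "v \<cdot> p = 0" for W v
    using comp_assoc[OF that(1) P(3,1)] that P(5) comp_id[OF that(1)] zero_comp[OF P(1) mor_ob(2)[OF that(1)]] by simp
  have "g \<cdot> (p \<cdot> k) = 0" using kK(3) comp_assoc[OF g P(3) kK(1)] by simp
  then obtain t where t: "mor K X t" "f \<cdot> t = p \<cdot> k" using kernelD(4)[OF ker mor_comp[OF P(3) kK(1)]] by blast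
  have "is_pushout C K P X k t Y f p"
  proof (rule pushoutI[OF kK(1) t(1) f P(3) t(2)[symmetric]])
    fix W h v assume h: "mor X W h" and v: "mor P W v" and vk: "v \<cdot> k = h \<cdot> t"
    \<comment> \<open>The factorization is \<open>v i\<close>.  It works because the kernel \<open>k\<close> contains the images of \<open>j\<close> and
      of \<open>i f\<close>, and \<open>t\<close> sends them to zero and to \<open>X\<close> identically.\<close>
    have "(g \<cdot> p) \<cdot> j = 0" using comp_assoc[OF g P(3,2)] P(8) comp_0[OF g V] by simp
    then obtain y where y: "mor V K y" "k \<cdot> y = j" using kK(4)[OF P(2)] by blast
    have "t \<cdot> y = 0"
    proof (rule kernel_mono[OF ker mor_comp[OF t(1) y(1)] mor_0[OF V X]])
      show "f \<cdot> (t \<cdot> y) = f \<cdot> 0"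
        using comp_assoc[OF f t(1) y(1)] comp_assoc[OF P(3) kK(1) y(1)] t(2) y(2) P(8) comp_0[OF f V] by simp
    qed
    then have vj: "v \<cdot> j = 0"
      using comp_assoc[OF v kK(1) y(1)] comp_assoc[OF h t(1) y(1)] vk y(2) comp_0[OF h V] by simp
    have iff: "mor X P (i \<cdot> f)" by (rule mor_comp[OF P(1) f])
    have pif: "p \<cdot> (i \<cdot> f) = f" using comp_assoc[OF P(3,1) f] P(5) id_comp[OF f] by simp
    have "(g \<cdot> p) \<cdot> (i \<cdot> f) = 0" using comp_assoc[OF g P(3) iff] pif gf by simp
    then obtain x where x: "mor X K x" "k \<cdot> x = i \<cdot> f" using kK(4)[OF iff] by blast
    have tx: "t \<cdot> x = idm C X"
    proof (rule kernel_mono[OF ker mor_comp[OF t(1) x(1)] mor_id[OF X]])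
      show "f \<cdot> (t \<cdot> x) = f \<cdot> idm C X"
        using comp_assoc[OF f t(1) x(1)] comp_assoc[OF P(3) kK(1) x(1)] t(2) x(2) pif comp_id[OF f] by simp
    qed
    have "(v \<cdot> i) \<cdot> f = h"
      using comp_assoc[OF v P(1) f] x(2) comp_assoc[OF v kK(1) x(1)] vk comp_assoc[OF h t(1) x(1)] tx comp_id[OF h] by simp
    moreover have "(v \<cdot> i) \<cdot> p = v"
      using comp_add[OF v mor_comp[OF P(1,3)] mor_comp[OF P(2,4)]] P(9) comp_id[OF v]
        comp_assoc[OF v P(1,3)] comp_assoc[OF v P(2,4)] vj zero_comp[OF P(4) mor_ob(2)[OF v]] by simp
    ultimately show "\<exists>l. mor Y W l \<and> l \<cdot> f = h \<and> l \<cdot> p = v" using mor_comp[OF v P(1)] by blast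
  qed (rule p_inj)
  moreover have "admissible_mono \<E> K P k" using s by (auto simp: admissible_mono_def)
  ultimately have "admissible_mono \<E> X Y f" using mono_pushout t(1) by blast
  moreover have "cokernel (X, f, Y, g, Z)"
  proof (rule cokernelI[OF f g gf])
    fix W h assume h: "mor Y W h" and hf: "h \<cdot> f = 0"
    have "(h \<cdot> p) \<cdot> k = 0"
      using comp_assoc[OF h P(3) kK(1)] comp_assoc[OF h f t(1)] hf t(2) zero_comp[OF t(1) mor_ob(2)[OF h]] by simp
    then obtain l where l: "mor Z W l" "l \<cdot> (g \<cdot> p) = h \<cdot> p"
      using cokernelD(4)[OF E_cokernel[OF s] mor_comp[OF h P(3)]] by blast
    have lg: "mor Y W (l \<cdot> g)" by (rule mor_comp[OF l(1) g])
    have "(l \<cdot> g - h) \<cdot> p = 0" using diff_comp[OF lg h P(3)] comp_assoc[OF l(1) g P(3)] l(2) by simp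
    then have "l \<cdot> g = h" using p_inj[OF mor_diff[OF lg h]] by simp
    then show "\<exists>l. mor Z W l \<and> l \<cdot> g = h" using l(1) by blast
  next
    fix W l assume l: "mor Z W l" and lg: "l \<cdot> g = 0"
    have "l \<cdot> (g \<cdot> p) = 0 \<cdot> (g \<cdot> p)"
      using comp_assoc[OF l g P(3)] lg zero_comp[OF P(3) mor_ob(2)[OF l]]
        zero_comp[OF mor_comp[OF g P(3)] mor_ob(2)[OF l]] by simp
    then show "l = 0" using cokernel_epi[OF E_cokernel[OF s] l mor_0[OF Z mor_ob(2)[OF l]]] by blast
  qed
  ultimately show ?thesis by (rule admissible_cokernel)
qed

end

section \<open>Homogeneous morphisms and cocycles\<close>

context dg_category
begin

definition hom :: "'o \<Rightarrow> 'o \<Rightarrow> 'g \<Rightarrow> 'm \<Rightarrow> bool" where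
  "hom X Y i f \<longleftrightarrow> X \<in> Ob A \<and> Y \<in> Ob A \<and> f \<in> Hom A X Y i"

definition cocycle :: "'o \<Rightarrow> 'o \<Rightarrow> 'g \<Rightarrow> 'm \<Rightarrow> bool" where
  "cocycle X Y i f \<longleftrightarrow> hom X Y i f \<and> dif A X Y i f = 0"

lemma cocycle_hom: "cocycle X Y i f \<Longrightarrow> hom X Y i f" and cocycle_dif: "cocycle X Y i f \<Longrightarrow> dif A X Y i f = 0"
  by (simp_all add: cocycle_def)

lemma hom_ob: "hom X Y i f \<Longrightarrow> X \<in> Ob A" "hom X Y i f \<Longrightarrow> Y \<in> Ob A"
  by (simp_all add: hom_def)

lemma cocycle_iff: "cocycle X Y i f \<longleftrightarrow> X \<in> Ob A \<and> Y \<in> Ob A \<and> f \<in> closed_hom A X Y i"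
  by (auto simp: cocycle_def hom_def closed_hom_def)

lemma hom_comp: "hom Y Z j g \<Longrightarrow> hom X Y i f \<Longrightarrow> j + i = k \<Longrightarrow> hom X Z k (g \<cdot> f)"
  by (auto simp: hom_def intro: cmp_Hom)

lemma hom_0: "X \<in> Ob A \<Longrightarrow> Y \<in> Ob A \<Longrightarrow> hom X Y i 0"
  by (simp add: hom_def)

lemma hom_add: "hom X Y i f \<Longrightarrow> hom X Y i g \<Longrightarrow> hom X Y i (f + g)"
  by (simp add: hom_def Hom_add)

lemma hom_minus: "hom X Y i f \<Longrightarrow> hom X Y i (- f)"
  by (simp add: hom_def Hom_minus)

lemma hom_diff: "hom X Y i f \<Longrightarrow> hom X Y i g \<Longrightarrow> hom X Y i (f - g)"
  by (simp add: hom_def Hom_diff)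

lemma comp_assoc: "hom Y Z k h \<Longrightarrow> hom X Y j g \<Longrightarrow> hom W X i f \<Longrightarrow> (h \<cdot> g) \<cdot> f = h \<cdot> (g \<cdot> f)"
  by (auto simp: hom_def intro: cmp_assoc)

lemma comp_id: "hom X Y i f \<Longrightarrow> f \<cdot> idm A X = f"
  by (auto simp: hom_def intro: cmp_Id)

lemma id_comp: "hom X Y i f \<Longrightarrow> idm A Y \<cdot> f = f"
  by (auto simp: hom_def intro: Id_cmp)

lemma comp_add: "hom Y Z j g \<Longrightarrow> hom X Y i f \<Longrightarrow> hom X Y i f' \<Longrightarrow> g \<cdot> (f + f') = g \<cdot> f + g \<cdot> f'"
  by (auto simp: hom_def intro: cmp_add)

lemma add_comp: "hom Y Z j g \<Longrightarrow> hom Y Z j g' \<Longrightarrow> hom X Y i f \<Longrightarrow> (g + g') \<cdot> f = g \<cdot> f + g' \<cdot> f"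
  by (auto simp: hom_def intro: add_cmp)

lemma comp_0: "hom Y Z j g \<Longrightarrow> X \<in> Ob A \<Longrightarrow> g \<cdot> 0 = 0"
  by (auto simp: hom_def intro: cmp_0)

lemma zero_comp: "hom X Y i f \<Longrightarrow> Z \<in> Ob A \<Longrightarrow> 0 \<cdot> f = 0"
  by (auto simp: hom_def intro: cmp_0')

lemma comp_minus: "hom Y Z j g \<Longrightarrow> hom X Y i f \<Longrightarrow> g \<cdot> (- f) = - (g \<cdot> f)"
  by (auto simp: hom_def intro: cmp_minus)

lemma minus_comp: "hom Y Z j g \<Longrightarrow> hom X Y i f \<Longrightarrow> (- g) \<cdot> f = - (g \<cdot> f)"
  by (auto simp: hom_def intro: minus_cmp)

lemma comp_diff: "hom Y Z j g \<Longrightarrow> hom X Y i f \<Longrightarrow> hom X Y i f' \<Longrightarrow> g \<cdot> (f - f') = g \<cdot> f - g \<cdot> f'"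
  using comp_add[of Y Z j g X i f "- f'"] comp_minus[of Y Z j g X i f'] hom_minus[of X Y i f'] by simp

lemma diff_comp: "hom Y Z j g \<Longrightarrow> hom Y Z j g' \<Longrightarrow> hom X Y i f \<Longrightarrow> (g - g') \<cdot> f = g \<cdot> f - g' \<cdot> f"
  using add_comp[of Y Z j g "- g'" X i f] minus_comp[of Y Z j g' X i f] hom_minus[of Y Z j g'] by simp

lemma hom_dif: "hom X Y i f \<Longrightarrow> i + u = k \<Longrightarrow> hom X Y k (dif A X Y i f)"
  by (auto simp: hom_def intro: dif_Hom)

lemma dif_cocycle: "hom X Y i f \<Longrightarrow> i + u = k \<Longrightarrow> cocycle X Y k (dif A X Y i f)"
  by (auto simp: cocycle_def hom_def intro: dif_Hom dif_dif)

lemma dif_sum: "hom X Y i f \<Longrightarrow> hom X Y i g \<Longrightarrow> dif A X Y i (f + g) = dif A X Y i f + dif A X Y i g"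
  by (simp add: hom_def dif_add)

lemma dif_comp:
  "hom Y Z j g \<Longrightarrow> hom X Y i f \<Longrightarrow> j + i = k \<Longrightarrow>
    dif A X Z k (g \<cdot> f) = dif A Y Z j g \<cdot> f + signed \<sigma> u j (g \<cdot> dif A X Y i f)"
  by (auto simp: hom_def intro: dif_cmp)

lemma dif_closed_comp:
  "cocycle Y Z j g \<Longrightarrow> hom X Y i f \<Longrightarrow> j + i = k \<Longrightarrow> dif A X Z k (g \<cdot> f) = signed \<sigma> u j (g \<cdot> dif A X Y i f)"
  using dif_comp[of Y Z j g X i f k] zero_comp[of X Y i f Z] by (auto simp: cocycle_def hom_def)

lemma dif_comp_closed:
  "hom Y Z j g \<Longrightarrow> cocycle X Y i f \<Longrightarrow> j + i = k \<Longrightarrow> dif A X Z k (g \<cdot> f) = dif A Y Z j g \<cdot> f"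
  using dif_comp[of Y Z j g X i f k] comp_0[of Y Z j g X] by (auto simp: cocycle_def hom_def signed_def)

lemma signed_0 [simp]: "signed \<sigma> u 0 x = x" "signed \<sigma> u i 0 = 0"
  by (simp_all add: signed_def)

lemma signed_u [simp]: "signed \<sigma> u u x = - x" "signed \<sigma> u (- u) x = - x"
  by (simp_all add: signed_def form_unit)

lemma cocycle_comp: "cocycle Y Z j g \<Longrightarrow> cocycle X Y i f \<Longrightarrow> j + i = k \<Longrightarrow> cocycle X Z k (g \<cdot> f)"
  using dif_comp_closed[of Y Z j g X i f k] hom_comp[of Y Z j g X i f k] zero_comp[of X Y i f Z]
  by (auto simp: cocycle_def hom_def)

lemma cocycle_add: "cocycle X Y i f \<Longrightarrow> cocycle X Y i g \<Longrightarrow> cocycle X Y i (f + g)"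
  by (simp add: cocycle_def hom_add dif_sum)

lemma cocycle_minus: "cocycle X Y i f \<Longrightarrow> cocycle X Y i (- f)"
  using dif_minus[of X Y f i] by (auto simp: cocycle_def hom_def Hom_minus)

lemma cocycle_0: "X \<in> Ob A \<Longrightarrow> Y \<in> Ob A \<Longrightarrow> cocycle X Y i 0"
  by (simp add: cocycle_def hom_0 dif_0)

lemma cocycle_id: "X \<in> Ob A \<Longrightarrow> cocycle X X 0 (idm A X)"
  by (simp add: cocycle_def hom_def Id_Hom dif_Id)

lemma Z0_sel [simp]: "Ob (Z0 A) = Ob A" "cmp (Z0 A) = cmp A" "idm (Z0 A) = idm A"
    "Mor (Z0 A) X Y = closed_hom A X Y 0"
  by (simp_all add: Z0_def)

lemma Z0_preadditive: "preadditive_category (Z0 A)"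
proof
  show "subgrp (Mor (Z0 A) X Y)" if "X \<in> Ob (Z0 A)" "Y \<in> Ob (Z0 A)" for X Y
    using that cocycle_0[of X Y 0] cocycle_add[of X Y 0] cocycle_minus[of X Y 0] by (auto simp: subgrp_def cocycle_iff)
qed (use cocycle_id cocycle_comp[where j = 0 and i = 0 and k = 0] in
    \<open>auto simp: cocycle_def hom_def closed_hom_def intro: cmp_assoc cmp_Id Id_cmp cmp_add add_cmp\<close>)

lemma Z0_mor: "preadditive_category.mor (Z0 A) X Y f \<longleftrightarrow> cocycle X Y 0 f"
  by (simp add: preadditive_category.mor_def[OF Z0_preadditive] cocycle_iff)

text \<open>
  The rewrites express everything about \<open>Z\<^sup>0(A)\<close> in terms of cocycles of degree 0 and of the composition
  of \<open>A\<close>, so that morphisms of \<open>Z\<^sup>0(A)\<close> and other homogeneous morphisms can be mixed freely.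
\<close>

sublocale Z: preadditive_category "Z0 A"
  rewrites "cmp (Z0 A) = cmp A" and "Ob (Z0 A) = Ob A" and "idm (Z0 A) = idm A"
    and "preadditive_category.mor (Z0 A) = (\<lambda>X Y. cocycle X Y 0)"
  by (rule Z0_preadditive) (simp_all add: fun_eq_iff Z0_mor)

end

section \<open>Morphisms of arbitrary degree as closed morphisms\<close>

locale dg_cone_category = dg_category +
  assumes shifts: "has_shifts A" and cones: "has_cones u A"
begin

abbreviation cone_ob ("K") where "K \<equiv> idcone u A"
abbreviation cone_iota ("\<iota>") where "\<iota> \<equiv> idcone_iota u A"
abbreviation cone_iota' ("\<iota>''") where "\<iota>' \<equiv> idcone_iota' u A"
abbreviation cone_pi ("\<pi>") where "\<pi> \<equiv> idcone_pi u A"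
abbreviation cone_pi' ("\<pi>''") where "\<pi>' \<equiv> idcone_pi' u A"
abbreviation shift_obj ("sh") where "sh \<equiv> shift_ob A"
abbreviation shift_in ("sto") where "sto \<equiv> shift_to A"
abbreviation shift_out ("sfrom") where "sfrom \<equiv> shift_from A"

lemma shift_structure:
  assumes "X \<in> Ob A"
  shows "cocycle X (sh i X) (- i) (sto i X)" "cocycle (sh i X) X i (sfrom i X)"
    "sfrom i X \<cdot> sto i X = idm A X" "sto i X \<cdot> sfrom i X = idm A (sh i X)" "sh i X \<in> Ob A"
  using shift_choice[OF shifts assms, of i] assms by (simp_all add: is_shift_def cocycle_iff)

lemma cone_structure:
  assumes "X \<in> Ob A"
  shows "K X \<in> Ob A" "cocycle X (K X) u (\<iota> X)" "hom X (K X) 0 (\<iota>' X)"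
    "cocycle (K X) X 0 (\<pi> X)" "hom (K X) X (- u) (\<pi>' X)"
    "dif A X (K X) 0 (\<iota>' X) = \<iota> X" "dif A (K X) X (- u) (\<pi>' X) = \<pi> X"
    "\<pi>' X \<cdot> \<iota>' X = 0" "\<pi> X \<cdot> \<iota> X = 0" "\<pi>' X \<cdot> \<iota> X = idm A X" "\<pi> X \<cdot> \<iota>' X = idm A X"
  using idcone_structure[OF shifts cones assms] assms by (simp_all add: cocycle_def hom_def)

text \<open>
  As a graded object the cone is the direct sum of \<open>X[-1]\<close> and \<open>X\<close>; the next two lemmas
  split morphisms into it and out of it accordingly.
\<close>

lemma cone_decomp_left:
  assumes X: "X \<in> Ob A" and c: "hom Q (K X) i c"
  shows "c = \<iota> X \<cdot> (\<pi>' X \<cdot> c) + \<iota>' X \<cdot> (\<pi> X \<cdot> c)"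
proof -
  note k = cone_structure[OF X]
  have "\<iota> X \<cdot> \<pi>' X + \<iota>' X \<cdot> \<pi> X = idm A (K X)" using idcone_structure[OF shifts cones X] by simp
  moreover have "(\<iota> X \<cdot> \<pi>' X + \<iota>' X \<cdot> \<pi> X) \<cdot> c = (\<iota> X \<cdot> \<pi>' X) \<cdot> c + (\<iota>' X \<cdot> \<pi> X) \<cdot> c"
    by (rule add_comp[OF hom_comp[OF cocycle_hom[OF k(2)] k(5), of 0] hom_comp[OF k(3) cocycle_hom[OF k(4)]] c]) simp_all
  ultimately show ?thesis
    using comp_assoc[OF cocycle_hom[OF k(2)] k(5) c] comp_assoc[OF k(3) cocycle_hom[OF k(4)] c] id_comp[OF c] by simp
qed

lemma cone_decomp_right:
  assumes X: "X \<in> Ob A" and c: "hom (K X) Q i c"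
  shows "c = (c \<cdot> \<iota> X) \<cdot> \<pi>' X + (c \<cdot> \<iota>' X) \<cdot> \<pi> X"
proof -
  note k = cone_structure[OF X]
  have "\<iota> X \<cdot> \<pi>' X + \<iota>' X \<cdot> \<pi> X = idm A (K X)" using idcone_structure[OF shifts cones X] by simp
  moreover have "c \<cdot> (\<iota> X \<cdot> \<pi>' X + \<iota>' X \<cdot> \<pi> X) = c \<cdot> (\<iota> X \<cdot> \<pi>' X) + c \<cdot> (\<iota>' X \<cdot> \<pi> X)"
    by (rule comp_add[OF c hom_comp[OF cocycle_hom[OF k(2)] k(5), of 0] hom_comp[OF k(3) cocycle_hom[OF k(4)]]]) simp_all
  ultimately show ?thesis
    using comp_assoc[OF c cocycle_hom[OF k(2)] k(5)] comp_assoc[OF c k(3) cocycle_hom[OF k(4)]] comp_id[OF c] by simp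
qed

text \<open>
  A closed morphism \<open>c\<close> into the cone is determined by its component \<open>\<pi>' c\<close>, because the other
  component \<open>\<pi> c\<close> is the differential of \<open>\<pi>' c\<close> by \<open>d \<pi>' = \<pi>\<close>; and \<open>\<pi>' c\<close> can be arbitrary.  So the cone
  represents the morphisms of degree \<open>-u\<close> into \<open>X\<close>.  Dually, by \<open>d \<iota>' = \<iota>\<close>, it corepresents the morphisms
  of degree 0 out of \<open>X\<close>.
\<close>

lemma closed_into_cone_0:
  assumes X: "X \<in> Ob A" and c: "cocycle Q (K X) i c" "\<pi>' X \<cdot> c = 0"
  shows "c = 0"
proof -
  note k = cone_structure[OF X]
  have "dif A Q X (- u + i) (\<pi>' X \<cdot> c) = \<pi> X \<cdot> c" using dif_comp_closed[OF k(5) c(1)] k(7) by simp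
  then have "\<pi> X \<cdot> c = 0" using c X dif_0[of Q X] hom_ob[OF cocycle_hom[OF c(1)]] by simp
  then show ?thesis
    using cone_decomp_left[OF X cocycle_hom[OF c(1)]] c(2) comp_0[OF cocycle_hom[OF k(2)]] comp_0[OF k(3)]
      hom_ob[OF cocycle_hom[OF c(1)]] by simp
qed

lemma closed_into_cone:
  assumes X: "X \<in> Ob A" and b: "hom Q X (- u) b"
  shows "\<exists>c. cocycle Q (K X) 0 c \<and> \<pi>' X \<cdot> c = b"
proof -
  note k = cone_structure[OF X]
  note db = dif_cocycle[OF b, of 0, simplified]
  let ?c = "\<iota> X \<cdot> b + \<iota>' X \<cdot> dif A Q X (- u) b"
  have 1: "hom Q (K X) 0 (\<iota> X \<cdot> b)" and 2: "hom Q (K X) 0 (\<iota>' X \<cdot> dif A Q X (- u) b)"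
    using hom_comp[OF cocycle_hom[OF k(2)] b] hom_comp[OF k(3) cocycle_hom[OF db]] by simp_all
  have "dif A Q (K X) 0 ?c = 0"
    using dif_sum[OF 1 2] dif_closed_comp[OF k(2) b] dif_comp_closed[OF k(3) db] k(6) by simp
  then have "cocycle Q (K X) 0 ?c" using hom_add[OF 1 2] by (simp add: cocycle_def)
  moreover have "\<pi>' X \<cdot> ?c = b"
    using comp_add[OF k(5) 1 2] comp_assoc[OF k(5) cocycle_hom[OF k(2)] b] comp_assoc[OF k(5,3) cocycle_hom[OF db]]
      k(8,10) id_comp[OF b] zero_comp[OF cocycle_hom[OF db] X] by simp
  ultimately show ?thesis by blast
qed

lemma closed_from_cone_0:
  assumes X: "X \<in> Ob A" and c: "cocycle (K X) Q i c" "c \<cdot> \<iota>' X = 0"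
  shows "c = 0"
proof -
  note k = cone_structure[OF X]
  have "dif A X Q i (c \<cdot> \<iota>' X) = signed \<sigma> u i (c \<cdot> \<iota> X)" using dif_closed_comp[OF c(1) k(3)] k(6) by simp
  then have "c \<cdot> \<iota> X = 0" using c X dif_0[of X Q] hom_ob[OF cocycle_hom[OF c(1)]] by (simp add: signed_def split: if_splits)
  then show ?thesis
    using cone_decomp_right[OF X cocycle_hom[OF c(1)]] c(2) zero_comp[OF cocycle_hom[OF k(4)]] zero_comp[OF k(5)]
      hom_ob[OF cocycle_hom[OF c(1)]] by simp
qed

lemma closed_from_cone:
  assumes X: "X \<in> Ob A" and b: "hom X Q 0 b"
  shows "\<exists>c. cocycle (K X) Q 0 c \<and> c \<cdot> \<iota>' X = b"
proof -
  note k = cone_structure[OF X]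
  note db = dif_cocycle[OF b, of u, simplified]
  let ?c = "b \<cdot> \<pi> X + dif A X Q 0 b \<cdot> \<pi>' X"
  have 1: "hom (K X) Q 0 (b \<cdot> \<pi> X)" and 2: "hom (K X) Q 0 (dif A X Q 0 b \<cdot> \<pi>' X)"
    using hom_comp[OF b cocycle_hom[OF k(4)]] hom_comp[OF cocycle_hom[OF db] k(5)] by simp_all
  have "dif A (K X) Q 0 ?c = 0"
    using dif_sum[OF 1 2] dif_comp_closed[OF b k(4)] dif_closed_comp[OF db k(5)] k(7) by simp
  then have "cocycle (K X) Q 0 ?c" using hom_add[OF 1 2] by (simp add: cocycle_def)
  moreover have "?c \<cdot> \<iota>' X = b"
    using add_comp[OF 1 2 k(3)] comp_assoc[OF b cocycle_hom[OF k(4)] k(3)] comp_assoc[OF cocycle_hom[OF db] k(5,3)]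
      k(8,11) comp_id[OF b] comp_0[OF cocycle_hom[OF db] X] by simp
  ultimately show ?thesis by blast
qed

text \<open>
  The cone of a suitable shift of \<open>W\<close> represents the morphisms of an arbitrary degree \<open>n\<close> into \<open>W\<close>.
\<close>

lemma represent:
  assumes "W \<in> Ob A"
  obtains R e where "hom R W n e" "\<And>Q b. hom Q W n b \<Longrightarrow> \<exists>c. cocycle Q R 0 c \<and> e \<cdot> c = b"
    "\<And>Q c. cocycle Q R 0 c \<Longrightarrow> e \<cdot> c = 0 \<Longrightarrow> c = 0"
proof -
  note s = shift_structure[OF assms, of "n + u"]
  let ?S = "sh (n + u) W" and ?t = "sfrom (n + u) W" and ?s = "sto (n + u) W"
  note k = cone_structure[OF s(5)]
  have e: "hom (K ?S) W n (?t \<cdot> \<pi>' ?S)" using hom_comp[OF cocycle_hom[OF s(2)] k(5)] by simp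
  have "\<exists>c. cocycle Q (K ?S) 0 c \<and> (?t \<cdot> \<pi>' ?S) \<cdot> c = b" if b: "hom Q W n b" for Q b
  proof -
    obtain c where c: "cocycle Q (K ?S) 0 c" "\<pi>' ?S \<cdot> c = ?s \<cdot> b"
      using closed_into_cone[OF s(5) hom_comp[OF cocycle_hom[OF s(1)] b]] by auto
    then have "(?t \<cdot> \<pi>' ?S) \<cdot> c = b"
      using comp_assoc[OF cocycle_hom[OF s(2)] k(5) cocycle_hom[OF c(1)]] comp_assoc[OF cocycle_hom[OF s(2)] cocycle_hom[OF s(1)] b]
        s(3) id_comp[OF b] by simp
    then show ?thesis using c(1) by blast
  qed
  moreover have "c = 0" if c: "cocycle Q (K ?S) 0 c" "(?t \<cdot> \<pi>' ?S) \<cdot> c = 0" for Q c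
  proof (rule closed_into_cone_0[OF s(5) c(1)])
    have 1: "hom Q ?S (- u) (\<pi>' ?S \<cdot> c)" using hom_comp[OF k(5) cocycle_hom[OF c(1)]] by simp
    have "?s \<cdot> (?t \<cdot> (\<pi>' ?S \<cdot> c)) = \<pi>' ?S \<cdot> c"
      using comp_assoc[OF cocycle_hom[OF s(1)] cocycle_hom[OF s(2)] 1] s(4) id_comp[OF 1] by simp
    then show "\<pi>' ?S \<cdot> c = 0"
      using comp_assoc[OF cocycle_hom[OF s(2)] k(5) cocycle_hom[OF c(1)]] c(2) comp_0[OF cocycle_hom[OF s(1)]]
        hom_ob(1)[OF 1] by simp
  qed
  ultimately show ?thesis using e that by blast
qed

lemma corepresent:
  assumes "W \<in> Ob A"
  obtains R e where "hom W R n e" "\<And>Q b. hom W Q n b \<Longrightarrow> \<exists>c. cocycle R Q 0 c \<and> c \<cdot> e = b"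
    "\<And>Q c. cocycle R Q 0 c \<Longrightarrow> c \<cdot> e = 0 \<Longrightarrow> c = 0"
proof -
  note s = shift_structure[OF assms, of "- n"]
  let ?S = "sh (- n) W" and ?t = "sfrom (- n) W" and ?s = "sto (- n) W"
  note k = cone_structure[OF s(5)]
  have e: "hom W (K ?S) n (\<iota>' ?S \<cdot> ?s)" using hom_comp[OF k(3) cocycle_hom[OF s(1)]] by simp
  have "\<exists>c. cocycle (K ?S) Q 0 c \<and> c \<cdot> (\<iota>' ?S \<cdot> ?s) = b" if b: "hom W Q n b" for Q b
  proof -
    obtain c where c: "cocycle (K ?S) Q 0 c" "c \<cdot> \<iota>' ?S = b \<cdot> ?t"
      using closed_from_cone[OF s(5) hom_comp[OF b cocycle_hom[OF s(2)]]] by auto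
    then have "c \<cdot> (\<iota>' ?S \<cdot> ?s) = b"
      using comp_assoc[OF cocycle_hom[OF c(1)] k(3) cocycle_hom[OF s(1)]] comp_assoc[OF b cocycle_hom[OF s(2)] cocycle_hom[OF s(1)]]
        s(3) comp_id[OF b] by simp
    then show ?thesis using c(1) by blast
  qed
  moreover have "c = 0" if c: "cocycle (K ?S) Q 0 c" "c \<cdot> (\<iota>' ?S \<cdot> ?s) = 0" for Q c
  proof (rule closed_from_cone_0[OF s(5) c(1)])
    have 1: "hom ?S Q 0 (c \<cdot> \<iota>' ?S)" using hom_comp[OF cocycle_hom[OF c(1)] k(3)] by simp
    have "((c \<cdot> \<iota>' ?S) \<cdot> ?s) \<cdot> ?t = c \<cdot> \<iota>' ?S"
      using comp_assoc[OF 1 cocycle_hom[OF s(1)] cocycle_hom[OF s(2)]] s(4) comp_id[OF 1] by simp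
    then show "c \<cdot> \<iota>' ?S = 0"
      using comp_assoc[OF cocycle_hom[OF c(1)] k(3) cocycle_hom[OF s(1)]] c(2) zero_comp[OF cocycle_hom[OF s(2)]]
        hom_ob(2)[OF 1] by simp
  qed
  ultimately show ?thesis using e that by blast
qed

section \<open>Universal properties in all degrees\<close>

text \<open>
  In each of the following lemmas a homogeneous morphism is written as a closed morphism of degree 0
  composed with a universal morphism \<open>e\<close>; the universal property in \<open>Z\<^sup>0(A)\<close> is applied to the closed
  morphism.
\<close>

lemma kernel_factor:
  assumes k: "Z.kernel (X, f, Y, g, Z)" and h: "hom W Y n h" "g \<cdot> h = 0"
  shows "\<exists>k. hom W X n k \<and> f \<cdot> k = h"
proof -
  note D = Z.kernelD[OF k]
  obtain R e where e: "hom W R n e" "\<And>Q b. hom W Q n b \<Longrightarrow> \<exists>c. cocycle R Q 0 c \<and> c \<cdot> e = b"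
    "\<And>Q c. cocycle R Q 0 c \<Longrightarrow> c \<cdot> e = 0 \<Longrightarrow> c = 0" using corepresent[OF hom_ob(1)[OF h(1)]] by blast
  obtain c where c: "cocycle R Y 0 c" "c \<cdot> e = h" using e(2)[OF h(1)] by blast
  have "g \<cdot> c = 0"
    using e(3)[OF cocycle_comp[OF D(2) c(1)]] comp_assoc[OF cocycle_hom[OF D(2)] cocycle_hom[OF c(1)] e(1)] c(2) h(2) by simp
  then obtain l where l: "cocycle R X 0 l" "f \<cdot> l = c" using D(4)[OF c(1)] by blast
  then have "f \<cdot> (l \<cdot> e) = h" using comp_assoc[OF cocycle_hom[OF D(1)] cocycle_hom[OF l(1)] e(1)] c(2) by simp
  moreover have "hom W X n (l \<cdot> e)" using hom_comp[OF cocycle_hom[OF l(1)] e(1)] by simp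
  ultimately show ?thesis by blast
qed

lemma kernel_cancel:
  assumes k: "Z.kernel (X, f, Y, g, Z)" and h: "hom W X n h" "f \<cdot> h = 0"
  shows "h = 0"
proof -
  note D = Z.kernelD[OF k]
  note W = hom_ob(1)[OF h(1)]
  obtain R e where e: "hom W R n e" "\<And>Q b. hom W Q n b \<Longrightarrow> \<exists>c. cocycle R Q 0 c \<and> c \<cdot> e = b"
    "\<And>Q c. cocycle R Q 0 c \<Longrightarrow> c \<cdot> e = 0 \<Longrightarrow> c = 0" using corepresent[OF W] by blast
  obtain c where c: "cocycle R X 0 c" "c \<cdot> e = h" using e(2)[OF h(1)] by blast
  have "f \<cdot> c = 0"
    using e(3)[OF cocycle_comp[OF D(1) c(1)]] comp_assoc[OF cocycle_hom[OF D(1)] cocycle_hom[OF c(1)] e(1)] c(2) h(2) by simp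
  then have "c = 0"
    using Z.kernel_mono[OF k c(1) cocycle_0] comp_0[OF cocycle_hom[OF D(1)]] hom_ob[OF cocycle_hom[OF c(1)]] by simp
  then show ?thesis using c(2) zero_comp[OF e(1)] hom_ob[OF h(1)] by simp
qed

lemma cokernel_factor:
  assumes k: "Z.cokernel (X, f, Y, g, Z)" and h: "hom Y W n h" "h \<cdot> f = 0"
  shows "\<exists>k. hom Z W n k \<and> k \<cdot> g = h"
proof -
  note D = Z.cokernelD[OF k]
  obtain R e where e: "hom R W n e" "\<And>Q b. hom Q W n b \<Longrightarrow> \<exists>c. cocycle Q R 0 c \<and> e \<cdot> c = b"
    "\<And>Q c. cocycle Q R 0 c \<Longrightarrow> e \<cdot> c = 0 \<Longrightarrow> c = 0" using represent[OF hom_ob(2)[OF h(1)]] by blast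
  obtain c where c: "cocycle Y R 0 c" "e \<cdot> c = h" using e(2)[OF h(1)] by blast
  have "c \<cdot> f = 0"
    using e(3)[OF cocycle_comp[OF c(1) D(1)]] comp_assoc[OF e(1) cocycle_hom[OF c(1)] cocycle_hom[OF D(1)]] c(2) h(2) by simp
  then obtain l where l: "cocycle Z R 0 l" "l \<cdot> g = c" using D(4)[OF c(1)] by blast
  then have "(e \<cdot> l) \<cdot> g = h" using comp_assoc[OF e(1) cocycle_hom[OF l(1)] cocycle_hom[OF D(2)]] c(2) by simp
  moreover have "hom Z W n (e \<cdot> l)" using hom_comp[OF e(1) cocycle_hom[OF l(1)]] by simp
  ultimately show ?thesis by blast
qed

lemma cokernel_cancel:
  assumes k: "Z.cokernel (X, f, Y, g, Z)" and h: "hom Z W n h" "h \<cdot> g = 0"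
  shows "h = 0"
proof -
  note D = Z.cokernelD[OF k]
  note W = hom_ob(2)[OF h(1)]
  obtain R e where e: "hom R W n e" "\<And>Q b. hom Q W n b \<Longrightarrow> \<exists>c. cocycle Q R 0 c \<and> e \<cdot> c = b"
    "\<And>Q c. cocycle Q R 0 c \<Longrightarrow> e \<cdot> c = 0 \<Longrightarrow> c = 0" using represent[OF W] by blast
  obtain c where c: "cocycle Z R 0 c" "e \<cdot> c = h" using e(2)[OF h(1)] by blast
  have "c \<cdot> g = 0"
    using e(3)[OF cocycle_comp[OF c(1) D(2)]] comp_assoc[OF e(1) cocycle_hom[OF c(1)] cocycle_hom[OF D(2)]] c(2) h(2) by simp
  then have "c = 0"
    using Z.cokernel_epi[OF k c(1) cocycle_0] zero_comp[OF cocycle_hom[OF D(2)]] hom_ob[OF cocycle_hom[OF c(1)]] by simp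
  then show ?thesis using c(2) comp_0[OF e(1)] hom_ob[OF h(1)] by simp
qed

lemma pushout_factor:
  assumes P: "is_pushout (Z0 A) X Y X' f a P f' b" and f: "cocycle X Y 0 f" and a: "cocycle X X' 0 a"
    and p: "hom X' W n p" and q: "hom Y W n q" and pq: "q \<cdot> f = p \<cdot> a"
  shows "\<exists>k. hom P W n k \<and> k \<cdot> f' = p \<and> k \<cdot> b = q"
proof -
  note D = Z.pushoutD[OF P f a]
  obtain R e where e: "hom R W n e" "\<And>Q b. hom Q W n b \<Longrightarrow> \<exists>c. cocycle Q R 0 c \<and> e \<cdot> c = b"
    "\<And>Q c. cocycle Q R 0 c \<Longrightarrow> e \<cdot> c = 0 \<Longrightarrow> c = 0" using represent[OF hom_ob(2)[OF p]] by blast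
  obtain c where c: "cocycle X' R 0 c" "e \<cdot> c = p" using e(2)[OF p] by blast
  obtain d where d: "cocycle Y R 0 d" "e \<cdot> d = q" using e(2)[OF q] by blast
  have df: "cocycle X R 0 (d \<cdot> f)" and ca: "cocycle X R 0 (c \<cdot> a)"
    using cocycle_comp[OF d(1) f] cocycle_comp[OF c(1) a] by simp_all
  have "e \<cdot> (d \<cdot> f - c \<cdot> a) = 0"
    using comp_diff[OF e(1) cocycle_hom[OF df] cocycle_hom[OF ca]] comp_assoc[OF e(1) cocycle_hom[OF d(1)] cocycle_hom[OF f]]
      comp_assoc[OF e(1) cocycle_hom[OF c(1)] cocycle_hom[OF a]] c(2) d(2) pq by simp
  then have "d \<cdot> f = c \<cdot> a" using e(3)[OF Z.mor_diff[OF df ca]] by simp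
  then obtain l where l: "cocycle P R 0 l" "l \<cdot> f' = c" "l \<cdot> b = d" using D(4)[OF c(1) d(1)] by blast
  have "(e \<cdot> l) \<cdot> f' = p" "(e \<cdot> l) \<cdot> b = q"
    using comp_assoc[OF e(1) cocycle_hom[OF l(1)] cocycle_hom[OF D(1)]]
      comp_assoc[OF e(1) cocycle_hom[OF l(1)] cocycle_hom[OF D(2)]] l c d by simp_all
  moreover have "hom P W n (e \<cdot> l)" using hom_comp[OF e(1) cocycle_hom[OF l(1)]] by simp
  ultimately show ?thesis by blast
qed

lemma pushout_cancel:
  assumes P: "is_pushout (Z0 A) X Y X' f a P f' b" and f: "cocycle X Y 0 f" and a: "cocycle X X' 0 a"
    and h: "hom P W n h" "h \<cdot> f' = 0" "h \<cdot> b = 0"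
  shows "h = 0"
proof -
  note D = Z.pushoutD[OF P f a]
  obtain R e where e: "hom R W n e" "\<And>Q b. hom Q W n b \<Longrightarrow> \<exists>c. cocycle Q R 0 c \<and> e \<cdot> c = b"
    "\<And>Q c. cocycle Q R 0 c \<Longrightarrow> e \<cdot> c = 0 \<Longrightarrow> c = 0" using represent[OF hom_ob(2)[OF h(1)]] by blast
  obtain c where c: "cocycle P R 0 c" "e \<cdot> c = h" using e(2)[OF h(1)] by blast
  have 1: "c \<cdot> f' = 0"
    using e(3)[OF cocycle_comp[OF c(1) D(1)]] comp_assoc[OF e(1) cocycle_hom[OF c(1)] cocycle_hom[OF D(1)]] c(2) h(2) by simp
  have 2: "c \<cdot> b = 0"
    using e(3)[OF cocycle_comp[OF c(1) D(2)]] comp_assoc[OF e(1) cocycle_hom[OF c(1)] cocycle_hom[OF D(2)]] c(2) h(3) by simp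
  have "c = 0"
    using Z.pushout_eq[OF P f a c(1) cocycle_0] 1 2 zero_comp[OF cocycle_hom[OF D(1)]] zero_comp[OF cocycle_hom[OF D(2)]]
      hom_ob[OF cocycle_hom[OF c(1)]] by simp
  then show ?thesis using c(2) comp_0[OF e(1)] hom_ob[OF h(1)] by simp
qed

lemma pullback_factor:
  assumes P: "is_pullback (Z0 A) Y Z Z' g a P g' b" and g: "cocycle Y Z 0 g" and a: "cocycle Z' Z 0 a"
    and p: "hom W Z' n p" and q: "hom W Y n q" and pq: "g \<cdot> q = a \<cdot> p"
  shows "\<exists>k. hom W P n k \<and> g' \<cdot> k = p \<and> b \<cdot> k = q"
proof -
  note D = Z.pullbackD[OF P g a]
  obtain R e where e: "hom W R n e" "\<And>Q b. hom W Q n b \<Longrightarrow> \<exists>c. cocycle R Q 0 c \<and> c \<cdot> e = b"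
    "\<And>Q c. cocycle R Q 0 c \<Longrightarrow> c \<cdot> e = 0 \<Longrightarrow> c = 0" using corepresent[OF hom_ob(1)[OF p]] by blast
  obtain c where c: "cocycle R Z' 0 c" "c \<cdot> e = p" using e(2)[OF p] by blast
  obtain d where d: "cocycle R Y 0 d" "d \<cdot> e = q" using e(2)[OF q] by blast
  have gd: "cocycle R Z 0 (g \<cdot> d)" and ac: "cocycle R Z 0 (a \<cdot> c)"
    using cocycle_comp[OF g d(1)] cocycle_comp[OF a c(1)] by simp_all
  have "(g \<cdot> d - a \<cdot> c) \<cdot> e = 0"
    using diff_comp[OF cocycle_hom[OF gd] cocycle_hom[OF ac] e(1)] comp_assoc[OF cocycle_hom[OF g] cocycle_hom[OF d(1)] e(1)]
      comp_assoc[OF cocycle_hom[OF a] cocycle_hom[OF c(1)] e(1)] c(2) d(2) pq by simp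
  then have "g \<cdot> d = a \<cdot> c" using e(3)[OF Z.mor_diff[OF gd ac]] by simp
  then obtain l where l: "cocycle R P 0 l" "g' \<cdot> l = c" "b \<cdot> l = d" using D(4)[OF c(1) d(1)] by blast
  have "g' \<cdot> (l \<cdot> e) = p" "b \<cdot> (l \<cdot> e) = q"
    using comp_assoc[OF cocycle_hom[OF D(1)] cocycle_hom[OF l(1)] e(1)]
      comp_assoc[OF cocycle_hom[OF D(2)] cocycle_hom[OF l(1)] e(1)] l c d by simp_all
  moreover have "hom W P n (l \<cdot> e)" using hom_comp[OF cocycle_hom[OF l(1)] e(1)] by simp
  ultimately show ?thesis by blast
qed

lemma pullback_cancel:
  assumes P: "is_pullback (Z0 A) Y Z Z' g a P g' b" and g: "cocycle Y Z 0 g" and a: "cocycle Z' Z 0 a"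
    and h: "hom W P n h" "g' \<cdot> h = 0" "b \<cdot> h = 0"
  shows "h = 0"
proof -
  note D = Z.pullbackD[OF P g a]
  obtain R e where e: "hom W R n e" "\<And>Q b. hom W Q n b \<Longrightarrow> \<exists>c. cocycle R Q 0 c \<and> c \<cdot> e = b"
    "\<And>Q c. cocycle R Q 0 c \<Longrightarrow> c \<cdot> e = 0 \<Longrightarrow> c = 0" using corepresent[OF hom_ob(1)[OF h(1)]] by blast
  obtain c where c: "cocycle R P 0 c" "c \<cdot> e = h" using e(2)[OF h(1)] by blast
  have 1: "g' \<cdot> c = 0"
    using e(3)[OF cocycle_comp[OF D(1) c(1)]] comp_assoc[OF cocycle_hom[OF D(1)] cocycle_hom[OF c(1)] e(1)] c(2) h(2) by simp
  have 2: "b \<cdot> c = 0"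
    using e(3)[OF cocycle_comp[OF D(2) c(1)]] comp_assoc[OF cocycle_hom[OF D(2)] cocycle_hom[OF c(1)] e(1)] c(2) h(3) by simp
  have "c = 0"
    using Z.pullback_eq[OF P g a c(1) cocycle_0] 1 2 comp_0[OF cocycle_hom[OF D(1)]] comp_0[OF cocycle_hom[OF D(2)]]
      hom_ob[OF cocycle_hom[OF c(1)]] by simp
  then show ?thesis using c(2) zero_comp[OF e(1)] hom_ob[OF h(1)] by simp
qed

end

section \<open>Contractions on universal objects\<close>

context dg_category
begin

definition contraction :: "'o \<Rightarrow> 'm \<Rightarrow> bool" where
  "contraction X h \<longleftrightarrow> hom X X (- u) h \<and> dif A X X (- u) h = idm A X \<and> h \<cdot> h = 0"

lemma natural_Ob: "(X, h) \<in> Ob (natural_dg \<sigma> u A) \<longleftrightarrow> contraction X h"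
  by (auto simp: natural_dg_def contraction_def hom_def)

lemma natural_Hom: "Hom (natural_dg \<sigma> u A) (X, h) (Y, k) i = closed_hom A X Y (- i)"
  and natural_dif: "dif (natural_dg \<sigma> u A) (X, h) (Y, k) i f = k \<cdot> f - signed \<sigma> u i (f \<cdot> h)"
  and natural_idm: "idm (natural_dg \<sigma> u A) (X, h) = idm A X"
  and natural_cmp: "cmp (natural_dg \<sigma> u A) = cmp A"
  by (simp_all add: natural_dg_def)

lemma contraction_hom: "contraction X h \<Longrightarrow> hom X X (- u) h"
  and contraction_dif: "contraction X h \<Longrightarrow> dif A X X (- u) h = idm A X"
  and contraction_square: "contraction X h \<Longrightarrow> h \<cdot> h = 0"
  by (simp_all add: contraction_def)

text \<open>
  Let \<open>l\<close> be an endomorphism that is compatible with a contraction \<open>k\<close> along a closed morphism \<open>g\<close>.  Then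
  the obstructions \<open>d l - id\<close> and \<open>l l\<close> against \<open>l\<close> being a contraction vanish on \<open>g\<close>.  If \<open>g\<close> runs over
  the legs of a colimit cocone, they vanish, and \<open>l\<close> is a contraction.  The second lemma is the dual one
  for limits.
\<close>

lemma commute_leg_out:
  assumes g: "cocycle Y Z 0 g" and k: "contraction Y k" and l: "hom Z Z (- u) l" and lg: "l \<cdot> g = g \<cdot> k"
  shows "(dif A Z Z (- u) l - idm A Z) \<cdot> g = 0" "(l \<cdot> l) \<cdot> g = 0"
proof -
  note gh = cocycle_hom[OF g] and kh = contraction_hom[OF k]
  have dl: "hom Z Z 0 (dif A Z Z (- u) l)" by (rule hom_dif[OF l]) simp
  have "dif A Y Z (- u) (l \<cdot> g) = dif A Z Z (- u) l \<cdot> g" by (rule dif_comp_closed[OF l g]) simp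
  moreover have "dif A Y Z (- u) (g \<cdot> k) = g"
    using dif_closed_comp[OF g kh] contraction_dif[OF k] comp_id[OF gh] by simp
  ultimately show "(dif A Z Z (- u) l - idm A Z) \<cdot> g = 0"
    using diff_comp[OF dl cocycle_hom[OF cocycle_id] gh] id_comp[OF gh] hom_ob[OF gh] lg by simp
  show "(l \<cdot> l) \<cdot> g = 0"
    using comp_assoc[OF l l gh] comp_assoc[OF l gh kh] comp_assoc[OF gh kh kh] lg contraction_square[OF k]
      comp_0[OF gh] hom_ob[OF gh] by simp
qed

lemma commute_leg_in:
  assumes f: "cocycle X Y 0 f" and k: "contraction Y k" and l: "hom X X (- u) l" and fl: "k \<cdot> f = f \<cdot> l"
  shows "f \<cdot> (dif A X X (- u) l - idm A X) = 0" "f \<cdot> (l \<cdot> l) = 0"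
proof -
  note fh = cocycle_hom[OF f] and kh = contraction_hom[OF k]
  have dl: "hom X X 0 (dif A X X (- u) l)" by (rule hom_dif[OF l]) simp
  have "dif A X Y (- u) (f \<cdot> l) = f \<cdot> dif A X X (- u) l" using dif_closed_comp[OF f l] by simp
  moreover have "dif A X Y (- u) (k \<cdot> f) = f"
    using dif_comp_closed[OF kh f] contraction_dif[OF k] id_comp[OF fh] by simp
  ultimately show "f \<cdot> (dif A X X (- u) l - idm A X) = 0"
    using comp_diff[OF fh dl cocycle_hom[OF cocycle_id]] comp_id[OF fh] hom_ob[OF fh] fl by simp
  show "f \<cdot> (l \<cdot> l) = 0"
    using comp_assoc[OF fh l l] comp_assoc[OF kh fh l] comp_assoc[OF kh kh fh] fl contraction_square[OF k]
      zero_comp[OF fh] hom_ob[OF fh] by simp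
qed

lemma contractionI:
  assumes l: "hom X X (- u) l" and d: "dif A X X (- u) l - idm A X = 0" and s: "l \<cdot> l = 0"
  shows "contraction X l"
  using assms by (simp add: contraction_def)

lemma square_hom: "hom X X (- u) l \<Longrightarrow> hom X X (- u + - u) (l \<cdot> l)"
  by (rule hom_comp[OF _ _ refl])

lemma dif_defect_hom: "hom X X (- u) l \<Longrightarrow> hom X X 0 (dif A X X (- u) l - idm A X)"
  using hom_dif[of X X "- u" l 0] cocycle_hom[OF cocycle_id[of X]] by (auto intro: hom_diff simp: hom_ob)

text \<open>
  If a closed morphism \<open>c\<close> out of a colimit commutes with the contractions after composition with the
  legs, then its commutator with the contractions vanishes on the legs, hence vanishes; dually for
  limits.
\<close>

lemma commutator_comp:
  assumes c: "cocycle Z W 0 c" and g: "cocycle Y Z 0 g" and k: "hom Y Y (- u) k" and l: "hom Z Z (- u) l"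
    and m: "hom W W (- u) m" and lg: "l \<cdot> g = g \<cdot> k" and mcg: "m \<cdot> (c \<cdot> g) = (c \<cdot> g) \<cdot> k"
  shows "hom Z W (- u) (m \<cdot> c - c \<cdot> l)" "(m \<cdot> c - c \<cdot> l) \<cdot> g = 0"
proof -
  note ch = cocycle_hom[OF c] and gh = cocycle_hom[OF g]
  have mc: "hom Z W (- u) (m \<cdot> c)" and cl: "hom Z W (- u) (c \<cdot> l)"
    using hom_comp[OF m ch] hom_comp[OF ch l] by simp_all
  show "hom Z W (- u) (m \<cdot> c - c \<cdot> l)" by (rule hom_diff[OF mc cl])
  show "(m \<cdot> c - c \<cdot> l) \<cdot> g = 0"
    using diff_comp[OF mc cl gh] comp_assoc[OF m ch gh] comp_assoc[OF ch l gh] comp_assoc[OF ch gh k] lg mcg by simp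
qed

lemma comp_commutator:
  assumes c: "cocycle W X 0 c" and f: "cocycle X Y 0 f" and k: "hom Y Y (- u) k" and l: "hom X X (- u) l"
    and m: "hom W W (- u) m" and fl: "k \<cdot> f = f \<cdot> l" and fcm: "k \<cdot> (f \<cdot> c) = (f \<cdot> c) \<cdot> m"
  shows "hom W X (- u) (l \<cdot> c - c \<cdot> m)" "f \<cdot> (l \<cdot> c - c \<cdot> m) = 0"
proof -
  note ch = cocycle_hom[OF c] and fh = cocycle_hom[OF f]
  have lc: "hom W X (- u) (l \<cdot> c)" and cm: "hom W X (- u) (c \<cdot> m)"
    using hom_comp[OF l ch] hom_comp[OF ch m] by simp_all
  show "hom W X (- u) (l \<cdot> c - c \<cdot> m)" by (rule hom_diff[OF lc cm])
  show "f \<cdot> (l \<cdot> c - c \<cdot> m) = 0"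
    using comp_diff[OF fh lc cm] comp_assoc[OF fh l ch] comp_assoc[OF fh ch m] comp_assoc[OF k fh ch] fl fcm by simp
qed

end

context dg_cone_category
begin

text \<open>
  Since \<open>A\<^sup>\<natural>\<close> has the composition of \<open>A\<close>, identities in \<open>A\<close> and in \<open>A\<^sup>\<natural>\<close> can be used side by side.
\<close>

sublocale N: dg_category \<sigma> u "natural_dg \<sigma> u A"
  rewrites "cmp (natural_dg \<sigma> u A) = cmp A"
  by (rule natural_dg) (simp add: natural_cmp)

lemma N_cocycle: "N.cocycle (X, h) (Y, k) 0 f \<longleftrightarrow>
    contraction X h \<and> contraction Y k \<and> cocycle X Y 0 f \<and> k \<cdot> f = f \<cdot> h"
  unfolding N.cocycle_iff natural_Ob closed_hom_def[of "natural_dg \<sigma> u A"] natural_Hom natural_dif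
  by (auto simp: cocycle_iff contraction_def hom_def)

text \<open>
  A contraction of \<open>Y\<close> that restricts to \<open>X\<close> descends to the quotient: \<open>g k\<close> vanishes on \<open>X\<close>, so it
  factors through the cokernel, which is also a cokernel for morphisms of degree \<open>-u\<close>.
\<close>

lemma quotient_contraction:
  assumes c: "Z.cokernel (X, f, Y, g, Z)" and f: "N.cocycle (X, h) (Y, k) 0 f"
  shows "\<exists>l. N.cocycle (Y, k) (Z, l) 0 g"
proof -
  note D = Z.cokernelD[OF c]
  note f' = f[unfolded N_cocycle]
  note k = f'[THEN conjunct2, THEN conjunct1] and h = f'[THEN conjunct1]
  note hh = contraction_hom[OF h] and kh = contraction_hom[OF k] and gh = cocycle_hom[OF D(2)] and fh = cocycle_hom[OF D(1)]
  have gk: "hom Y Z (- u) (g \<cdot> k)" using hom_comp[OF gh kh] by simp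
  have "(g \<cdot> k) \<cdot> f = (g \<cdot> f) \<cdot> h" using comp_assoc[OF gh kh fh] comp_assoc[OF gh fh hh] f' by simp
  then have "(g \<cdot> k) \<cdot> f = 0" using D(3) zero_comp[OF hh] hom_ob(2)[OF gh] by simp
  then obtain l where l: "hom Z Z (- u) l" "l \<cdot> g = g \<cdot> k" using cokernel_factor[OF c gk] by blast
  have "contraction Z l"
    using commute_leg_out[OF D(2) k l]
    by (intro contractionI[OF l(1)] cokernel_cancel[OF c dif_defect_hom[OF l(1)]] cokernel_cancel[OF c square_hom[OF l(1)]])
  then show ?thesis using l D(2) k N_cocycle by blast
qed

lemma sub_contraction:
  assumes c: "Z.kernel (X, f, Y, g, Z)" and g: "N.cocycle (Y, k) (Z, l) 0 g"
  shows "\<exists>h. N.cocycle (X, h) (Y, k) 0 f"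
proof -
  note D = Z.kernelD[OF c]
  note g' = g[unfolded N_cocycle]
  note k = g'[THEN conjunct1] and l = g'[THEN conjunct2, THEN conjunct1]
  note lh = contraction_hom[OF l] and kh = contraction_hom[OF k] and gh = cocycle_hom[OF D(2)] and fh = cocycle_hom[OF D(1)]
  have kf: "hom X Y (- u) (k \<cdot> f)" using hom_comp[OF kh fh] by simp
  have "g \<cdot> (k \<cdot> f) = l \<cdot> (g \<cdot> f)" using comp_assoc[OF gh kh fh] comp_assoc[OF lh gh fh] g' by simp
  then have "g \<cdot> (k \<cdot> f) = 0" using D(3) comp_0[OF lh] hom_ob(1)[OF fh] by simp
  then obtain h where h: "hom X X (- u) h" "f \<cdot> h = k \<cdot> f" using kernel_factor[OF c kf] by blast
  have "contraction X h"
    using commute_leg_in[OF D(1) k h(1) h(2)[symmetric]]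
    by (intro contractionI[OF h(1)] kernel_cancel[OF c dif_defect_hom[OF h(1)]] kernel_cancel[OF c square_hom[OF h(1)]])
  then show ?thesis using h D(1) k N_cocycle by auto
qed

lemma natural_kernel:
  assumes c: "Z.kernel (X, f, Y, g, Z)" and f: "N.cocycle (X, h) (Y, k) 0 f" and g: "N.cocycle (Y, k) (Z, l) 0 g"
  shows "N.Z.kernel ((X, h), f, (Y, k), g, (Z, l))"
proof (rule N.Z.kernelI[OF f g])
  note D = Z.kernelD[OF c]
  show "g \<cdot> f = 0" by (rule D(3))
  note f' = f[unfolded N_cocycle]
  fix P v
  show "\<exists>w. N.cocycle P (X, h) 0 w \<and> f \<cdot> w = v" if v: "N.cocycle P (Y, k) 0 v" and gv: "g \<cdot> v = 0"
  proof (cases P)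
    case (Pair W m)
    note v' = v[unfolded Pair N_cocycle]
    obtain w where w: "cocycle W X 0 w" "f \<cdot> w = v" using D(4) v' gv by blast
    have "hom W X (- u) (h \<cdot> w - w \<cdot> m)" "f \<cdot> (h \<cdot> w - w \<cdot> m) = 0"
      using comp_commutator[OF w(1) D(1), of k h m] f' v' w(2) by (auto simp: contraction_hom)
    then have "h \<cdot> w - w \<cdot> m = 0" by (rule kernel_cancel[OF c])
    then have "N.cocycle P (X, h) 0 w" using w f' v' by (simp add: Pair N_cocycle)
    then show ?thesis using w(2) by blast
  qed
  show "v = 0" if v: "N.cocycle P (X, h) 0 v" and fv: "f \<cdot> v = 0"
    using that by (cases P) (auto simp: N_cocycle intro: kernel_cancel[OF c cocycle_hom])
qed

lemma natural_cokernel: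
  assumes c: "Z.cokernel (X, f, Y, g, Z)" and f: "N.cocycle (X, h) (Y, k) 0 f" and g: "N.cocycle (Y, k) (Z, l) 0 g"
  shows "N.Z.cokernel ((X, h), f, (Y, k), g, (Z, l))"
proof (rule N.Z.cokernelI[OF f g])
  note D = Z.cokernelD[OF c]
  show "g \<cdot> f = 0" by (rule D(3))
  note g' = g[unfolded N_cocycle]
  fix P v
  show "\<exists>w. N.cocycle (Z, l) P 0 w \<and> w \<cdot> g = v" if v: "N.cocycle (Y, k) P 0 v" and gv: "v \<cdot> f = 0"
  proof (cases P)
    case (Pair W m)
    note v' = v[unfolded Pair N_cocycle]
    obtain w where w: "cocycle Z W 0 w" "w \<cdot> g = v" using D(4) v' gv by blast
    have "hom Z W (- u) (m \<cdot> w - w \<cdot> l)" "(m \<cdot> w - w \<cdot> l) \<cdot> g = 0"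
      using commutator_comp[OF w(1) D(2), of k l m] g' v' w(2) by (auto simp: contraction_hom)
    then have "m \<cdot> w - w \<cdot> l = 0" by (rule cokernel_cancel[OF c])
    then have "N.cocycle (Z, l) P 0 w" using w g' v' by (simp add: Pair N_cocycle)
    then show ?thesis using w(2) by blast
  qed
  show "v = 0" if v: "N.cocycle (Z, l) P 0 v" and fv: "v \<cdot> g = 0"
    using that by (cases P) (auto simp: N_cocycle intro: cokernel_cancel[OF c cocycle_hom])
qed

text \<open>
  The contraction of the pushout is glued from \<open>f' h'\<close> and \<open>b k\<close>, which agree on \<open>X\<close> because \<open>f\<close> and \<open>a\<close>
  commute with the contractions.
\<close>

lemma natural_pushout:
  assumes c: "is_pushout (Z0 A) X Y X' f a P f' b"
    and f: "N.cocycle (X, h) (Y, k) 0 f" and a: "N.cocycle (X, h) (X', h') 0 a"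
  shows "\<exists>p. is_pushout (Z0 (natural_dg \<sigma> u A)) (X, h) (Y, k) (X', h') f a (P, p) f' b"
proof -
  note f0 = f[unfolded N_cocycle] and a0 = a[unfolded N_cocycle]
  have fc: "cocycle X Y 0 f" and ac: "cocycle X X' 0 a" and h: "contraction X h" and k: "contraction Y k" and h': "contraction X' h'"
    using f0 a0 by auto
  note D = Z.pushoutD[OF c fc ac]
  note hh = contraction_hom[OF h] and kh = contraction_hom[OF k] and h'h = contraction_hom[OF h']
    and fh = cocycle_hom[OF fc] and ah = cocycle_hom[OF ac] and bh = cocycle_hom[OF D(2)] and f'h = cocycle_hom[OF D(1)]
  have 1: "hom X' P (- u) (f' \<cdot> h')" and 2: "hom Y P (- u) (b \<cdot> k)"
    using hom_comp[OF f'h h'h] hom_comp[OF bh kh] by simp_all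
  have "(b \<cdot> k) \<cdot> f = (f' \<cdot> h') \<cdot> a"
    using comp_assoc[OF bh kh fh] comp_assoc[OF bh fh hh] comp_assoc[OF f'h h'h ah] comp_assoc[OF f'h ah hh]
      D(3) f0 a0 by simp
  then obtain p where p: "hom P P (- u) p" "p \<cdot> f' = f' \<cdot> h'" "p \<cdot> b = b \<cdot> k"
    using pushout_factor[OF c fc ac 1 2] by blast
  have "contraction P p"
    using commute_leg_out[OF D(1) h' p(1,2)] commute_leg_out[OF D(2) k p(1,3)]
    by (intro contractionI[OF p(1)] pushout_cancel[OF c fc ac dif_defect_hom[OF p(1)]]
        pushout_cancel[OF c fc ac square_hom[OF p(1)]])
  then have f'N: "N.cocycle (X', h') (P, p) 0 f'" and bN: "N.cocycle (Y, k) (P, p) 0 b"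
    using p D(1,2) h' k by (auto simp: N_cocycle)
  have "is_pushout (Z0 (natural_dg \<sigma> u A)) (X, h) (Y, k) (X', h') f a (P, p) f' b"
  proof (rule N.Z.pushoutI[OF f a f'N bN D(3)])
    fix R v w assume v: "N.cocycle (X', h') R 0 v" and w: "N.cocycle (Y, k) R 0 w" and wv: "w \<cdot> f = v \<cdot> a"
    obtain W m where R: "R = (W, m)" by (cases R)
    note v' = v[unfolded R N_cocycle] and w' = w[unfolded R N_cocycle]
    obtain z where z: "cocycle P W 0 z" "z \<cdot> f' = v" "z \<cdot> b = w" using D(4) v' w' wv by blast
    have "hom P W (- u) (m \<cdot> z - z \<cdot> p)" "(m \<cdot> z - z \<cdot> p) \<cdot> f' = 0" "(m \<cdot> z - z \<cdot> p) \<cdot> b = 0"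
      using commutator_comp[OF z(1) D(1) h'h p(1), of m] commutator_comp[OF z(1) D(2) kh p(1), of m]
        p z(2,3) v' w' by (auto simp: contraction_hom)
    then have "m \<cdot> z - z \<cdot> p = 0" by (rule pushout_cancel[OF c fc ac])
    then have "N.cocycle (P, p) R 0 z" using z v' f'N by (simp add: R N_cocycle)
    then show "\<exists>z. N.cocycle (P, p) R 0 z \<and> z \<cdot> f' = v \<and> z \<cdot> b = w" using z by blast
  next
    fix R v assume "N.cocycle (P, p) R 0 v" "v \<cdot> f' = 0" "v \<cdot> b = 0"
    then show "v = 0" by (cases R) (auto simp: N_cocycle intro: pushout_cancel[OF c fc ac cocycle_hom])
  qed
  then show ?thesis ..
qed

lemma natural_pullback:
  assumes c: "is_pullback (Z0 A) Y Z Z' g a P g' b"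
    and g: "N.cocycle (Y, k) (Z, l) 0 g" and a: "N.cocycle (Z', l') (Z, l) 0 a"
  shows "\<exists>p. is_pullback (Z0 (natural_dg \<sigma> u A)) (Y, k) (Z, l) (Z', l') g a (P, p) g' b"
proof -
  note g0 = g[unfolded N_cocycle] and a0 = a[unfolded N_cocycle]
  have gc: "cocycle Y Z 0 g" and ac: "cocycle Z' Z 0 a" and l: "contraction Z l" and k: "contraction Y k" and l': "contraction Z' l'"
    using g0 a0 by auto
  note D = Z.pullbackD[OF c gc ac]
  note lh = contraction_hom[OF l] and kh = contraction_hom[OF k] and l'h = contraction_hom[OF l']
    and gh = cocycle_hom[OF gc] and ah = cocycle_hom[OF ac] and bh = cocycle_hom[OF D(2)] and g'h = cocycle_hom[OF D(1)]
  have 1: "hom P Z' (- u) (l' \<cdot> g')" and 2: "hom P Y (- u) (k \<cdot> b)"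
    using hom_comp[OF l'h g'h] hom_comp[OF kh bh] by simp_all
  have "g \<cdot> (k \<cdot> b) = a \<cdot> (l' \<cdot> g')"
    using comp_assoc[OF gh kh bh] comp_assoc[OF lh gh bh] comp_assoc[OF ah l'h g'h] comp_assoc[OF lh ah g'h]
      D(3) g0 a0 by simp
  then obtain p where p: "hom P P (- u) p" "g' \<cdot> p = l' \<cdot> g'" "b \<cdot> p = k \<cdot> b"
    using pullback_factor[OF c gc ac 1 2] by blast
  have "contraction P p"
    using commute_leg_in[OF D(1) l' p(1) p(2)[symmetric]] commute_leg_in[OF D(2) k p(1) p(3)[symmetric]]
    by (intro contractionI[OF p(1)] pullback_cancel[OF c gc ac dif_defect_hom[OF p(1)]]
        pullback_cancel[OF c gc ac square_hom[OF p(1)]])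
  then have g'N: "N.cocycle (P, p) (Z', l') 0 g'" and bN: "N.cocycle (P, p) (Y, k) 0 b"
    using p D(1,2) l' k by (auto simp: N_cocycle)
  have "is_pullback (Z0 (natural_dg \<sigma> u A)) (Y, k) (Z, l) (Z', l') g a (P, p) g' b"
  proof (rule N.Z.pullbackI[OF g a g'N bN D(3)])
    fix R v w assume v: "N.cocycle R (Z', l') 0 v" and w: "N.cocycle R (Y, k) 0 w" and wv: "g \<cdot> w = a \<cdot> v"
    obtain W m where R: "R = (W, m)" by (cases R)
    note v' = v[unfolded R N_cocycle] and w' = w[unfolded R N_cocycle]
    obtain z where z: "cocycle W P 0 z" "g' \<cdot> z = v" "b \<cdot> z = w" using D(4) v' w' wv by blast
    have "hom W P (- u) (p \<cdot> z - z \<cdot> m)" "g' \<cdot> (p \<cdot> z - z \<cdot> m) = 0" "b \<cdot> (p \<cdot> z - z \<cdot> m) = 0"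
      using comp_commutator[OF z(1) D(1) l'h p(1), of m] comp_commutator[OF z(1) D(2) kh p(1), of m]
        p z(2,3) v' w' by (auto simp: contraction_hom)
    then have "p \<cdot> z - z \<cdot> m = 0" by (rule pullback_cancel[OF c gc ac])
    then have "N.cocycle R (P, p) 0 z" using z v' g'N by (simp add: R N_cocycle)
    then show "\<exists>z. N.cocycle R (P, p) 0 z \<and> g' \<cdot> z = v \<and> b \<cdot> z = w" using z by blast
  next
    fix R v assume "N.cocycle R (P, p) 0 v" "g' \<cdot> v = 0" "b \<cdot> v = 0"
    then show "v = 0" by (cases R) (auto simp: N_cocycle intro: pullback_cancel[OF c gc ac cocycle_hom])
  qed
  then show ?thesis ..
qed

text \<open>
  A zero object has the contraction 0; on a biproduct the contraction is the direct sum of the two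
  given ones.
\<close>

lemma natural_additive:
  assumes add: "additive_category (Z0 A)"
  shows "additive_category (Z0 (natural_dg \<sigma> u A))"
  unfolding additive_category_def
proof (intro conjI ballI)
  show "preadditive_category (Z0 (natural_dg \<sigma> u A))" by (rule N.Z0_preadditive)
next
  obtain O' where O: "is_zero_object (Z0 A) O'" using add by (auto simp: additive_category_def)
  have Ob: "O' \<in> Ob A" and z: "\<And>X f. cocycle X O' 0 f \<Longrightarrow> f = 0" "\<And>X f. cocycle O' X 0 f \<Longrightarrow> f = 0"
    using O by (auto simp: is_zero_object_def cocycle_iff)
  have c: "contraction O' 0"
    using z(1)[OF cocycle_id[OF Ob]] comp_0[OF hom_0[OF Ob Ob] Ob] Ob by (simp add: contraction_def hom_0 dif_0)
  have "is_zero_object (Z0 (natural_dg \<sigma> u A)) (O', 0)"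
    unfolding is_zero_object_def
  proof (intro conjI ballI)
    show "(O', 0) \<in> Ob (Z0 (natural_dg \<sigma> u A))" using c by (simp add: natural_Ob)
  next
    fix P assume P: "P \<in> Ob (Z0 (natural_dg \<sigma> u A))"
    obtain X h where Xh: "P = (X, h)" by (cases P)
    have P': "P \<in> Ob (natural_dg \<sigma> u A)" "(O', 0) \<in> Ob (natural_dg \<sigma> u A)" using P c by (simp_all add: natural_Ob)
    have "f = 0" if "f \<in> Mor (Z0 (natural_dg \<sigma> u A)) P (O', 0)" for f
      using that P' z(1)[of X f] N_cocycle[of X h O' 0 f] by (simp add: N.cocycle_iff Xh)
    moreover have "0 \<in> Mor (Z0 (natural_dg \<sigma> u A)) P (O', 0)"
      using N.cocycle_0[OF P', of 0] by (simp add: N.cocycle_iff)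
    ultimately show "Mor (Z0 (natural_dg \<sigma> u A)) P (O', 0) = {0}" by blast
    have "f = 0" if "f \<in> Mor (Z0 (natural_dg \<sigma> u A)) (O', 0) P" for f
      using that P' z(2)[of X f] N_cocycle[of O' 0 X h f] by (simp add: N.cocycle_iff Xh)
    moreover have "0 \<in> Mor (Z0 (natural_dg \<sigma> u A)) (O', 0) P"
      using N.cocycle_0[OF P'(2,1), of 0] by (simp add: N.cocycle_iff)
    ultimately show "Mor (Z0 (natural_dg \<sigma> u A)) (O', 0) P = {0}" by blast
  qed
  then show "\<exists>N. is_zero_object (Z0 (natural_dg \<sigma> u A)) N" ..
next
  fix P Q assume PQ: "P \<in> Ob (Z0 (natural_dg \<sigma> u A))" "Q \<in> Ob (Z0 (natural_dg \<sigma> u A))"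
  obtain X h where P: "P = (X, h)" by (cases P)
  obtain Y k where Q: "Q = (Y, k)" by (cases Q)
  have h: "contraction X h" and k: "contraction Y k" using PQ by (simp_all add: P Q natural_Ob)
  note hh = contraction_hom[OF h] and kh = contraction_hom[OF k]
  have Ob: "X \<in> Ob A" "Y \<in> Ob A" using hom_ob hh kh by blast+
  then obtain B where "is_biproduct (Z0 A) X Y B" using add by (auto simp: additive_category_def)
  then obtain i j p q where B: "cocycle X B 0 i" "cocycle Y B 0 j" "cocycle B X 0 p" "cocycle B Y 0 q"
    and e: "p \<cdot> i = idm A X" "q \<cdot> j = idm A Y" "q \<cdot> i = 0" "p \<cdot> j = 0" "i \<cdot> p + j \<cdot> q = idm A B"
    using Ob by (auto simp: is_biproduct_def cocycle_iff)
  note ih = cocycle_hom[OF B(1)] and jh = cocycle_hom[OF B(2)] and ph = cocycle_hom[OF B(3)] and qh = cocycle_hom[OF B(4)]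
  have BOb: "B \<in> Ob A" using hom_ob(2)[OF ih] .
  let ?l = "i \<cdot> (h \<cdot> p) + j \<cdot> (k \<cdot> q)"
  have hp: "hom B X (- u) (h \<cdot> p)" and kq: "hom B Y (- u) (k \<cdot> q)"
    using hom_comp[OF hh ph] hom_comp[OF kh qh] by simp_all
  have ihp: "hom B B (- u) (i \<cdot> (h \<cdot> p))" and jkq: "hom B B (- u) (j \<cdot> (k \<cdot> q))"
    using hom_comp[OF ih hp] hom_comp[OF jh kq] by simp_all
  have l: "hom B B (- u) ?l" by (rule hom_add[OF ihp jkq])
  have li: "?l \<cdot> i = i \<cdot> h"
    using add_comp[OF ihp jkq ih] comp_assoc[OF ih hp ih] comp_assoc[OF hh ph ih] comp_assoc[OF jh kq ih]
      comp_assoc[OF kh qh ih] e comp_id[OF hh] comp_0[OF kh Ob(1)] comp_0[OF jh Ob(1)] by simp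
  have lj: "?l \<cdot> j = j \<cdot> k"
    using add_comp[OF ihp jkq jh] comp_assoc[OF ih hp jh] comp_assoc[OF hh ph jh] comp_assoc[OF jh kq jh]
      comp_assoc[OF kh qh jh] e comp_id[OF kh] comp_0[OF hh Ob(2)] comp_0[OF ih Ob(2)] by simp
  have pl: "p \<cdot> ?l = h \<cdot> p"
    using comp_add[OF ph ihp jkq] comp_assoc[OF ph ih hp] comp_assoc[OF ph jh kq] e id_comp[OF hp]
      zero_comp[OF kq Ob(1)] by simp
  have ql: "q \<cdot> ?l = k \<cdot> q"
    using comp_add[OF qh ihp jkq] comp_assoc[OF qh ih hp] comp_assoc[OF qh jh kq] e id_comp[OF kq]
      zero_comp[OF hp Ob(2)] by simp
  have cancel: "c = 0" if c: "hom B B n c" "c \<cdot> i = 0" "c \<cdot> j = 0" for n c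
  proof -
    have "c = c \<cdot> (i \<cdot> p + j \<cdot> q)" using e(5) comp_id[OF c(1)] by simp
    also have "\<dots> = c \<cdot> (i \<cdot> p) + c \<cdot> (j \<cdot> q)"
      using comp_add[OF c(1) hom_comp[OF ih ph] hom_comp[OF jh qh]] by simp
    finally show ?thesis
      using comp_assoc[OF c(1) ih ph] comp_assoc[OF c(1) jh qh] c zero_comp[OF ph BOb] zero_comp[OF qh BOb] by simp
  qed
  have "contraction B ?l"
    using commute_leg_out[OF B(1) h l li] commute_leg_out[OF B(2) k l lj]
    by (intro contractionI[OF l] cancel[OF dif_defect_hom[OF l]] cancel[OF square_hom[OF l]])
  then have "N.cocycle P (B, ?l) 0 i" "N.cocycle Q (B, ?l) 0 j" "N.cocycle (B, ?l) P 0 p" "N.cocycle (B, ?l) Q 0 q"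
    using B h k li lj pl ql by (simp_all add: N_cocycle P Q)
  then have "is_biproduct (Z0 (natural_dg \<sigma> u A)) P Q (B, ?l)"
    using e by (auto simp: is_biproduct_def N.cocycle_iff natural_idm natural_cmp P Q)
  then show "\<exists>B. is_biproduct (Z0 (natural_dg \<sigma> u A)) P Q B" ..
qed

lemma natural_iso:
  assumes "is_iso (Z0 (natural_dg \<sigma> u A)) (X, h) (X', h') a" "contraction X h" "contraction X' h'"
  shows "is_iso (Z0 A) X X' a"
proof -
  have "(X, h) \<in> Ob (natural_dg \<sigma> u A)" "(X', h') \<in> Ob (natural_dg \<sigma> u A)" using assms by (simp_all add: natural_Ob)
  then obtain b where "N.cocycle (X, h) (X', h') 0 a" "N.cocycle (X', h') (X, h) 0 b" "b \<cdot> a = idm A X" "a \<cdot> b = idm A X'"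
    using N.Z.is_isoE[OF assms(1)] by (auto simp: natural_idm)
  then show ?thesis by (intro Z.is_isoI[of _ _ _ b]) (auto simp: N_cocycle)
qed

end

section \<open>The exact structure on contracted objects\<close>

locale natural_exact_category = dg_cone_category \<sigma> u A
  for \<sigma> :: "'g::ab_group_add \<Rightarrow> 'g \<Rightarrow> bit" and u :: 'g
    and A :: "('g, 'o, 'm::ab_group_add) dgcat" (structure) +
  fixes \<E> :: "('o, 'm) seq set"
  assumes exact: "exact_structure (Z0 A) \<E>"
begin

sublocale Z: exact_category "Z0 A" \<E>
  rewrites "cmp (Z0 A) = cmp A" and "Ob (Z0 A) = Ob A" and "idm (Z0 A) = idm A"
    and "preadditive_category.mor (Z0 A) = (\<lambda>X Y. cocycle X Y 0)"
  by (simp_all add: exact_category_def exact_category_axioms_def Z0_preadditive exact fun_eq_iff Z0_mor)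

definition lift :: "('o \<times> 'm, 'm) seq set" where
  "lift = {s. composable (Z0 (natural_dg \<sigma> u A)) s \<and> map_seq Psi_ob Psi_mor s \<in> \<E>}"

lemma lift_iff: "((X, h), f, (Y, k), g, (Z, l)) \<in> lift \<longleftrightarrow>
    N.cocycle (X, h) (Y, k) 0 f \<and> N.cocycle (Y, k) (Z, l) 0 g \<and> (X, f, Y, g, Z) \<in> \<E>"
  by (auto simp: lift_def composable_def map_seq_def Psi_ob_def Psi_mor_def N.cocycle_iff)

text \<open>
  A morphism commuting with contractions is admissible as soon as it is admissible in \<open>\<E>\<close>, since the
  missing third object of the sequence receives a contraction.
\<close>

lemma mono_lift: "admissible_mono lift (X, h) (Y, k) f \<longleftrightarrow> N.cocycle (X, h) (Y, k) 0 f \<and> admissible_mono \<E> X Y f"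
proof
  show "admissible_mono lift (X, h) (Y, k) f" if *: "N.cocycle (X, h) (Y, k) 0 f \<and> admissible_mono \<E> X Y f"
  proof -
    obtain Z g where s: "(X, f, Y, g, Z) \<in> \<E>" using * by (auto simp: admissible_mono_def)
    then obtain l where "N.cocycle (Y, k) (Z, l) 0 g" using quotient_contraction[OF Z.E_cokernel[OF s]] * by blast
    then show ?thesis using * s lift_iff unfolding admissible_mono_def by blast
  qed
qed (auto simp: admissible_mono_def lift_iff)

lemma epi_lift: "admissible_epi lift (Y, k) (Z, l) g \<longleftrightarrow> N.cocycle (Y, k) (Z, l) 0 g \<and> admissible_epi \<E> Y Z g"
proof
  show "admissible_epi lift (Y, k) (Z, l) g" if *: "N.cocycle (Y, k) (Z, l) 0 g \<and> admissible_epi \<E> Y Z g"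
  proof -
    obtain X f where s: "(X, f, Y, g, Z) \<in> \<E>" using * by (auto simp: admissible_epi_def)
    then obtain h where "N.cocycle (X, h) (Y, k) 0 f" using sub_contraction[OF Z.E_kernel[OF s]] * by blast
    then show ?thesis using * s lift_iff unfolding admissible_epi_def by blast
  qed
qed (auto simp: admissible_epi_def lift_iff)

theorem lift_exact: "exact_structure (Z0 (natural_dg \<sigma> u A)) lift"
  unfolding exact_structure_def
proof (intro conjI ballI allI impI; (elim conjE)?)
  show "additive_category (Z0 (natural_dg \<sigma> u A))" by (rule natural_additive[OF Z.additive])
next
  fix s assume s: "s \<in> lift"
  obtain X h f Y k g Z l where [simp]: "s = ((X, h), f, (Y, k), g, (Z, l))" by (metis surj_pair)
  show "kernel_cokernel_pair (Z0 (natural_dg \<sigma> u A)) s"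
    using s natural_kernel natural_cokernel Z.E_kernel Z.E_cokernel
    by (simp add: N.Z.kernel_cokernel_pair_iff lift_iff)
  fix s' assume s': "composable (Z0 (natural_dg \<sigma> u A)) s'" and i: "seq_iso (Z0 (natural_dg \<sigma> u A)) s s'"
  obtain X' h' f' Y' k' g' Z' l' where [simp]: "s' = ((X', h'), f', (Y', k'), g', (Z', l'))" by (metis surj_pair)
  have t: "N.cocycle (X, h) (Y, k) 0 f" "N.cocycle (Y, k) (Z, l) 0 g" "(X, f, Y, g, Z) \<in> \<E>"
    using s by (auto simp: lift_iff)
  have t': "N.cocycle (X', h') (Y', k') 0 f'" "N.cocycle (Y', k') (Z', l') 0 g'"
    using s' by (auto simp: composable_def N.cocycle_iff)
  obtain a b c where abc: "is_iso (Z0 (natural_dg \<sigma> u A)) (X, h) (X', h') a"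
    "is_iso (Z0 (natural_dg \<sigma> u A)) (Y, k) (Y', k') b" "is_iso (Z0 (natural_dg \<sigma> u A)) (Z, l) (Z', l') c"
    "b \<cdot> f = f' \<cdot> a" "c \<cdot> g = g' \<cdot> b"
    using i by (auto simp: seq_iso_def natural_cmp)
  have "(X', f', Y', g', Z') \<in> \<E>"
    by (rule Z.E_iso[OF t(3), of _ a _ b _ c])
      (use abc t t' in \<open>auto simp: N_cocycle intro: natural_iso\<close>)
  then show "s' \<in> lift" using t' by (simp add: lift_iff)
next
  fix P assume P: "P \<in> Ob (Z0 (natural_dg \<sigma> u A))"
  obtain X h where [simp]: "P = (X, h)" by (cases P)
  have X: "X \<in> Ob A" using P hom_ob(1)[OF contraction_hom] by (simp add: natural_Ob)
  have "N.cocycle P P 0 (idm A X)" using N.cocycle_id[of P] P by (simp add: natural_idm)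
  then show "admissible_mono lift P P (idm (Z0 (natural_dg \<sigma> u A)) P)"
    "admissible_epi lift P P (idm (Z0 (natural_dg \<sigma> u A)) P)"
    using Z.id_admissible X by (simp_all add: natural_idm mono_lift epi_lift)
next
  fix P Q R f g assume "admissible_mono lift P Q f" "admissible_mono lift Q R g"
  then show "admissible_mono lift P R (g \<cdot>\<^bsub>Z0 (natural_dg \<sigma> u A)\<^esub> f)"
    using N.cocycle_comp[of Q R 0 g P 0 f 0] Z.mono_comp
    by (cases P; cases Q; cases R) (auto simp: mono_lift natural_cmp)
next
  fix P Q R f g assume "admissible_epi lift P Q f" "admissible_epi lift Q R g"
  then show "admissible_epi lift P R (g \<cdot>\<^bsub>Z0 (natural_dg \<sigma> u A)\<^esub> f)"
    using N.cocycle_comp[of Q R 0 g P 0 f 0] Z.epi_comp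
    by (cases P; cases Q; cases R) (auto simp: epi_lift natural_cmp)
next
  fix P Q f P' a assume f: "admissible_mono lift P Q f" and P': "P' \<in> Ob (Z0 (natural_dg \<sigma> u A))"
    and a: "a \<in> Mor (Z0 (natural_dg \<sigma> u A)) P P'"
  obtain X h Y k X' h' where [simp]: "P = (X, h)" "Q = (Y, k)" "P' = (X', h')" by (metis surj_pair)
  have fN: "N.cocycle (X, h) (Y, k) 0 f" and fE: "admissible_mono \<E> X Y f" using f by (simp_all add: mono_lift)
  have aN: "N.cocycle (X, h) (X', h') 0 a" using fN P' a by (auto simp: N.cocycle_iff)
  then have ac: "cocycle X X' 0 a" by (simp add: N_cocycle)
  obtain T f' b where T: "is_pushout (Z0 A) X Y X' f a T f' b" "admissible_mono \<E> X' T f'"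
    using Z.pushout_exists[OF fE ac] by blast
  obtain t where t: "is_pushout (Z0 (natural_dg \<sigma> u A)) (X, h) (Y, k) (X', h') f a (T, t) f' b"
    using natural_pushout[OF T(1) fN aN] by blast
  then show "\<exists>T f' b. is_pushout (Z0 (natural_dg \<sigma> u A)) P Q P' f a T f' b \<and> admissible_mono lift P' T f'"
    using T(2) N.Z.pushoutD(1)[OF t fN aN] by (force simp: mono_lift)
next
  fix Q R g R' a assume g: "admissible_epi lift Q R g" and R': "R' \<in> Ob (Z0 (natural_dg \<sigma> u A))"
    and a: "a \<in> Mor (Z0 (natural_dg \<sigma> u A)) R' R"
  obtain Z l Y k Z' l' where [simp]: "R = (Z, l)" "Q = (Y, k)" "R' = (Z', l')" by (metis surj_pair)
  have gN: "N.cocycle (Y, k) (Z, l) 0 g" and gE: "admissible_epi \<E> Y Z g" using g by (simp_all add: epi_lift)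
  have aN: "N.cocycle (Z', l') (Z, l) 0 a" using gN R' a by (auto simp: N.cocycle_iff)
  then have ac: "cocycle Z' Z 0 a" by (simp add: N_cocycle)
  obtain T g' b where T: "is_pullback (Z0 A) Y Z Z' g a T g' b" "admissible_epi \<E> T Z' g'"
    using Z.pullback_exists[OF gE ac] by blast
  obtain t where t: "is_pullback (Z0 (natural_dg \<sigma> u A)) (Y, k) (Z, l) (Z', l') g a (T, t) g' b"
    using natural_pullback[OF T(1) gN aN] by blast
  then show "\<exists>T g' b. is_pullback (Z0 (natural_dg \<sigma> u A)) Q R R' g a T g' b \<and> admissible_epi lift T R' g'"
    using T(2) N.Z.pullbackD(1)[OF t gN aN] by (force simp: epi_lift)
qed

end

section \<open>Compatibility with shifts\<close>

context dg_category
begin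

lemma is_shiftD:
  assumes "is_shift A i X S s t" "X \<in> Ob A"
  shows "cocycle X S (- i) s" "cocycle S X i t" "t \<cdot> s = idm A X" "s \<cdot> t = idm A S" "S \<in> Ob A"
  using assms by (auto simp: is_shift_def cocycle_iff)

lemma shift_square:
  assumes f: "cocycle X Y 0 f" and X: "is_shift A i X S s t" "is_shift A i X S' s' t'"
    and Y: "is_shift A i Y T p q" "is_shift A i Y T' p' q'"
  shows "(p' \<cdot> q) \<cdot> (p \<cdot> f \<cdot> t) = (p' \<cdot> f \<cdot> t') \<cdot> (s' \<cdot> t)"
proof -
  note Ob = hom_ob[OF cocycle_hom[OF f]]
  note x = is_shiftD[OF X(1) Ob(1)] and x' = is_shiftD[OF X(2) Ob(1)]
    and y = is_shiftD[OF Y(1) Ob(2)] and y' = is_shiftD[OF Y(2) Ob(2)]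
  note fh = cocycle_hom[OF f] and th = cocycle_hom[OF x(2)] and t'h = cocycle_hom[OF x'(2)] and s'h = cocycle_hom[OF x'(1)]
    and ph = cocycle_hom[OF y(1)] and qh = cocycle_hom[OF y(2)] and p'h = cocycle_hom[OF y'(1)]
  have ft: "hom S Y i (f \<cdot> t)" using hom_comp[OF fh th] by simp
  have p'f: "hom X T' (- i) (p' \<cdot> f)" using hom_comp[OF p'h fh] by simp
  have s't: "hom S S' 0 (s' \<cdot> t)" using hom_comp[OF s'h th] by simp
  have "q \<cdot> (p \<cdot> (f \<cdot> t)) = f \<cdot> t" using comp_assoc[OF qh ph ft] y(3) id_comp[OF ft] by simp
  moreover have "t' \<cdot> (s' \<cdot> t) = t" using comp_assoc[OF t'h s'h th] x'(3) id_comp[OF th] by simp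
  ultimately show ?thesis
    using comp_assoc[OF p'h qh hom_comp[OF ph ft refl]] comp_assoc[OF p'f t'h s't] comp_assoc[OF ph fh th]
      comp_assoc[OF p'h fh th] by simp
qed

lemma shift_iso:
  assumes X: "X \<in> Ob A" "is_shift A i X S s t" "is_shift A i X S' s' t'"
  shows "is_iso (Z0 A) S S' (s' \<cdot> t)"
proof -
  note x = is_shiftD[OF X(2,1)] and x' = is_shiftD[OF X(3,1)]
  have 1: "cocycle S S' 0 (s' \<cdot> t)" "cocycle S' S 0 (s \<cdot> t')" using cocycle_comp x x' by auto
  note th = cocycle_hom[OF x(2)] and t'h = cocycle_hom[OF x'(2)] and s'h = cocycle_hom[OF x'(1)] and sh = cocycle_hom[OF x(1)]
  have "(s \<cdot> t') \<cdot> (s' \<cdot> t) = idm A S"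
    using comp_assoc[OF sh t'h cocycle_hom[OF 1(1)]] comp_assoc[OF t'h s'h th] x(4) x'(3) id_comp[OF th] by simp
  moreover have "(s' \<cdot> t) \<cdot> (s \<cdot> t') = idm A S'"
    using comp_assoc[OF s'h th cocycle_hom[OF 1(2)]] comp_assoc[OF th sh t'h] x(3) x'(4) id_comp[OF t'h] by simp
  ultimately show ?thesis using Z.is_isoI[OF 1] by simp
qed

end

context natural_exact_category
begin

text \<open>
  Different choices of shifts give isomorphic sequences.  This matters because the shifts chosen in
  \<open>A\<^sup>\<natural>\<close> need not lie over those chosen in \<open>A\<close>.
\<close>

lemma shift_admissible:
  assumes pres: "preserves_admissible (shift_ob A i) (shift_mor A i) \<E> \<E>" and s: "(X, f, Y, g, Z) \<in> \<E>"
    and X: "is_shift A i X S p p'" and Y: "is_shift A i Y T q q'" and Z: "is_shift A i Z R r r'"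
  shows "(S, q \<cdot> f \<cdot> p', T, r \<cdot> g \<cdot> q', R) \<in> \<E>"
proof -
  note f = Z.E_mor(1)[OF s] and g = Z.E_mor(2)[OF s]
  note Ob = hom_ob(1)[OF cocycle_hom[OF f]] hom_ob(2)[OF cocycle_hom[OF f]] hom_ob(2)[OF cocycle_hom[OF g]]
  note X0 = shift_choice[OF shifts Ob(1), of i] and Y0 = shift_choice[OF shifts Ob(2), of i]
    and Z0 = shift_choice[OF shifts Ob(3), of i]
  have m: "(shift_ob A i X, shift_mor A i X Y f, shift_ob A i Y, shift_mor A i Y Z g, shift_ob A i Z) \<in> \<E>"
    using pres s by (auto simp: preserves_admissible_def map_seq_def)
  show ?thesis
  proof (rule Z.E_iso[OF m shift_iso[OF Ob(1) X0 X] shift_iso[OF Ob(2) Y0 Y] shift_iso[OF Ob(3) Z0 Z]])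
    show "cocycle S T 0 (q \<cdot> f \<cdot> p')"
      by (rule cocycle_comp[OF cocycle_comp[OF is_shiftD(1)[OF Y Ob(2)] f refl] is_shiftD(2)[OF X Ob(1)]]) simp
    show "cocycle T R 0 (r \<cdot> g \<cdot> q')"
      by (rule cocycle_comp[OF cocycle_comp[OF is_shiftD(1)[OF Z Ob(3)] g refl] is_shiftD(2)[OF Y Ob(2)]]) simp
  qed (use shift_square[OF f X0 X Y0 Y] shift_square[OF g Y0 Y Z0 Z] in \<open>simp_all add: shift_mor_def\<close>)
qed

text \<open>
  Degrees in \<open>A\<^sup>\<natural>\<close> are the negatives of those in \<open>A\<close>, so the shift by \<open>i\<close> lies over the shift by \<open>-i\<close>.
  Its contraction is \<open>h\<close> transported along the isomorphism \<open>X \<rightarrow> X[-i]\<close>; this isomorphism has degree \<open>i\<close>,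
  which accounts for the sign.
\<close>

lemma natural_has_shifts: "has_shifts (natural_dg \<sigma> u A)"
  unfolding has_shifts_def
proof (intro ballI allI)
  fix P i assume "P \<in> Ob (natural_dg \<sigma> u A)"
  then obtain X h where P: "P = (X, h)" and h: "contraction X h" by (cases P) (auto simp: natural_Ob)
  note hh = contraction_hom[OF h] and X = hom_ob(1)[OF contraction_hom[OF h]]
  note s = shift_structure[OF X, of "- i", simplified]
  let ?S = "sh (- i) X" and ?s = "sto (- i) X" and ?t = "sfrom (- i) X"
  note sh = cocycle_hom[OF s(1)] and th = cocycle_hom[OF s(2)]
  have sgh: "hom X ?S (i - u) (?s \<cdot> h)" using hom_comp[OF sh hh] by simp
  have ht: "hom ?S X (- u - i) (h \<cdot> ?t)" using hom_comp[OF hh th] by simp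
  let ?c = "(?s \<cdot> h) \<cdot> ?t"
  have c: "hom ?S ?S (- u) ?c" by (rule hom_comp[OF sgh th]) simp
  let ?k = "signed \<sigma> u i ?c"
  have k: "hom ?S ?S (- u) ?k" using c hom_minus[OF c] by (simp add: signed_def)
  have "dif A X ?S (i - u) (?s \<cdot> h) = signed \<sigma> u i ?s"
    using dif_closed_comp[OF s(1) hh] contraction_dif[OF h] comp_id[OF sh] by simp
  then have "dif A ?S ?S (- u) ?c = signed \<sigma> u i (?s \<cdot> ?t)"
    using dif_comp_closed[OF sgh s(2), of "- u"] minus_comp[OF sh th] by (simp add: signed_def)
  then have dk: "dif A ?S ?S (- u) ?k = idm A ?S"
    using s(4) dif_minus[of ?S ?S ?c "- u"] c by (simp add: signed_def hom_def)
  have cs: "?c \<cdot> ?s = ?s \<cdot> h" using comp_assoc[OF sgh th sh] s(3) comp_id[OF sgh] by simp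
  have tc: "?t \<cdot> ?c = h \<cdot> ?t"
    using comp_assoc[OF sh hh th] comp_assoc[OF th sh ht] s(3) id_comp[OF ht] by simp
  have "?c \<cdot> ?c = (?s \<cdot> h) \<cdot> (h \<cdot> ?t)" using comp_assoc[OF sgh th c] tc by simp
  also have "\<dots> = ?s \<cdot> ((h \<cdot> h) \<cdot> ?t)" using comp_assoc[OF sh hh ht] comp_assoc[OF hh hh th] by simp
  also have "\<dots> = 0" using contraction_square[OF h] zero_comp[OF th X] comp_0[OF sh s(5)] by simp
  finally have cc: "?c \<cdot> ?c = 0" .
  then have "?k \<cdot> ?k = 0" using minus_comp[OF c hom_minus[OF c]] comp_minus[OF c c] by (simp add: signed_def)
  then have kc: "contraction ?S ?k" using k dk by (simp add: contraction_def)
  have "?k \<cdot> ?s - signed \<sigma> u (- i) (?s \<cdot> h) = 0" using cs minus_comp[OF c sh] by (simp add: signed_def)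
  moreover have "h \<cdot> ?t - signed \<sigma> u i (?t \<cdot> ?k) = 0" using tc comp_minus[OF th c] by (simp add: signed_def)
  ultimately have "is_shift (natural_dg \<sigma> u A) i P (?S, ?k) ?s ?t"
    unfolding is_shift_def closed_hom_def[of "natural_dg \<sigma> u A"] P natural_Hom natural_dif natural_Ob natural_idm natural_cmp
    using kc s by (simp add: cocycle_iff)
  then show "\<exists>S s t. is_shift (natural_dg \<sigma> u A) i P S s t" by blast
qed

lemma natural_shift:
  assumes "is_shift (natural_dg \<sigma> u A) i (X, h) (S, k) s t"
  shows "is_shift A (- i) X S s t"
  using assms
  unfolding is_shift_def closed_hom_def[of "natural_dg \<sigma> u A"] natural_Hom natural_dif natural_Ob natural_idm natural_cmp
  by (auto dest: contraction_hom hom_ob)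

lemma lift_shift:
  assumes pres: "preserves_admissible (shift_ob A (- i)) (shift_mor A (- i)) \<E> \<E>"
  shows "preserves_admissible (shift_ob (natural_dg \<sigma> u A) i) (shift_mor (natural_dg \<sigma> u A) i) lift lift"
  unfolding preserves_admissible_def
proof
  fix s assume s: "s \<in> lift"
  let ?N = "natural_dg \<sigma> u A"
  obtain X h f Y k g Z l where seq: "s = ((X, h), f, (Y, k), g, (Z, l))" by (metis surj_pair)
  have t: "N.cocycle (X, h) (Y, k) 0 f" "N.cocycle (Y, k) (Z, l) 0 g" "(X, f, Y, g, Z) \<in> \<E>"
    using s by (auto simp: lift_iff seq)
  have Ob: "(X, h) \<in> Ob ?N" "(Y, k) \<in> Ob ?N" "(Z, l) \<in> Ob ?N" using t by (auto simp: N.cocycle_iff)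
  note sX = N.shift_choice[OF natural_has_shifts Ob(1), of i] and sY = N.shift_choice[OF natural_has_shifts Ob(2), of i]
    and sZ = N.shift_choice[OF natural_has_shifts Ob(3), of i]
  obtain S a where S: "shift_ob ?N i (X, h) = (S, a)" by (metis surj_pair)
  obtain T b where T: "shift_ob ?N i (Y, k) = (T, b)" by (metis surj_pair)
  obtain R c where R: "shift_ob ?N i (Z, l) = (R, c)" by (metis surj_pair)
  have 1: "N.cocycle (S, a) (T, b) 0 (shift_mor ?N i (X, h) (Y, k) f)"
    unfolding shift_mor_def natural_cmp
    by (rule N.cocycle_comp[OF N.cocycle_comp[OF N.is_shiftD(1)[OF sY[unfolded T] Ob(2)] t(1) refl] N.is_shiftD(2)[OF sX[unfolded S] Ob(1)]]) simp
  have 2: "N.cocycle (T, b) (R, c) 0 (shift_mor ?N i (Y, k) (Z, l) g)"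
    unfolding shift_mor_def natural_cmp
    by (rule N.cocycle_comp[OF N.cocycle_comp[OF N.is_shiftD(1)[OF sZ[unfolded R] Ob(3)] t(2) refl] N.is_shiftD(2)[OF sY[unfolded T] Ob(2)]]) simp
  have "(S, shift_mor ?N i (X, h) (Y, k) f, T, shift_mor ?N i (Y, k) (Z, l) g, R) \<in> \<E>"
    using shift_admissible[OF pres t(3) natural_shift[OF sX[unfolded S]] natural_shift[OF sY[unfolded T]]
        natural_shift[OF sZ[unfolded R]]] by (simp add: shift_mor_def natural_cmp)
  then show "map_seq (shift_ob ?N i) (shift_mor ?N i) s \<in> lift"
    using 1 2 by (simp add: seq map_seq_def S T R lift_iff)
qed

end

section \<open>The cone functor\<close>

context dg_cone_category
begin

abbreviation cone_mor ("\<Phi>") where "\<Phi> \<equiv> Phi_mor u A"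

lemma Phi_structure:
  assumes f: "cocycle X Y 0 f"
  shows "cocycle (K X) (K Y) 0 (\<Phi> X Y f)" "\<Phi> X Y f \<cdot> \<iota> X = \<iota> Y \<cdot> f" "\<Phi> X Y f \<cdot> \<iota>' X = \<iota>' Y \<cdot> f"
    "\<pi> Y \<cdot> \<Phi> X Y f = f \<cdot> \<pi> X" "\<pi>' Y \<cdot> \<Phi> X Y f = f \<cdot> \<pi>' X"
    "N.cocycle (Phi_ob u A X) (Phi_ob u A Y) 0 (\<Phi> X Y f)"
proof -
  note fh = cocycle_hom[OF f]
  note X = hom_ob(1)[OF fh] and Y = hom_ob(2)[OF fh]
  note x = cone_structure[OF X] and y = cone_structure[OF Y]
  note xi = cocycle_hom[OF x(2)] and xp = cocycle_hom[OF x(4)] and yi = cocycle_hom[OF y(2)] and yp = cocycle_hom[OF y(4)]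
  have a: "cocycle X (K Y) u (\<iota> Y \<cdot> f)" and a': "hom X (K Y) 0 (\<iota>' Y \<cdot> f)"
    using cocycle_comp[OF y(2) f] hom_comp[OF y(3) fh] by simp_all
  note ah = cocycle_hom[OF a]
  have 1: "hom (K X) (K Y) 0 ((\<iota> Y \<cdot> f) \<cdot> \<pi>' X)" and 2: "hom (K X) (K Y) 0 ((\<iota>' Y \<cdot> f) \<cdot> \<pi> X)"
    using hom_comp[OF ah x(5)] hom_comp[OF a' xp] by simp_all
  have P: "\<Phi> X Y f = (\<iota> Y \<cdot> f) \<cdot> \<pi>' X + (\<iota>' Y \<cdot> f) \<cdot> \<pi> X" by (simp add: Phi_mor_def)
  have h: "hom (K X) (K Y) 0 (\<Phi> X Y f)" unfolding P by (rule hom_add[OF 1 2])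
  have "dif A (K X) (K Y) 0 (\<Phi> X Y f) = 0"
    unfolding P using dif_sum[OF 1 2] dif_closed_comp[OF a x(5)] dif_comp_closed[OF a' x(4)]
      dif_comp_closed[OF y(3) f] x(7) y(6) by simp
  then show c: "cocycle (K X) (K Y) 0 (\<Phi> X Y f)" using h by (simp add: cocycle_def)
  show "\<Phi> X Y f \<cdot> \<iota> X = \<iota> Y \<cdot> f"
    unfolding P using add_comp[OF 1 2 xi] comp_assoc[OF ah x(5) xi] comp_assoc[OF a' xp xi] x(9,10) comp_id[OF ah]
      comp_0[OF a' X] by simp
  show i': "\<Phi> X Y f \<cdot> \<iota>' X = \<iota>' Y \<cdot> f"
    unfolding P using add_comp[OF 1 2 x(3)] comp_assoc[OF ah x(5,3)] comp_assoc[OF a' xp x(3)] x(8,11) comp_id[OF a']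
      comp_0[OF ah X] by simp
  have fp: "hom (K X) Y 0 (f \<cdot> \<pi> X)" and fp': "hom (K X) Y (- u) (f \<cdot> \<pi>' X)"
    using hom_comp[OF fh xp] hom_comp[OF fh x(5)] by simp_all
  have P': "\<Phi> X Y f = \<iota> Y \<cdot> (f \<cdot> \<pi>' X) + \<iota>' Y \<cdot> (f \<cdot> \<pi> X)"
    unfolding P using comp_assoc[OF yi fh x(5)] comp_assoc[OF y(3) fh xp] by simp
  have 3: "hom (K X) (K Y) 0 (\<iota> Y \<cdot> (f \<cdot> \<pi>' X))" and 4: "hom (K X) (K Y) 0 (\<iota>' Y \<cdot> (f \<cdot> \<pi> X))"
    using hom_comp[OF yi fp'] hom_comp[OF y(3) fp] by simp_all
  show "\<pi> Y \<cdot> \<Phi> X Y f = f \<cdot> \<pi> X"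
    unfolding P' using comp_add[OF yp 3 4] comp_assoc[OF yp yi fp'] comp_assoc[OF yp y(3) fp] y(9,11) id_comp[OF fp]
      zero_comp[OF fp' Y] by simp
  show p': "\<pi>' Y \<cdot> \<Phi> X Y f = f \<cdot> \<pi>' X"
    unfolding P' using comp_add[OF y(5) 3 4] comp_assoc[OF y(5) yi fp'] comp_assoc[OF y(5,3) fp] y(8,10) id_comp[OF fp']
      zero_comp[OF fp Y] by simp
  have "contraction (K X) (\<iota>' X \<cdot> \<pi>' X)" "contraction (K Y) (\<iota>' Y \<cdot> \<pi>' Y)"
    using Phi_ob[OF shifts cones X] Phi_ob[OF shifts cones Y] by (simp_all add: Phi_ob_def natural_Ob)
  moreover have "(\<iota>' Y \<cdot> \<pi>' Y) \<cdot> \<Phi> X Y f = \<Phi> X Y f \<cdot> (\<iota>' X \<cdot> \<pi>' X)"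
    using comp_assoc[OF y(3,5) h] comp_assoc[OF h x(3,5)] comp_assoc[OF y(3) fh x(5)] i' p' by simp
  ultimately show "N.cocycle (Phi_ob u A X) (Phi_ob u A Y) 0 (\<Phi> X Y f)"
    using c by (simp add: Phi_ob_def N_cocycle)
qed

end

context natural_exact_category
begin

lemma kernel_eq:
  assumes c: "Z.kernel (X, f, Y, g, Z)" and h: "hom W X n h" "hom W X n h'" "f \<cdot> h = f \<cdot> h'"
  shows "h = h'"
  using kernel_cancel[OF c hom_diff[OF h(1,2)]] comp_diff[OF cocycle_hom[OF Z.kernelD(1)[OF c]] h(1,2)] h(3) by simp

lemma Phi_zero:
  assumes f: "cocycle X Y 0 f" and g: "cocycle Y Z 0 g" and gf: "g \<cdot> f = 0"
  shows "\<Phi> Y Z g \<cdot> \<Phi> X Y f = 0"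
proof -
  note F = Phi_structure[OF f] and G = Phi_structure[OF g]
  note X = hom_ob(1)[OF cocycle_hom[OF f]] and Z = hom_ob(2)[OF cocycle_hom[OF g]] and Y = hom_ob(1)[OF cocycle_hom[OF g]]
  note x = cone_structure[OF X] and y = cone_structure[OF Y] and z = cone_structure[OF Z]
  have "(\<Phi> Y Z g \<cdot> \<Phi> X Y f) \<cdot> \<iota>' X = 0"
    using comp_assoc[OF cocycle_hom[OF G(1)] cocycle_hom[OF F(1)] x(3)] comp_assoc[OF cocycle_hom[OF G(1)] y(3) cocycle_hom[OF f]]
      comp_assoc[OF z(3) cocycle_hom[OF g] cocycle_hom[OF f]] F(3) G(3) gf comp_0[OF z(3) X] by simp
  then show ?thesis using closed_from_cone_0[OF X cocycle_comp[OF G(1) F(1)]] by simp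
qed

text \<open>
  A closed morphism \<open>v\<close> out of \<open>K Y\<close> amounts to the morphism \<open>v \<iota>'\<close> out of \<open>Y\<close>, in general not closed.  So
  the cokernel property for \<open>K Z\<close> is the one for \<open>Z\<close> in degree 0 without the condition of closedness.
\<close>

lemma Phi_cokernel:
  assumes c: "Z.cokernel (X, f, Y, g, Z)"
  shows "Z.cokernel (K X, \<Phi> X Y f, K Y, \<Phi> Y Z g, K Z)"
proof -
  note f = Z.cokernelD(1)[OF c] and g = Z.cokernelD(2)[OF c] and gf = Z.cokernelD(3)[OF c]
  note fh = cocycle_hom[OF f] and gh = cocycle_hom[OF g]
  note X = hom_ob(1)[OF fh] and Y = hom_ob(2)[OF fh] and Z = hom_ob(2)[OF gh]
  note x = cone_structure[OF X] and y = cone_structure[OF Y] and z = cone_structure[OF Z]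
  note F = Phi_structure[OF f] and G = Phi_structure[OF g]
  note Fh = cocycle_hom[OF F(1)] and Gh = cocycle_hom[OF G(1)]
  show ?thesis
  proof (rule Z.cokernelI[OF F(1) G(1) Phi_zero[OF f g gf]])
    fix W v assume v: "cocycle (K Y) W 0 v" and vF: "v \<cdot> \<Phi> X Y f = 0"
    note vh = cocycle_hom[OF v]
    have vi: "hom Y W 0 (v \<cdot> \<iota>' Y)" using hom_comp[OF vh y(3)] by simp
    have "(v \<cdot> \<iota>' Y) \<cdot> f = 0"
      using comp_assoc[OF vh y(3) fh] comp_assoc[OF vh Fh x(3)] F(3) vF zero_comp[OF x(3) hom_ob(2)[OF vh]] by simp
    then obtain m where m: "hom Z W 0 m" "m \<cdot> g = v \<cdot> \<iota>' Y" using cokernel_factor[OF c vi] by blast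
    obtain w where w: "cocycle (K Z) W 0 w" "w \<cdot> \<iota>' Z = m" using closed_from_cone[OF Z m(1)] by blast
    have wG: "cocycle (K Y) W 0 (w \<cdot> \<Phi> Y Z g)" using cocycle_comp[OF w(1) G(1)] by simp
    have "(w \<cdot> \<Phi> Y Z g - v) \<cdot> \<iota>' Y = 0"
      using diff_comp[OF cocycle_hom[OF wG] vh y(3)] comp_assoc[OF cocycle_hom[OF w(1)] Gh y(3)]
        comp_assoc[OF cocycle_hom[OF w(1)] z(3) gh] G(3) w(2) m(2) by simp
    then have "w \<cdot> \<Phi> Y Z g = v" using closed_from_cone_0[OF Y Z.mor_diff[OF wG v]] by simp
    then show "\<exists>w. cocycle (K Z) W 0 w \<and> w \<cdot> \<Phi> Y Z g = v" using w(1) by blast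
  next
    fix W w assume w: "cocycle (K Z) W 0 w" and wG: "w \<cdot> \<Phi> Y Z g = 0"
    note wh = cocycle_hom[OF w]
    have wi: "hom Z W 0 (w \<cdot> \<iota>' Z)" using hom_comp[OF wh z(3)] by simp
    have "(w \<cdot> \<iota>' Z) \<cdot> g = 0"
      using comp_assoc[OF wh z(3) gh] comp_assoc[OF wh Gh y(3)] G(3) wG zero_comp[OF y(3) hom_ob(2)[OF wh]] by simp
    then show "w = 0" using cokernel_cancel[OF c wi] closed_from_cone_0[OF Z w] by simp
  qed
qed

context
  assumes compat: "DG_compatible u A \<E>"
begin

lemma cone_sequence:
  assumes "X \<in> Ob A"
  shows "(shift_ob A (- u) X, \<iota> X \<cdot> shift_from A (- u) X, K X, \<pi> X, X) \<in> \<E>"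
  using compat assms by (simp add: DG_compatible_def)

lemma shifts_preserve:
  "preserves_admissible (shift_ob A u) (shift_mor A u) \<E> \<E>"
  "preserves_admissible (shift_ob A (- u)) (shift_mor A (- u)) \<E> \<E>"
  using compat by (simp_all add: DG_compatible_def preserved_by_shifts_def)

text \<open>
  With the kernel \<open>k : L \<rightarrow> K Y\<close> of \<open>K Y \<rightarrow> Y \<rightarrow> Z\<close>, the morphism \<open>\<Phi> f\<close> factors as \<open>k b\<close>, where \<open>b\<close> is the
  pushout of the shift of \<open>f\<close> along \<open>X[-1] \<rightarrow> K X\<close>.
\<close>

lemma Phi_preserves:
  assumes s: "(X, f, Y, g, Z) \<in> \<E>"
  shows "(K X, \<Phi> X Y f, K Y, \<Phi> Y Z g, K Z) \<in> \<E>"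
proof -
  note ker = Z.E_kernel[OF s]
  note f = Z.kernelD(1)[OF ker] and g = Z.kernelD(2)[OF ker] and gf = Z.kernelD(3)[OF ker]
  note fh = cocycle_hom[OF f] and gh = cocycle_hom[OF g]
  note X = hom_ob(1)[OF fh] and Y = hom_ob(2)[OF fh] and Z = hom_ob(2)[OF gh]
  note x = cone_structure[OF X] and y = cone_structure[OF Y]
  note xi = cocycle_hom[OF x(2)] and xp = cocycle_hom[OF x(4)] and yi = cocycle_hom[OF y(2)] and yp = cocycle_hom[OF y(4)]
  note F = Phi_structure[OF f]
  note Fh = cocycle_hom[OF F(1)]
  let ?t = "sfrom (- u)" and ?s = "sto (- u)" and ?S = "sh (- u)"
  note sx = shift_structure[OF X, of "- u", simplified] and sy = shift_structure[OF Y, of "- u", simplified]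
  note sxh = cocycle_hom[OF sx(1)] and txh = cocycle_hom[OF sx(2)] and syh = cocycle_hom[OF sy(1)] and tyh = cocycle_hom[OF sy(2)]
  define f1 where "f1 = shift_mor A (- u) X Y f"
  have f1: "f1 = (?s Y \<cdot> f) \<cdot> ?t X" by (simp add: f1_def shift_mor_def)
  have syf: "hom X (?S Y) u (?s Y \<cdot> f)" using hom_comp[OF syh fh] by simp
  have f1m: "admissible_mono \<E> (?S X) (?S Y) f1"
    using shifts_preserve(2) s by (force simp: preserves_admissible_def map_seq_def admissible_mono_def f1_def)
  note f1c = Z.mono_mor[OF f1m]
  note f1h = cocycle_hom[OF f1c]
  have tf1: "?t Y \<cdot> f1 = f \<cdot> ?t X"
    using comp_assoc[OF tyh syf txh] comp_assoc[OF tyh syh fh] sy(3) id_comp[OF fh] by (simp add: f1)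
  have f1s: "f1 \<cdot> ?s X = ?s Y \<cdot> f"
    using comp_assoc[OF syf txh sxh] sx(3) comp_id[OF syf] by (simp add: f1)
  have "admissible_epi \<E> (K Y) Y (\<pi> Y)" "admissible_epi \<E> Y Z g"
    using cone_sequence[OF Y] s by (auto simp: admissible_epi_def)
  then have "admissible_epi \<E> (K Y) Z (g \<cdot> \<pi> Y)" by (rule Z.epi_comp)
  then obtain L k where L: "(L, k, K Y, g \<cdot> \<pi> Y, Z) \<in> \<E>" by (auto simp: admissible_epi_def)
  note kL = Z.E_kernel[OF L]
  note k = Z.kernelD(1)[OF kL]
  note kh = cocycle_hom[OF k]
  note LOb = hom_ob(1)[OF kh]
  \<comment> \<open>\<open>L\<close> splits as a graded object like a cone of the shift of \<open>f\<close>: the morphisms \<open>a\<close> and \<open>\<pi>' k\<close>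
    connect it with \<open>Y\<close>, the morphisms \<open>b \<iota>'\<close> and \<open>r\<close> with \<open>X\<close>.\<close>
  have pk: "cocycle L Y 0 (\<pi> Y \<cdot> k)" using cocycle_comp[OF y(4) k] by simp
  have "g \<cdot> (\<pi> Y \<cdot> k) = 0" using comp_assoc[OF gh yp kh] Z.kernelD(3)[OF kL] by simp
  then obtain r where r: "cocycle L X 0 r" "f \<cdot> r = \<pi> Y \<cdot> k" using Z.kernelD(4)[OF ker pk] by blast
  note rh = cocycle_hom[OF r(1)]
  have "(g \<cdot> \<pi> Y) \<cdot> \<iota> Y = 0" using comp_assoc[OF gh yp yi] y(9) comp_0[OF gh Y] by simp
  then obtain a where a: "hom Y L u a" "k \<cdot> a = \<iota> Y" using kernel_factor[OF kL yi] by blast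
  have "(g \<cdot> \<pi> Y) \<cdot> \<Phi> X Y f = 0"
    using comp_assoc[OF gh yp Fh] F(4) comp_assoc[OF gh fh xp] gf zero_comp[OF xp Z] by simp
  then obtain b where b: "cocycle (K X) L 0 b" "k \<cdot> b = \<Phi> X Y f" using Z.kernelD(4)[OF kL F(1)] by blast
  note bh = cocycle_hom[OF b(1)]
  have "k \<cdot> dif A Y L u a = 0" using dif_closed_comp[OF k a(1)] a(2) cocycle_dif[OF y(2)] by simp
  then have "dif A Y L u a = 0" by (rule kernel_cancel[OF kL hom_dif[OF a(1) refl]])
  then have ac: "cocycle Y L u a" using a(1) by (simp add: cocycle_def)
  have at: "cocycle (?S Y) L 0 (a \<cdot> ?t Y)" using cocycle_comp[OF ac sy(2)] by simp
  have j: "cocycle (?S X) (K X) 0 (\<iota> X \<cdot> ?t X)" using cocycle_comp[OF x(2) sx(2)] by simp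
  have ra: "r \<cdot> a = 0"
  proof (rule kernel_cancel[OF ker hom_comp[OF rh a(1)]])
    show "f \<cdot> (r \<cdot> a) = 0" using comp_assoc[OF fh rh a(1)] comp_assoc[OF yp kh a(1)] r(2) a(2) y(9) by simp
  qed simp
  have rb: "r \<cdot> b = \<pi> X"
  proof (rule kernel_eq[OF ker hom_comp[OF rh bh refl]])
    show "f \<cdot> (r \<cdot> b) = f \<cdot> \<pi> X" using comp_assoc[OF fh rh bh] comp_assoc[OF yp kh bh] r(2) b(2) F(4) by simp
  qed (simp add: xp)
  have pkh: "hom L Y (- u) (\<pi>' Y \<cdot> k)" using hom_comp[OF y(5) kh] by simp
  have ir: "hom L (K X) 0 (\<iota>' X \<cdot> r)" using hom_comp[OF x(3) rh] by simp
  have bir: "hom L L 0 (b \<cdot> (\<iota>' X \<cdot> r))" and apk: "hom L L 0 (a \<cdot> (\<pi>' Y \<cdot> k))"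
    using hom_comp[OF bh ir] hom_comp[OF a(1) pkh] by simp_all
  have decomp: "a \<cdot> (\<pi>' Y \<cdot> k) + b \<cdot> (\<iota>' X \<cdot> r) = idm A L"
  proof (rule kernel_eq[OF kL hom_add[OF apk bir] cocycle_hom[OF cocycle_id[OF LOb]]])
    have "k \<cdot> (b \<cdot> (\<iota>' X \<cdot> r)) = \<iota>' Y \<cdot> (\<pi> Y \<cdot> k)"
      using comp_assoc[OF kh bh ir] b(2) comp_assoc[OF Fh x(3) rh] F(3) comp_assoc[OF y(3) fh rh] r(2) by simp
    moreover have "k \<cdot> (a \<cdot> (\<pi>' Y \<cdot> k)) = \<iota> Y \<cdot> (\<pi>' Y \<cdot> k)" using comp_assoc[OF kh a(1) pkh] a(2) by simp
    ultimately show "k \<cdot> (a \<cdot> (\<pi>' Y \<cdot> k) + b \<cdot> (\<iota>' X \<cdot> r)) = k \<cdot> idm A L"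
      using comp_add[OF kh apk bir] cone_decomp_left[OF Y kh] comp_id[OF kh] by simp
  qed
  have "is_pushout (Z0 A) (?S X) (?S Y) (K X) f1 (\<iota> X \<cdot> ?t X) L b (a \<cdot> ?t Y)"
  proof (rule Z.pushoutI[OF f1c j b(1) at])
    show "(a \<cdot> ?t Y) \<cdot> f1 = b \<cdot> (\<iota> X \<cdot> ?t X)"
    proof (rule kernel_eq[OF kL hom_comp[OF cocycle_hom[OF at] f1h refl]])
      show "hom (?S X) L (0 + 0) (b \<cdot> (\<iota> X \<cdot> ?t X))" using hom_comp[OF bh cocycle_hom[OF j]] by simp
      have "k \<cdot> ((a \<cdot> ?t Y) \<cdot> f1) = \<iota> Y \<cdot> (f \<cdot> ?t X)"
        using comp_assoc[OF a(1) tyh f1h] comp_assoc[OF kh a(1) hom_comp[OF tyh f1h refl]] a(2) tf1 by simp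
      moreover have "k \<cdot> (b \<cdot> (\<iota> X \<cdot> ?t X)) = \<iota> Y \<cdot> (f \<cdot> ?t X)"
        using comp_assoc[OF kh bh cocycle_hom[OF j]] b(2) comp_assoc[OF Fh xi txh] F(2) comp_assoc[OF yi fh txh] by simp
      ultimately show "k \<cdot> ((a \<cdot> ?t Y) \<cdot> f1) = k \<cdot> (b \<cdot> (\<iota> X \<cdot> ?t X))" by simp
    qed
  next
    fix W p q assume p: "cocycle (K X) W 0 p" and q: "cocycle (?S Y) W 0 q" and qp: "q \<cdot> f1 = p \<cdot> (\<iota> X \<cdot> ?t X)"
    note ph = cocycle_hom[OF p] and qh = cocycle_hom[OF q]
    note W = hom_ob(2)[OF ph]
    have qs: "cocycle Y W u (q \<cdot> ?s Y)" using cocycle_comp[OF q sy(1)] by simp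
    note qsh = cocycle_hom[OF qs]
    have pi: "hom X W 0 (p \<cdot> \<iota>' X)" using hom_comp[OF ph x(3)] by simp
    have qsf: "(q \<cdot> ?s Y) \<cdot> f = p \<cdot> \<iota> X"
    proof -
      have "(q \<cdot> ?s Y) \<cdot> f = (q \<cdot> f1) \<cdot> ?s X"
        using comp_assoc[OF qh syh fh] comp_assoc[OF qh f1h sxh] f1s by simp
      also have "\<dots> = p \<cdot> \<iota> X"
        using qp comp_assoc[OF ph cocycle_hom[OF j] sxh] comp_assoc[OF xi txh sxh] sx(3) comp_id[OF xi] by simp
      finally show ?thesis .
    qed
    \<comment> \<open>The factorization is forced by the splitting of \<open>L\<close>.  The differentials of the two summands
      cancel because \<open>q\<close> and \<open>p\<close> agree on \<open>X[-1]\<close>.\<close>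
    define l where "l = (q \<cdot> ?s Y) \<cdot> (\<pi>' Y \<cdot> k) + (p \<cdot> \<iota>' X) \<cdot> r"
    have 1: "hom L W 0 ((q \<cdot> ?s Y) \<cdot> (\<pi>' Y \<cdot> k))" and 2: "hom L W 0 ((p \<cdot> \<iota>' X) \<cdot> r)"
      using hom_comp[OF qsh pkh] hom_comp[OF pi rh] by simp_all
    have lh: "hom L W 0 l" unfolding l_def by (rule hom_add[OF 1 2])
    have "dif A L W 0 l = - ((q \<cdot> ?s Y) \<cdot> (\<pi> Y \<cdot> k)) + (p \<cdot> \<iota> X) \<cdot> r"
      unfolding l_def using dif_sum[OF 1 2] dif_closed_comp[OF qs pkh] dif_comp_closed[OF y(5) k]
        dif_comp_closed[OF pi r(1)] dif_closed_comp[OF p x(3)] x(6) y(7) by simp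
    then have "dif A L W 0 l = 0" using comp_assoc[OF qsh fh rh] r(2) qsf by simp
    then have l: "cocycle L W 0 l" using lh by (simp add: cocycle_def)
    have pkb: "(\<pi>' Y \<cdot> k) \<cdot> b = f \<cdot> \<pi>' X" using comp_assoc[OF y(5) kh bh] b(2) F(5) by simp
    have pka: "(\<pi>' Y \<cdot> k) \<cdot> a = idm A Y" using comp_assoc[OF y(5) kh a(1)] a(2) y(10) by simp
    have "l \<cdot> b = (p \<cdot> \<iota> X) \<cdot> \<pi>' X + (p \<cdot> \<iota>' X) \<cdot> \<pi> X"
      unfolding l_def using add_comp[OF 1 2 bh] comp_assoc[OF qsh pkh bh] comp_assoc[OF pi rh bh] pkb rb
        comp_assoc[OF qsh fh x(5)] qsf by simp
    then have lb: "l \<cdot> b = p" using cone_decomp_right[OF X ph] by simp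
    have "l \<cdot> a = q \<cdot> ?s Y"
      unfolding l_def using add_comp[OF 1 2 a(1)] comp_assoc[OF qsh pkh a(1)] comp_assoc[OF pi rh a(1)] pka ra
        comp_id[OF qsh] comp_0[OF pi Y] by simp
    then have "l \<cdot> (a \<cdot> ?t Y) = q"
      using comp_assoc[OF lh a(1) tyh] comp_assoc[OF qh syh tyh] sy(4) comp_id[OF qh] by simp
    then show "\<exists>l. cocycle L W 0 l \<and> l \<cdot> b = p \<and> l \<cdot> (a \<cdot> ?t Y) = q" using l lb by blast
  next
    fix W l assume l: "cocycle L W 0 l" and lb: "l \<cdot> b = 0" and lat: "l \<cdot> (a \<cdot> ?t Y) = 0"
    note lh = cocycle_hom[OF l]
    note W = hom_ob(2)[OF lh]
    have la: "hom Y W u (l \<cdot> a)" using hom_comp[OF lh a(1)] by simp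
    have "((l \<cdot> a) \<cdot> ?t Y) \<cdot> ?s Y = l \<cdot> a" using comp_assoc[OF la tyh syh] sy(3) comp_id[OF la] by simp
    then have "l \<cdot> a = 0" using comp_assoc[OF lh a(1) tyh] lat zero_comp[OF syh W] by simp
    then have "l \<cdot> (a \<cdot> (\<pi>' Y \<cdot> k) + b \<cdot> (\<iota>' X \<cdot> r)) = 0"
      using comp_add[OF lh apk bir] comp_assoc[OF lh a(1) pkh] comp_assoc[OF lh bh ir] lb
        zero_comp[OF pkh W] zero_comp[OF ir W] by simp
    then show "l = 0" using decomp comp_id[OF lh] by simp
  qed
  then have "admissible_mono \<E> (K X) L b" by (rule Z.mono_pushout[OF f1m j])
  moreover have "admissible_mono \<E> L (K Y) k" using L by (auto simp: admissible_mono_def)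
  ultimately have "admissible_mono \<E> (K X) (K Y) (\<Phi> X Y f)" using Z.mono_comp b(2) by force
  then show ?thesis by (rule Z.admissible_cokernel[OF _ Phi_cokernel[OF Z.E_cokernel[OF s]]])
qed

text \<open>
  That \<open>f\<close> is a kernel of \<open>g\<close> is read off from the component \<open>X[-1] \<rightarrow> Y[-1] \<rightarrow> Z[-1]\<close> of the sequence of
  cones, that is, by composing with \<open>\<iota>\<close> and \<open>\<pi>'\<close>.
\<close>

lemma Phi_reflects:
  assumes f: "cocycle X Y 0 f" and g: "cocycle Y Z 0 g" and s: "(K X, \<Phi> X Y f, K Y, \<Phi> Y Z g, K Z) \<in> \<E>"
  shows "(X, f, Y, g, Z) \<in> \<E>"
proof -
  note ker = Z.E_kernel[OF s]
  note fh = cocycle_hom[OF f] and gh = cocycle_hom[OF g]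
  note X = hom_ob(1)[OF fh] and Y = hom_ob(2)[OF fh] and Z = hom_ob(2)[OF gh]
  note x = cone_structure[OF X] and y = cone_structure[OF Y] and z = cone_structure[OF Z]
  note xi = cocycle_hom[OF x(2)] and xp = cocycle_hom[OF x(4)] and yi = cocycle_hom[OF y(2)] and yp = cocycle_hom[OF y(4)]
    and zi = cocycle_hom[OF z(2)] and zp = cocycle_hom[OF z(4)]
  note F = Phi_structure[OF f] and G = Phi_structure[OF g]
  note Fh = cocycle_hom[OF F(1)] and Gh = cocycle_hom[OF G(1)]
  have inj: "h = 0" if h: "hom W X n h" and fh0: "f \<cdot> h = 0" for W n h
  proof -
    note W = hom_ob(1)[OF h]
    have "\<Phi> X Y f \<cdot> (\<iota> X \<cdot> h) = 0"
      using comp_assoc[OF Fh xi h] F(2) comp_assoc[OF yi fh h] fh0 comp_0[OF yi W] by simp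
    then have "\<iota> X \<cdot> h = 0" by (rule kernel_cancel[OF ker hom_comp[OF xi h refl]])
    moreover have "\<pi>' X \<cdot> (\<iota> X \<cdot> h) = h" using comp_assoc[OF x(5) xi h] x(10) id_comp[OF h] by simp
    ultimately show ?thesis using comp_0[OF x(5) W] by simp
  qed
  have "Z.kernel (X, f, Y, g, Z)"
  proof (rule Z.kernelI[OF f g])
    have gf: "hom X Z 0 (g \<cdot> f)" using hom_comp[OF gh fh] by simp
    have "(\<Phi> Y Z g \<cdot> \<Phi> X Y f) \<cdot> \<iota>' X = \<iota>' Z \<cdot> (g \<cdot> f)"
      using comp_assoc[OF Gh Fh x(3)] comp_assoc[OF Gh y(3) fh] comp_assoc[OF z(3) gh fh] F(3) G(3) by simp
    then have "\<iota>' Z \<cdot> (g \<cdot> f) = 0" using Z.kernelD(3)[OF ker] zero_comp[OF x(3) z(1)] by simp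
    then show "g \<cdot> f = 0"
      using comp_assoc[OF zp z(3) gf] z(11) id_comp[OF gf] comp_0[OF zp X] by simp
  next
    fix W h assume h: "cocycle W Y 0 h" and gh0: "g \<cdot> h = 0"
    note hh = cocycle_hom[OF h]
    note W = hom_ob(1)[OF hh]
    have ih: "cocycle W (K Y) u (\<iota> Y \<cdot> h)" using cocycle_comp[OF y(2) h] by simp
    have "\<Phi> Y Z g \<cdot> (\<iota> Y \<cdot> h) = 0"
      using comp_assoc[OF Gh yi hh] G(2) comp_assoc[OF zi gh hh] gh0 comp_0[OF zi W] by simp
    then obtain w where w: "hom W (K X) u w" "\<Phi> X Y f \<cdot> w = \<iota> Y \<cdot> h"
      using kernel_factor[OF ker cocycle_hom[OF ih]] by blast
    have "\<Phi> X Y f \<cdot> dif A W (K X) u w = 0" using dif_closed_comp[OF F(1) w(1)] w(2) cocycle_dif[OF ih] by simp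
    then have "dif A W (K X) u w = 0" by (rule kernel_cancel[OF ker hom_dif[OF w(1) refl]])
    then have wc: "cocycle W (K X) u w" using w(1) by (simp add: cocycle_def)
    have pw: "hom W X 0 (\<pi>' X \<cdot> w)" using hom_comp[OF x(5) w(1)] by simp
    \<comment> \<open>\<open>\<pi> w\<close> is the differential of \<open>\<pi>' w\<close>, so its vanishing makes \<open>\<pi>' w\<close> closed.\<close>
    have "f \<cdot> (\<pi> X \<cdot> w) = 0"
      using comp_assoc[OF fh xp w(1)] F(4) comp_assoc[OF yp Fh w(1)] w(2) comp_assoc[OF yp yi hh] y(9)
        zero_comp[OF hh Y] by simp
    then have "\<pi> X \<cdot> w = 0" by (rule inj[OF hom_comp[OF xp w(1) refl]])
    then have "dif A W X 0 (\<pi>' X \<cdot> w) = 0" using dif_comp_closed[OF x(5) wc] x(7) by simp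
    then have "cocycle W X 0 (\<pi>' X \<cdot> w)" using pw by (simp add: cocycle_def)
    moreover have "f \<cdot> (\<pi>' X \<cdot> w) = h"
      using comp_assoc[OF fh x(5) w(1)] F(5) comp_assoc[OF y(5) Fh w(1)] w(2) comp_assoc[OF y(5) yi hh] y(10)
        id_comp[OF hh] by simp
    ultimately show "\<exists>k. cocycle W X 0 k \<and> f \<cdot> k = h" by blast
  qed (use inj cocycle_hom in blast)
  moreover have "admissible_epi \<E> (K Y) Z (g \<cdot> \<pi> Y)"
  proof -
    have "admissible_epi \<E> (K Y) (K Z) (\<Phi> Y Z g)" "admissible_epi \<E> (K Z) Z (\<pi> Z)"
      using s cone_sequence[OF Z] by (auto simp: admissible_epi_def)
    then show ?thesis using Z.epi_comp G(4) by force
  qed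
  ultimately show ?thesis by (rule Z.obscure_axiom[OF _ y(4)])
qed

section \<open>Existence and uniqueness\<close>

theorem lift_compatible: "natural_compatible \<sigma> u A \<E> lift"
  unfolding natural_compatible_def
proof (intro conjI)
  show "preserved_by_shifts u A \<E>" using compat by (simp add: DG_compatible_def)
  show "preserved_by_shifts u (natural_dg \<sigma> u A) lift"
    using lift_shift[of u] lift_shift[of "- u"] shifts_preserve by (simp add: preserved_by_shifts_def)
  show "preserves_admissible Psi_ob Psi_mor lift \<E>"
    by (simp add: preserves_admissible_def lift_def)
  show "reflects_admissible (Z0 (natural_dg \<sigma> u A)) Psi_ob Psi_mor lift \<E>"
    by (simp add: reflects_admissible_def lift_def)
  show "preserves_admissible (Phi_ob u A) \<Phi> \<E> lift"
    unfolding preserves_admissible_def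
  proof
    fix s assume "s \<in> \<E>"
    moreover obtain X f Y g Z where "s = (X, f, Y, g, Z)" by (metis surj_pair)
    ultimately show "map_seq (Phi_ob u A) \<Phi> s \<in> lift"
      using Phi_preserves Phi_structure(6) Z.E_mor unfolding map_seq_def Phi_ob_def
      by (simp add: lift_iff)
  qed
  show "reflects_admissible (Z0 A) (Phi_ob u A) \<Phi> \<E> lift"
    unfolding reflects_admissible_def
  proof (intro allI impI, elim conjE)
    fix s assume c: "composable (Z0 A) s" and m: "map_seq (Phi_ob u A) \<Phi> s \<in> lift"
    obtain X f Y g Z where s: "s = (X, f, Y, g, Z)" by (metis surj_pair)
    have "cocycle X Y 0 f" "cocycle Y Z 0 g" using c by (auto simp: s composable_def cocycle_iff)
    then show "s \<in> \<E>" using m Phi_reflects by (auto simp: s map_seq_def Phi_ob_def lift_iff)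
  qed
qed

end

lemma compatible_unique:
  assumes F: "exact_structure (Z0 (natural_dg \<sigma> u A)) \<F>" and c: "natural_compatible \<sigma> u A \<E> \<F>"
  shows "\<F> = lift"
proof -
  have "composable (Z0 (natural_dg \<sigma> u A)) s" if "s \<in> \<F>" for s
    using F that unfolding exact_structure_def kernel_cokernel_pair_def by fastforce
  then show ?thesis
    using c unfolding natural_compatible_def preserves_admissible_def reflects_admissible_def lift_def by blast
qed

end

theorem theorem4p17:
  fixes \<sigma> :: "'g::ab_group_add \<Rightarrow> 'g \<Rightarrow> bit" and u :: 'g
    and E :: "('g, 'o, 'm::ab_group_add) dgcat"
    and \<E> :: "('o, 'm) seq set"
  assumes "dg_category \<sigma> u E"
    and "additive_category (Z0 E)"
    and "has_shifts E"
    and "has_cones u E"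
    and "exact_structure (Z0 E) \<E>"
    and "DG_compatible u E \<E>"
  shows "\<exists>!\<F>. exact_structure (Z0 (natural_dg \<sigma> u E)) \<F> \<and> natural_compatible \<sigma> u E \<E> \<F>"
proof -
  interpret natural_exact_category \<sigma> u E \<E>
    using assms by (simp add: natural_exact_category_def natural_exact_category_axioms_def
        dg_cone_category_def dg_cone_category_axioms_def)
  show ?thesis using lift_exact lift_compatible[OF assms(6)] compatible_unique by blast
qed

end
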